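(* Let $0\ne f\in\mathbb C[[x_1,\dots,x_n]]$ be a formal power series which is not a product, and let $s$ and $r$ be the non-negative integers attached to $f$ as in the context. If $r\le1$ or $s=0$, then for every $d\ge1$ the complex Lie algebra $\mathfrak D_d=\mathrm{Der}_f/\widehat{\mathfrak m}^d\cdot\mathrm{Der}_f$ is solvable. In particular, $\mathfrak D_d$ is solvable for every $d\ge 1$ if $\mathrm{Der}_f$ is a free $\mathbb C[[x_1,\dots,x_n]]$-module of rank $2$.
   Context: $\widehat{\mathcal O}=\mathbb C[[x_1,\dots,x_n]]$ with maximal ideal $\widehat{\mathfrak m}$; $\mathrm{Der}=\mathrm{Der}_{\mathbb C}\widehat{\mathcal O}$ is the free $\widehat{\mathcal O}$-module of formal vector fields with basis the partial derivatives $\partial_1,\dots,\partial_n$, with its Lie bracket. For $0\neq f\in\widehat{\mathcal O}$, $\mathrm{Der}_f=\{\delta\in\mathrm{Der}\mid\delta(f)\in\widehat{\mathcal O}\cdot f\}$; it is closed under the Lie bracket. $f$ is called a product if $\mathrm{Der}_f\not\subseteq\widehat{\mathfrak m}\cdot\mathrm{Der}$. If $f$ is not a product, $\widehat{\mathfrak m}^d\cdot\mathrm{Der}_f$ is a Lie ideal of $\mathrm{Der}_f$ and $\mathfrak D_d$ carries the induced Lie bracket. The formal contact equivalence class of $f$ is the set of all $u\cdot\varphi(f)$ with $u\in\widehat{\mathcal O}^*$ a unit and $\varphi$ a formal coordinate change ($\mathbb C$-algebra automorphism of $\widehat{\mathcal O}$). A vector field is diagonal if it is of the form $\sum_i w_ix_i\partial_i$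 with $w_i\in\mathbb C$. The integer $s$ is the maximum, over all $g$ in the formal contact equivalence class of $f$, of the dimension of the complex vector space of diagonal vector fields $\sigma\in\mathrm{Der}_g$ with $\sigma(g)\in\mathbb C\cdot g$. The integer $r\geq 0$ is defined by requiring that $s+r$ be the minimal number of generators of the $\widehat{\mathcal O}$-module $\mathrm{Der}_f$. (Equivalently, by the paper's Formal Structure Theorem: after replacing $f$ by a suitable element of its formal contact equivalence class, $\mathrm{Der}_f$ has a minimal system of generators $\sigma_1,\dots,\sigma_s,\nu_1,\dots,\nu_r$ such that the $\sigma_i$ are diagonal with rational eigenvalues, the $\nu_j$ have nilpotent linear part, $[\sigma_i,\nu_j]\in\mathbb Q\cdot\nu_j$, $\sigma_i(f_k)\in\mathbb Q\cdot f_k$ for a complete set of irreducible factors $f_k$ of $f$, and every $\delta\in\mathrm{Der}_f$ commuting with all $\sigma_i$ has the semisimple part of its linear part in the $\mathbb C$-span of the $\sigma_i$.) A Lie algebra $\mathfrak D$ is solvable if its derived series $\mathfrak D^{(0)}=\mathfrak D$, $\mathfrak D^{(i+1)}=[\mathfrak D^{(i)},\mathfrak D^{(i)}]$ vanishes for $i\gg0$. *)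

theory Defs
  imports Complex_Main "HOL-Library.FuncSet" "HOL-Library.Function_Algebras"
begin

section \<open>Formal power series in finitely many variables\<close>

text \<open>
  The variables are indexed by the finite type \<open>'n\<close>. A series is the family of its coefficients,
  indexed by the exponent vectors \<open>'n \<Rightarrow> nat\<close>. Sums of exponent vectors, vector fields etc. are the pointwise ones of
  \<^theory>\<open>HOL-Library.Function_Algebras\<close>; in particular \<open>0 :: 'n \<Rightarrow> nat\<close> is the exponent of the
  constant term.
\<close>

typedef (overloaded) 'n cps = "UNIV :: (('n \<Rightarrow> nat) \<Rightarrow> complex) set"
  morphisms coeff Abs_cps ..

setup_lifting type_definition_cps

lemma cps_eqI: "(\<And>\<alpha>. coeff f \<alpha> = coeff g \<alpha>) \<Longrightarrow> f = g"
  by (simp add: coeff_inject[symmetric] fun_eq_iff)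

definition splits :: "('n \<Rightarrow> nat) \<Rightarrow> (('n \<Rightarrow> nat) \<times> ('n \<Rightarrow> nat)) set"
  where "splits \<alpha> = {(\<beta>, \<gamma>). \<beta> + \<gamma> = \<alpha>}"

lemma finite_splits [simp]: "finite (splits (\<alpha> :: 'n::finite \<Rightarrow> nat))"
proof (rule finite_subset)
  let ?A = "PiE UNIV (\<lambda>i. {..\<alpha> i})"
  show "splits \<alpha> \<subseteq> ?A \<times> ?A"
    by (auto simp: splits_def PiE_def)
  show "finite (?A \<times> ?A)"
    by (intro finite_cartesian_product finite_PiE) auto
qed

lemma splits_zero [simp]: "splits (0 :: 'n \<Rightarrow> nat) = {(0, 0)}"
  by (auto simp: splits_def fun_eq_iff)

instantiation cps :: (finite) comm_ring_1
begin

lift_definition zero_cps :: "'a cps" is "\<lambda>_. 0" .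
lift_definition one_cps :: "'a cps" is "\<lambda>\<alpha>. if \<alpha> = 0 then 1 else 0" .
lift_definition plus_cps :: "'a cps \<Rightarrow> 'a cps \<Rightarrow> 'a cps" is "\<lambda>f g \<alpha>. f \<alpha> + g \<alpha>" .
lift_definition minus_cps :: "'a cps \<Rightarrow> 'a cps \<Rightarrow> 'a cps" is "\<lambda>f g \<alpha>. f \<alpha> - g \<alpha>" .
lift_definition uminus_cps :: "'a cps \<Rightarrow> 'a cps" is "\<lambda>f \<alpha>. - f \<alpha>" .
lift_definition times_cps :: "'a cps \<Rightarrow> 'a cps \<Rightarrow> 'a cps"
  is "\<lambda>f g \<alpha>. \<Sum>(\<beta>, \<gamma>)\<in>splits \<alpha>. f \<beta> * g \<gamma>" .

instance
proof
  fix f g h :: "'a cps"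
  show "f * g * h = f * (g * h)"
  proof (rule cps_eqI)
    fix \<alpha> :: "'a \<Rightarrow> nat"
    have "coeff (f * g * h) \<alpha> = (\<Sum>p\<in>splits \<alpha>. \<Sum>q\<in>splits (fst p).
            coeff f (fst q) * coeff g (snd q) * coeff h (snd p))"
      by (simp add: times_cps.rep_eq case_prod_beta sum_distrib_right)
    also have "\<dots> = (\<Sum>(p, q)\<in>(SIGMA p:splits \<alpha>. splits (fst p)).
            coeff f (fst q) * coeff g (snd q) * coeff h (snd p))"
      by (rule sum.Sigma) auto
    also have "\<dots> = (\<Sum>(p, q)\<in>(SIGMA p:splits \<alpha>. splits (snd p)).
            coeff f (fst p) * (coeff g (fst q) * coeff h (snd q)))"
      by (rule sum.reindex_bij_witness
            [where i = "\<lambda>(p, q). ((fst p + fst q, snd q), (fst p, fst q))"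
               and j = "\<lambda>(p, q). ((fst q, snd q + snd p), (snd q, snd p))"])
         (auto simp: splits_def add.assoc mult.assoc)
    also have "\<dots> = (\<Sum>p\<in>splits \<alpha>. \<Sum>q\<in>splits (snd p).
            coeff f (fst p) * (coeff g (fst q) * coeff h (snd q)))"
      by (rule sum.Sigma[symmetric]) auto
    also have "\<dots> = coeff (f * (g * h)) \<alpha>"
      by (simp add: times_cps.rep_eq case_prod_beta sum_distrib_left)
    finally show "coeff (f * g * h) \<alpha> = coeff (f * (g * h)) \<alpha>" .
  qed
  show "f * g = g * f"
  proof (rule cps_eqI)
    fix \<alpha> :: "'a \<Rightarrow> nat"
    show "coeff (f * g) \<alpha> = coeff (g * f) \<alpha>"
      unfolding times_cps.rep_eq
      by (rule sum.reindex_bij_witness[where i = prod.swap and j = prod.swap])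
         (auto simp: splits_def add.commute)
  qed
  show "1 * f = f"
  proof (rule cps_eqI)
    fix \<alpha> :: "'a \<Rightarrow> nat"
    have "coeff (1 * f) \<alpha> = (\<Sum>p\<in>splits \<alpha>. if p = (0, \<alpha>) then coeff f \<alpha> else 0)"
      unfolding times_cps.rep_eq one_cps.rep_eq
      by (rule sum.cong) (auto simp: splits_def split: if_splits)
    also have "\<dots> = coeff f \<alpha>"
      by simp (simp add: splits_def)
    finally show "coeff (1 * f) \<alpha> = coeff f \<alpha>" .
  qed
  show "(f + g) * h = f * h + g * h"
    by (rule cps_eqI)
       (simp add: times_cps.rep_eq plus_cps.rep_eq case_prod_beta sum.distrib distrib_right)
  show "(0 :: 'a cps) \<noteq> 1"
    by (metis one_cps.rep_eq zero_cps.rep_eq zero_neq_one)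
qed (auto intro!: cps_eqI simp: plus_cps.rep_eq zero_cps.rep_eq minus_cps.rep_eq uminus_cps.rep_eq)

end

lift_definition cps_const :: "complex \<Rightarrow> 'n cps" is "\<lambda>c \<alpha>. if \<alpha> = 0 then c else 0" .

lift_definition cps_X :: "'n \<Rightarrow> 'n cps" is "\<lambda>i \<alpha>. if \<alpha> = 0(i := 1) then 1 else 0" .

lift_definition partial :: "'n \<Rightarrow> 'n cps \<Rightarrow> 'n cps"
  is "\<lambda>i f \<alpha>. of_nat (\<alpha> i + 1) * f (\<alpha>(i := \<alpha> i + 1))" .

lemma coeff_const_mult: "coeff (cps_const c * f) \<alpha> = c * coeff (f :: 'n::finite cps) \<alpha>"
proof -
  have "coeff (cps_const c * f) \<alpha> = (\<Sum>p\<in>splits \<alpha>. if p = (0, \<alpha>) then c * coeff f \<alpha> else 0)"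
    unfolding times_cps.rep_eq cps_const.rep_eq
    by (rule sum.cong) (auto simp: splits_def split: if_splits)
  also have "\<dots> = c * coeff f \<alpha>"
    by simp (simp add: splits_def)
  finally show ?thesis .
qed

lemma cps_const_mult: "cps_const (a * b) = cps_const a * (cps_const b :: 'n::finite cps)"
  by (rule cps_eqI) (simp add: coeff_const_mult cps_const.rep_eq)

lemma cps_const_add: "cps_const (a + b) = cps_const a + (cps_const b :: 'n::finite cps)"
  by (rule cps_eqI) (simp add: plus_cps.rep_eq cps_const.rep_eq)

lemma cps_const_one [simp]: "cps_const 1 = (1 :: 'n::finite cps)"
  by (rule cps_eqI) (simp add: one_cps.rep_eq cps_const.rep_eq)

definition max_ideal :: "'n::finite cps set"
  where "max_ideal = {g. coeff g 0 = 0}"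


section \<open>Formal vector fields\<close>

type_synonym 'n vfield = "'n cps \<Rightarrow> 'n cps"

definition vscale :: "'n::finite cps \<Rightarrow> 'n vfield \<Rightarrow> 'n vfield"
  where "vscale a \<delta> = (\<lambda>g. a * \<delta> g)"

definition vscaleC :: "complex \<Rightarrow> 'n::finite vfield \<Rightarrow> 'n vfield"
  where "vscaleC c = vscale (cps_const c)"

text \<open>Not interpreted globally: the simp rules of the locale would reassociate products.\<close>

lemma module_cps: "module ((*) :: 'n::finite cps \<Rightarrow> 'n cps \<Rightarrow> 'n cps)"
  by standard (simp_all add: algebra_simps)

global_interpretation vfield: module "vscale :: 'n::finite cps \<Rightarrow> 'n vfield \<Rightarrow> 'n vfield"
  by standard (simp_all add: vscale_def fun_eq_iff algebra_simps)

global_interpretation vfieldC: vector_space "vscaleC :: complex \<Rightarrow> 'n::finite vfield \<Rightarrow> 'n vfield"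
  by standard
     (simp_all add: vscaleC_def vscale_def fun_eq_iff algebra_simps cps_const_mult cps_const_add)

text \<open>
  A complex-linear derivation maps \<open>m\<^sup>k\<^sup>+\<^sup>1\<close> to \<open>m\<^sup>k\<close>, so it is continuous and hence equal to
  \<open>\<Sum>i. \<delta> x\<^sub>i \<partial>\<^sub>i\<close>; continuity need not be required.
\<close>

definition Der :: "'n::finite vfield set"
  where "Der = {\<delta>. (\<forall>g h. \<delta> (g + h) = \<delta> g + \<delta> h) \<and>
                    (\<forall>c g. \<delta> (cps_const c * g) = cps_const c * \<delta> g) \<and>
                    (\<forall>g h. \<delta> (g * h) = \<delta> g * h + g * \<delta> h)}"

definition vbracket :: "'n::finite vfield \<Rightarrow> 'n vfield \<Rightarrow> 'n vfield"
  where "vbracket \<delta> \<epsilon> = (\<lambda>g. \<delta> (\<epsilon> g) - \<epsilon> (\<delta> g))"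

definition Der_log :: "'n::finite cps \<Rightarrow> 'n vfield set"
  where "Der_log f = {\<delta> \<in> Der. f dvd \<delta> f}"

text \<open>
  The product \<open>I \<cdot> M\<close> of an ideal and a module, that is the submodule generated by all \<open>a x\<close>
  with \<open>a \<in> I\<close> and \<open>x \<in> M\<close>; the first argument is the scalar multiplication.
\<close>

definition ideal_prod :: "('n::finite cps \<Rightarrow> 'b \<Rightarrow> 'b) \<Rightarrow> 'n cps set \<Rightarrow> 'b::ab_group_add set \<Rightarrow> 'b set"
  where "ideal_prod scale I M = module.span scale {scale a x | a x. a \<in> I \<and> x \<in> M}"

primrec max_ideal_power :: "nat \<Rightarrow> 'n::finite cps set"
  where
    "max_ideal_power 0 = UNIV"
  | "max_ideal_power (Suc d) = ideal_prod (*) max_ideal (max_ideal_power d)"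

definition is_product :: "'n::finite cps \<Rightarrow> bool"
  where "is_product f \<longleftrightarrow> \<not> Der_log f \<subseteq> ideal_prod vscale max_ideal Der"

definition is_min_number_of_generators :: "'n::finite vfield set \<Rightarrow> nat \<Rightarrow> bool"
  where "is_min_number_of_generators M k \<longleftrightarrow>
    (\<exists>G. finite G \<and> card G = k \<and> vfield.span G = M) \<and>
    (\<forall>G. finite G \<and> vfield.span G = M \<longrightarrow> k \<le> card G)"

definition free_of_rank :: "'n::finite vfield set \<Rightarrow> nat \<Rightarrow> bool"
  where "free_of_rank M k \<longleftrightarrow>
    (\<exists>B. finite B \<and> card B = k \<and> vfield.independent B \<and> vfield.span B = M)"


section \<open>The invariant \<open>s\<close>\<close>

definition cps_automorphism :: "('n::finite cps \<Rightarrow> 'n cps) \<Rightarrow> bool"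
  where "cps_automorphism \<phi> \<longleftrightarrow> bij \<phi> \<and>
    (\<forall>g h. \<phi> (g + h) = \<phi> g + \<phi> h) \<and>
    (\<forall>g h. \<phi> (g * h) = \<phi> g * \<phi> h) \<and>
    (\<forall>c. \<phi> (cps_const c) = cps_const c)"

definition contact_class :: "'n::finite cps \<Rightarrow> 'n cps set"
  where "contact_class f = {u * \<phi> f | u \<phi>. u dvd 1 \<and> cps_automorphism \<phi>}"

definition diagonal :: "'n::finite vfield \<Rightarrow> bool"
  where "diagonal \<sigma> \<longleftrightarrow> (\<exists>w. \<sigma> = (\<Sum>i\<in>UNIV. vscale (cps_const (w i) * cps_X i) (partial i)))"

definition diagonal_symmetries :: "'n::finite cps \<Rightarrow> 'n vfield set"
  where "diagonal_symmetries g = {\<sigma> \<in> Der_log g. diagonal \<sigma> \<and> (\<exists>c. \<sigma> g = cps_const c * g)}"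

definition s_invariant :: "'n::finite cps \<Rightarrow> nat"
  where "s_invariant f = Max ((\<lambda>g. vfieldC.dim (diagonal_symmetries g)) ` contact_class f)"


lemma dim_diagonal_symmetries_le:
  "vfieldC.dim (diagonal_symmetries (g :: 'n::finite cps)) \<le> card (UNIV :: 'n set)"
proof -
  let ?B = "range (\<lambda>i :: 'n. vscale (cps_X i) (partial i))"
  have "diagonal_symmetries g \<subseteq> vfieldC.span ?B"
  proof
    fix \<sigma> assume "\<sigma> \<in> diagonal_symmetries g"
    then obtain w where "\<sigma> = (\<Sum>i\<in>UNIV. vscale (cps_const (w i) * cps_X i) (partial i))"
      by (auto simp: diagonal_symmetries_def diagonal_def)
    also have "\<dots> = (\<Sum>i\<in>UNIV. vscaleC (w i) (vscale (cps_X i) (partial i)))"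
      by (simp add: vscaleC_def)
    also have "\<dots> \<in> vfieldC.span ?B"
      by (intro vfieldC.span_sum vfieldC.span_scale vfieldC.span_base) auto
    finally show "\<sigma> \<in> vfieldC.span ?B" .
  qed
  then have "vfieldC.dim (diagonal_symmetries g) \<le> card ?B"
    by (rule vfieldC.dim_le_card) simp
  also have "\<dots> \<le> card (UNIV :: 'n set)"
    by (rule card_image_le) simp
  finally show ?thesis .
qed

lemma s_invariant_maximum:
  shows "\<exists>g\<in>contact_class f. s_invariant f = vfieldC.dim (diagonal_symmetries g)"
    and "g \<in> contact_class f \<Longrightarrow> vfieldC.dim (diagonal_symmetries g) \<le> s_invariant f"
proof -
  let ?D = "(\<lambda>g. vfieldC.dim (diagonal_symmetries g)) ` contact_class f"
  have fin: "finite ?D"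
    by (rule finite_subset[of _ "{..card (UNIV :: 'a set)}"]) (auto simp: dim_diagonal_symmetries_le)
  have "f \<in> contact_class f"
    unfolding contact_class_def cps_automorphism_def by (auto intro!: exI[of _ 1] exI[of _ id])
  then have "Max ?D \<in> ?D"
    using fin by (intro Max_in) auto
  then show "\<exists>g\<in>contact_class f. s_invariant f = vfieldC.dim (diagonal_symmetries g)"
    by (auto simp: s_invariant_def)
  show "g \<in> contact_class f \<Longrightarrow> vfieldC.dim (diagonal_symmetries g) \<le> s_invariant f"
    unfolding s_invariant_def using fin by (intro Max_ge) auto
qed


section \<open>Complex Lie algebras\<close>

record 'a lie_alg =
  lcarrier :: "'a set"
  lzero :: 'a
  ladd :: "'a \<Rightarrow> 'a \<Rightarrow> 'a"
  lscale :: "complex \<Rightarrow> 'a \<Rightarrow> 'a"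
  lbracket :: "'a \<Rightarrow> 'a \<Rightarrow> 'a"

locale complex_lie_algebra =
  fixes L :: "'a lie_alg"
  assumes zero_closed: "lzero L \<in> lcarrier L"
    and add_closed: "\<lbrakk>x \<in> lcarrier L; y \<in> lcarrier L\<rbrakk> \<Longrightarrow> ladd L x y \<in> lcarrier L"
    and scale_closed: "x \<in> lcarrier L \<Longrightarrow> lscale L c x \<in> lcarrier L"
    and bracket_closed: "\<lbrakk>x \<in> lcarrier L; y \<in> lcarrier L\<rbrakk> \<Longrightarrow> lbracket L x y \<in> lcarrier L"
    and add_assoc: "\<lbrakk>x \<in> lcarrier L; y \<in> lcarrier L; z \<in> lcarrier L\<rbrakk> \<Longrightarrow>
      ladd L (ladd L x y) z = ladd L x (ladd L y z)"
    and add_commute: "\<lbrakk>x \<in> lcarrier L; y \<in> lcarrier L\<rbrakk> \<Longrightarrow> ladd L x y = ladd L y x"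
    and add_zero: "x \<in> lcarrier L \<Longrightarrow> ladd L (lzero L) x = x"
    and add_inverse: "x \<in> lcarrier L \<Longrightarrow> \<exists>y\<in>lcarrier L. ladd L y x = lzero L"
    and scale_add_right: "\<lbrakk>x \<in> lcarrier L; y \<in> lcarrier L\<rbrakk> \<Longrightarrow>
      lscale L c (ladd L x y) = ladd L (lscale L c x) (lscale L c y)"
    and scale_add_left: "x \<in> lcarrier L \<Longrightarrow> lscale L (b + c) x = ladd L (lscale L b x) (lscale L c x)"
    and scale_scale: "x \<in> lcarrier L \<Longrightarrow> lscale L b (lscale L c x) = lscale L (b * c) x"
    and scale_one: "x \<in> lcarrier L \<Longrightarrow> lscale L 1 x = x"
    and bracket_add_left: "\<lbrakk>x \<in> lcarrier L; y \<in> lcarrier L; z \<in> lcarrier L\<rbrakk> \<Longrightarrow>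
      lbracket L (ladd L x y) z = ladd L (lbracket L x z) (lbracket L y z)"
    and bracket_add_right: "\<lbrakk>x \<in> lcarrier L; y \<in> lcarrier L; z \<in> lcarrier L\<rbrakk> \<Longrightarrow>
      lbracket L x (ladd L y z) = ladd L (lbracket L x y) (lbracket L x z)"
    and bracket_scale_left: "\<lbrakk>x \<in> lcarrier L; y \<in> lcarrier L\<rbrakk> \<Longrightarrow>
      lbracket L (lscale L c x) y = lscale L c (lbracket L x y)"
    and bracket_scale_right: "\<lbrakk>x \<in> lcarrier L; y \<in> lcarrier L\<rbrakk> \<Longrightarrow>
      lbracket L x (lscale L c y) = lscale L c (lbracket L x y)"
    and bracket_self: "x \<in> lcarrier L \<Longrightarrow> lbracket L x x = lzero L"
    and jacobi: "\<lbrakk>x \<in> lcarrier L; y \<in> lcarrier L; z \<in> lcarrier L\<rbrakk> \<Longrightarrow>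
      ladd L (lbracket L x (lbracket L y z))
        (ladd L (lbracket L y (lbracket L z x)) (lbracket L z (lbracket L x y))) = lzero L"

definition lsubspace :: "'a lie_alg \<Rightarrow> 'a set \<Rightarrow> bool"
  where "lsubspace L U \<longleftrightarrow> U \<subseteq> lcarrier L \<and> lzero L \<in> U \<and>
    (\<forall>x\<in>U. \<forall>y\<in>U. ladd L x y \<in> U) \<and> (\<forall>c. \<forall>x\<in>U. lscale L c x \<in> U)"

definition lspan :: "'a lie_alg \<Rightarrow> 'a set \<Rightarrow> 'a set"
  where "lspan L S = \<Inter>{U. lsubspace L U \<and> S \<subseteq> U}"

primrec derived_series :: "'a lie_alg \<Rightarrow> nat \<Rightarrow> 'a set"
  where
    "derived_series L 0 = lcarrier L"
  | "derived_series L (Suc i) =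
       lspan L {lbracket L x y | x y. x \<in> derived_series L i \<and> y \<in> derived_series L i}"

definition solvable_lie :: "'a lie_alg \<Rightarrow> bool"
  where "solvable_lie L \<longleftrightarrow> (\<exists>k. \<forall>i\<ge>k. derived_series L i = {lzero L})"

text \<open>
  The quotient by an ideal \<open>I\<close>, with the cosets as elements. As for \<open>FactRing\<close> in HOL-Algebra, the
  operations are unions over all representatives.
\<close>

definition lcoset :: "'a lie_alg \<Rightarrow> 'a set \<Rightarrow> 'a \<Rightarrow> 'a set"
  where "lcoset L I x = ladd L x ` I"

definition lie_quotient :: "'a lie_alg \<Rightarrow> 'a set \<Rightarrow> 'a set lie_alg"
  where "lie_quotient L I =
    \<lparr> lcarrier = lcoset L I ` lcarrier L,
      lzero = I,
      ladd = (\<lambda>A B. \<Union>a\<in>A. \<Union>b\<in>B. lcoset L I (ladd L a b)),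
      lscale = (\<lambda>c A. \<Union>a\<in>A. lcoset L I (lscale L c a)),
      lbracket = (\<lambda>A B. \<Union>a\<in>A. \<Union>b\<in>B. lcoset L I (lbracket L a b)) \<rparr>"

definition Der_log_lie :: "'n::finite cps \<Rightarrow> 'n vfield lie_alg"
  where "Der_log_lie f =
    \<lparr> lcarrier = Der_log f, lzero = 0, ladd = (+), lscale = vscaleC, lbracket = vbracket \<rparr>"

definition Der_log_quotient :: "'n::finite cps \<Rightarrow> nat \<Rightarrow> 'n vfield set lie_alg"
  where "Der_log_quotient f d =
    lie_quotient (Der_log_lie f) (ideal_prod vscale (max_ideal_power d) (Der_log f))"

section \<open>The quotient is a Lie algebra\<close>

lemma partial_in_Der: "partial i \<in> (Der :: 'n::finite vfield set)"
proof -
  have mult: "partial i (g * h) = partial i g * h + g * partial i h" for g h :: "'n cps"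
  proof (rule cps_eqI)
    fix \<alpha> :: "'n \<Rightarrow> nat"
    define e :: "('n \<Rightarrow> nat) \<Rightarrow> 'n \<Rightarrow> nat" where "e \<beta> = \<beta>(i := \<beta> i + 1)" for \<beta>
    define e' :: "('n \<Rightarrow> nat) \<Rightarrow> 'n \<Rightarrow> nat" where "e' \<beta> = \<beta>(i := \<beta> i - 1)" for \<beta>
    have sum: "of_nat (\<alpha> i + 1) = (of_nat (\<beta> i) + of_nat (\<gamma> i) :: complex)"
      if "(\<beta>, \<gamma>) \<in> splits (e \<alpha>)" for \<beta> \<gamma>
    proof -
      have "\<beta> i + \<gamma> i = \<alpha> i + 1"
        using that unfolding splits_def e_def by (auto dest!: fun_cong[where x = i])
      then show ?thesis by (metis of_nat_add)
    qed
    have e: "e \<beta> + \<gamma> = e (\<beta> + \<gamma>)" "\<beta> + e \<gamma> = e (\<beta> + \<gamma>)" for \<beta> \<gamma>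
      by (auto simp: e_def fun_eq_iff)
    have e'e [simp]: "e' (e \<beta>) = \<beta>" for \<beta>
      by (auto simp: e_def e'_def fun_eq_iff)
    have ee' [simp]: "e (e' \<beta>) = \<beta>" if "\<beta> i \<noteq> 0" for \<beta>
      using that by (auto simp: e_def e'_def fun_eq_iff)
    have e_pos [simp]: "0 < e \<beta> i" for \<beta>
      by (simp add: e_def)
    have coeff: "coeff (partial i k) \<beta> = of_nat (e \<beta> i) * coeff k (e \<beta>)" for k :: "'n cps" and \<beta>
      by (simp add: partial.rep_eq e_def)
    have e': "e' \<beta> + \<gamma> = \<alpha>" "\<gamma> + e' \<beta> = \<alpha>" if "\<beta> + \<gamma> = e \<alpha> \<or> \<gamma> + \<beta> = e \<alpha>" "\<beta> i \<noteq> 0" for \<beta> \<gamma>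
    proof -
      have "\<beta> j + \<gamma> j = e \<alpha> j" for j
        using that(1) by (auto simp: fun_eq_iff add.commute)
      from this[of i] this show "e' \<beta> + \<gamma> = \<alpha>"
        using that(2) by (auto simp: e_def e'_def fun_eq_iff)
      then show "\<gamma> + e' \<beta> = \<alpha>"
        by (simp add: add.commute)
    qed
    have l: "(\<Sum>(\<beta>, \<gamma>)\<in>splits (e \<alpha>). of_nat (\<beta> i) * (coeff g \<beta> * coeff h \<gamma>))
               = coeff (partial i g * h) \<alpha>"
    proof -
      let ?S = "{p \<in> splits (e \<alpha>). fst p i \<noteq> 0}"
      have "(\<Sum>(\<beta>, \<gamma>)\<in>splits (e \<alpha>). of_nat (\<beta> i) * (coeff g \<beta> * coeff h \<gamma>))
              = (\<Sum>(\<beta>, \<gamma>)\<in>?S. of_nat (\<beta> i) * (coeff g \<beta> * coeff h \<gamma>))"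
        by (rule sum.mono_neutral_right) auto
      also have "\<dots> = (\<Sum>(\<beta>, \<gamma>)\<in>splits \<alpha>. of_nat (e \<beta> i) * coeff g (e \<beta>) * coeff h \<gamma>)"
        by (rule sum.reindex_bij_witness
              [where i = "\<lambda>(\<beta>, \<gamma>). (e \<beta>, \<gamma>)" and j = "\<lambda>(\<beta>, \<gamma>). (e' \<beta>, \<gamma>)"])
           (auto simp: splits_def e e' mult_ac)
      finally show ?thesis
        by (simp only: times_cps.rep_eq coeff)
    qed
    have r: "(\<Sum>(\<beta>, \<gamma>)\<in>splits (e \<alpha>). of_nat (\<gamma> i) * (coeff g \<beta> * coeff h \<gamma>))
               = coeff (g * partial i h) \<alpha>"
    proof -
      let ?S = "{p \<in> splits (e \<alpha>). snd p i \<noteq> 0}"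
      have "(\<Sum>(\<beta>, \<gamma>)\<in>splits (e \<alpha>). of_nat (\<gamma> i) * (coeff g \<beta> * coeff h \<gamma>))
              = (\<Sum>(\<beta>, \<gamma>)\<in>?S. of_nat (\<gamma> i) * (coeff g \<beta> * coeff h \<gamma>))"
        by (rule sum.mono_neutral_right) auto
      also have "\<dots> = (\<Sum>(\<beta>, \<gamma>)\<in>splits \<alpha>. coeff g \<beta> * (of_nat (e \<gamma> i) * coeff h (e \<gamma>)))"
        by (rule sum.reindex_bij_witness
              [where i = "\<lambda>(\<beta>, \<gamma>). (\<beta>, e \<gamma>)" and j = "\<lambda>(\<beta>, \<gamma>). (\<beta>, e' \<gamma>)"])
           (auto simp: splits_def e e' mult_ac)
      finally show ?thesis
        by (simp only: times_cps.rep_eq coeff)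
    qed
    have "coeff (partial i (g * h)) \<alpha> =
            (\<Sum>(\<beta>, \<gamma>)\<in>splits (e \<alpha>). of_nat (\<alpha> i + 1) * (coeff g \<beta> * coeff h \<gamma>))"
      by (simp add: coeff times_cps.rep_eq sum_distrib_left case_prod_beta e_def)
    also have "\<dots> = (\<Sum>(\<beta>, \<gamma>)\<in>splits (e \<alpha>). of_nat (\<beta> i) * (coeff g \<beta> * coeff h \<gamma>)
                                           + of_nat (\<gamma> i) * (coeff g \<beta> * coeff h \<gamma>))"
      by (rule sum.cong) (auto simp only: sum distrib_right)
    also have "\<dots> = coeff (partial i g * h) \<alpha> + coeff (g * partial i h) \<alpha>"
      by (simp add: case_prod_beta sum.distrib flip: l r)
    finally show "coeff (partial i (g * h)) \<alpha> = coeff (partial i g * h + g * partial i h) \<alpha>"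
      by (simp add: plus_cps.rep_eq)
  qed
  have "partial i (g + h) = partial i g + partial i h" for g h :: "'n cps"
    by (rule cps_eqI) (simp add: partial.rep_eq plus_cps.rep_eq algebra_simps)
  moreover have "partial i (cps_const c * g) = cps_const c * partial i g" for c and g :: "'n cps"
    by (rule cps_eqI) (simp add: partial.rep_eq coeff_const_mult)
  ultimately show ?thesis
    using mult by (simp add: Der_def)
qed

lemma Der_add: "\<delta> \<in> Der \<Longrightarrow> \<delta> (g + h) = \<delta> g + \<delta> h"
  and Der_const: "\<delta> \<in> Der \<Longrightarrow> \<delta> (cps_const c * g) = cps_const c * \<delta> g"
  and Der_mult: "\<delta> \<in> Der \<Longrightarrow> \<delta> (g * h) = \<delta> g * h + g * \<delta> h"
  by (auto simp: Der_def)

lemma Der_diff: "\<delta> \<in> Der \<Longrightarrow> \<delta> (g - h) = \<delta> g - \<delta> h"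
  by (metis Der_add add_diff_cancel diff_add_cancel)

lemma Der_zero: "\<delta> \<in> Der \<Longrightarrow> \<delta> 0 = 0"
  by (metis Der_diff diff_self)

lemma subspace_Der: "vfield.subspace Der"
  by (rule vfield.subspaceI) (auto simp: Der_def vscale_def algebra_simps)

lemma subspace_Der_log: "vfield.subspace (Der_log f)"
  using subspace_Der
  by (auto simp: vfield.subspace_def Der_log_def) (auto simp: vscale_def)

lemma vbracket_Der:
  assumes "\<delta> \<in> Der" and "\<epsilon> \<in> Der"
  shows "vbracket \<delta> \<epsilon> \<in> Der"
proof -
  note rules = Der_add[OF assms(1)] Der_add[OF assms(2)] Der_mult[OF assms(1)] Der_mult[OF assms(2)]
  have "vbracket \<delta> \<epsilon> (g + h) = vbracket \<delta> \<epsilon> g + vbracket \<delta> \<epsilon> h" for g h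
    by (simp add: vbracket_def rules)
  moreover have "vbracket \<delta> \<epsilon> (cps_const c * g) = cps_const c * vbracket \<delta> \<epsilon> g" for c g
    by (simp only: vbracket_def Der_const[OF assms(1)] Der_const[OF assms(2)] right_diff_distrib)
  moreover have "vbracket \<delta> \<epsilon> (g * h) = vbracket \<delta> \<epsilon> g * h + g * vbracket \<delta> \<epsilon> h" for g h
    by (simp add: vbracket_def rules left_diff_distrib right_diff_distrib)
  ultimately show ?thesis
    by (simp add: Der_def)
qed

lemma vbracket_Der_log:
  assumes "\<delta> \<in> Der_log f" and "\<epsilon> \<in> Der_log f"
  shows "vbracket \<delta> \<epsilon> \<in> Der_log f"
proof -
  from assms have "f dvd \<delta> f" "f dvd \<epsilon> f"
    by (simp_all add: Der_log_def)
  then obtain a b where ab: "\<delta> f = f * a" "\<epsilon> f = f * b"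
    by (elim dvdE)
  have "f dvd \<delta> (f * b) - \<epsilon> (f * a)"
    using assms ab by (simp add: Der_log_def Der_mult mult.assoc)
  then show ?thesis
    using assms vbracket_Der[of \<delta> \<epsilon>] by (simp add: Der_log_def vbracket_def ab)
qed

lemma subspace_ideal_prod:
  "module scale \<Longrightarrow> module.subspace scale (ideal_prod scale I M)"
  unfolding ideal_prod_def by (rule module.subspace_span)

lemma ideal_prod_mem:
  "module scale \<Longrightarrow> a \<in> I \<Longrightarrow> x \<in> M \<Longrightarrow> scale a x \<in> ideal_prod scale I M"
  unfolding ideal_prod_def by (rule module.span_base) auto

lemma ideal_prod_induct:
  assumes "module scale" and "x \<in> ideal_prod scale I M" and "P 0"
    and "\<And>x y. P x \<Longrightarrow> P y \<Longrightarrow> P (x + y)"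
    and "\<And>a x. a \<in> I \<Longrightarrow> x \<in> M \<Longrightarrow> P (scale a x)"
    and "\<And>c a. a \<in> I \<Longrightarrow> c * a \<in> I"
  shows "P x"
proof -
  interpret module scale by fact
  show ?thesis
    using assms(2) unfolding ideal_prod_def
    by (induction rule: span_induct_alt) (use assms(3-) in auto)
qed

lemma subspace_max_ideal: "module.subspace (*) (max_ideal :: 'n::finite cps set)"
  by (simp add: module.subspace_def[OF module_cps] max_ideal_def zero_cps.rep_eq
      plus_cps.rep_eq times_cps.rep_eq)

lemma subspace_max_ideal_power: "module.subspace (*) (max_ideal_power d :: 'n::finite cps set)"
  by (cases d) (simp_all add: subspace_ideal_prod module_cps module.subspace_UNIV)

lemmas max_ideal_closed =
  subspace_max_ideal[unfolded module.subspace_def[OF module_cps]]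

lemmas max_ideal_power_closed =
  subspace_max_ideal_power[unfolded module.subspace_def[OF module_cps]]

lemma Der_log_max_ideal:
  assumes "\<not> is_product f" and "\<delta> \<in> Der_log f" and "g \<in> max_ideal"
  shows "\<delta> g \<in> max_ideal"
proof -
  have "\<delta> \<in> ideal_prod vscale max_ideal Der"
    using assms by (auto simp: is_product_def)
  with vfield.module_axioms show ?thesis
    by (rule ideal_prod_induct)
       (use max_ideal_closed in \<open>auto simp: vscale_def mult.commute[of _ "_ g"]\<close>)
qed

lemma Der_log_max_ideal_power:
  assumes "\<not> is_product f" and "\<delta> \<in> Der_log f" and "g \<in> max_ideal_power d"
  shows "\<delta> g \<in> max_ideal_power d"
  using assms(3)
proof (induction d arbitrary: g)
  case (Suc d)
  have \<delta>: "\<delta> \<in> Der"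
    using assms by (simp add: Der_log_def)
  let ?J = "max_ideal_power (Suc d)"
  from Suc.prems have "g \<in> ideal_prod (*) max_ideal (max_ideal_power d)"
    by simp
  with module_cps show ?case
  proof (rule ideal_prod_induct)
    show "\<delta> 0 \<in> ?J"
      unfolding Der_zero[OF \<delta>] using max_ideal_power_closed[of "Suc d"] by blast
    show "\<delta> (g + h) \<in> ?J" if "\<delta> g \<in> ?J" "\<delta> h \<in> ?J" for g h
      unfolding Der_add[OF \<delta>] using max_ideal_power_closed[of "Suc d"] that by blast
    show "\<delta> (a * h) \<in> ?J" if "a \<in> max_ideal" "h \<in> max_ideal_power d" for a h
    proof -
      have "\<delta> a * h \<in> ?J" "a * \<delta> h \<in> ?J"
        using that Suc.IH Der_log_max_ideal[OF assms(1,2)]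
        by (auto intro!: ideal_prod_mem module_cps)
      then show ?thesis
        unfolding Der_mult[OF \<delta>] using max_ideal_power_closed[of "Suc d"] by blast
    qed
  qed (use max_ideal_closed in auto)
qed simp

abbreviation Der_log_ideal :: "'n::finite cps \<Rightarrow> nat \<Rightarrow> 'n vfield set"
  where "Der_log_ideal f d \<equiv> ideal_prod vscale (max_ideal_power d) (Der_log f)"

lemma Der_log_ideal_subset: "Der_log_ideal f d \<subseteq> Der_log f"
  unfolding ideal_prod_def
  by (rule vfield.span_minimal) (use subspace_Der_log[of f] in \<open>auto simp: vfield.subspace_def\<close>)

lemma vbracket_Der_log_ideal:
  assumes "\<not> is_product f" and "\<delta> \<in> Der_log f" and "\<epsilon> \<in> Der_log_ideal f d"
  shows "vbracket \<delta> \<epsilon> \<in> Der_log_ideal f d"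
proof -
  have \<delta>: "\<delta> \<in> Der"
    using assms by (simp add: Der_log_def)
  note closed = subspace_ideal_prod[OF vfield.module_axioms, of "max_ideal_power d" "Der_log f",
      unfolded vfield.subspace_def]
  from vfield.module_axioms assms(3) show ?thesis
  proof (rule ideal_prod_induct)
    have "vbracket \<delta> 0 = 0"
      by (auto simp: vbracket_def fun_eq_iff Der_zero[OF \<delta>])
    then show "vbracket \<delta> 0 \<in> Der_log_ideal f d"
      using closed by simp
    show "vbracket \<delta> (\<epsilon> + \<epsilon>') \<in> Der_log_ideal f d"
      if "vbracket \<delta> \<epsilon> \<in> Der_log_ideal f d" "vbracket \<delta> \<epsilon>' \<in> Der_log_ideal f d" for \<epsilon> \<epsilon>'
    proof -
      have "vbracket \<delta> (\<epsilon> + \<epsilon>') = vbracket \<delta> \<epsilon> + vbracket \<delta> \<epsilon>'"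
        by (auto simp: vbracket_def fun_eq_iff Der_add[OF \<delta>] algebra_simps)
      with that closed show ?thesis by simp
    qed
    show "vbracket \<delta> (vscale a \<epsilon>) \<in> Der_log_ideal f d"
      if "a \<in> max_ideal_power d" "\<epsilon> \<in> Der_log f" for a \<epsilon>
    proof -
      have "vbracket \<delta> (vscale a \<epsilon>) = vscale (\<delta> a) \<epsilon> + vscale a (vbracket \<delta> \<epsilon>)"
        by (auto simp: vbracket_def vscale_def fun_eq_iff Der_mult[OF \<delta>] algebra_simps)
      moreover have "vscale (\<delta> a) \<epsilon> \<in> Der_log_ideal f d" "vscale a (vbracket \<delta> \<epsilon>) \<in> Der_log_ideal f d"
        using that assms Der_log_max_ideal_power vbracket_Der_log
        by (auto intro!: ideal_prod_mem vfield.module_axioms)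
      ultimately show ?thesis
        using closed by simp
    qed
  qed (use max_ideal_power_closed[of d] in auto)
qed

lemma complex_lie_algebra_Der_log_quotient:
  assumes "\<not> is_product f"
  shows "complex_lie_algebra (Der_log_quotient f d)"
proof -
  define V where "V = Der_log f"
  define I where "I = Der_log_ideal f d"
  define co where "co = lcoset (Der_log_lie f) I"
  define Q where "Q = Der_log_quotient f d"
  have I: "vfield.subspace I"
    unfolding I_def by (rule subspace_ideal_prod) (rule vfield.module_axioms)
  have I0: "0 \<in> I" and I_add: "x \<in> I \<Longrightarrow> y \<in> I \<Longrightarrow> x + y \<in> I"
    and I_diff: "x \<in> I \<Longrightarrow> y \<in> I \<Longrightarrow> x - y \<in> I"
    and I_scale: "x \<in> I \<Longrightarrow> vscaleC c x \<in> I" for x y c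
    using vfield.subspace_0[OF I] vfield.subspace_add[OF I] vfield.subspace_diff[OF I]
      vfield.subspace_scale[OF I] by (auto simp: vscaleC_def)
  have V: "vfield.subspace V"
    unfolding V_def by (rule subspace_Der_log)
  have V0: "0 \<in> V" and V_add: "x \<in> V \<Longrightarrow> y \<in> V \<Longrightarrow> x + y \<in> V"
    and V_scale: "x \<in> V \<Longrightarrow> vscaleC c x \<in> V" 
    and V_neg: "x \<in> V \<Longrightarrow> - x \<in> V" for x y c
    using vfield.subspace_0[OF V] vfield.subspace_add[OF V] vfield.subspace_neg[OF V]
      vfield.subspace_scale[OF V] by (auto simp: vscaleC_def)
  have V_br: "x \<in> V \<Longrightarrow> y \<in> V \<Longrightarrow> vbracket x y \<in> V" for x y
    unfolding V_def by (rule vbracket_Der_log)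
  have I_sub: "x \<in> I \<Longrightarrow> x \<in> V" for x
    using Der_log_ideal_subset by (auto simp: I_def V_def)
  have Der: "x \<in> V \<Longrightarrow> x \<in> Der" for x
    by (simp add: V_def Der_log_def)
  have neg_br: "vbracket x y = - vbracket y x" for x y :: "'a vfield"
    by (simp add: vbracket_def fun_eq_iff)
  have I_br: "vbracket x y \<in> I" if "x \<in> V" "y \<in> I" for x y
    using vbracket_Der_log_ideal[OF assms] that by (simp add: V_def I_def)
  have I_br': "vbracket y x \<in> I" if "x \<in> V" "y \<in> I" for x y
    using vfield.subspace_neg[OF I I_br[OF that]] neg_br[of y x] by simp
  have br_add_l: "vbracket (x + y) z = vbracket x z + vbracket y z" if "z \<in> V" for x y z
    using Der_add[OF Der[OF that]] by (auto simp: vbracket_def fun_eq_iff)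
  have br_add_r: "vbracket z (x + y) = vbracket z x + vbracket z y" if "z \<in> V" for x y z
    using Der_add[OF Der[OF that]] by (auto simp: vbracket_def fun_eq_iff)
  have br_scale_l: "vbracket (vscaleC c x) z = vscaleC c (vbracket x z)" if "z \<in> V" for c x z
    using Der_const[OF Der[OF that]]
    by (auto simp: vbracket_def vscaleC_def vscale_def fun_eq_iff right_diff_distrib)
  have br_scale_r: "vbracket z (vscaleC c x) = vscaleC c (vbracket z x)" if "z \<in> V" for c x z
    using Der_const[OF Der[OF that]]
    by (auto simp: vbracket_def vscaleC_def vscale_def fun_eq_iff right_diff_distrib)
  have co_mem: "y \<in> co x \<longleftrightarrow> y - x \<in> I" for x y
    unfolding co_def lcoset_def Der_log_lie_def
    by (auto intro!: image_eqI[of y _ "y - x"])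
  have co_eqI: "co x = co y" if "x - y \<in> I" for x y
  proof -
    have "z - x \<in> I \<longleftrightarrow> z - y \<in> I" for z
      using I_add[OF _ that, of "z - x"] I_diff[OF _ that, of "z - y"]
      by (auto simp: algebra_simps)
    then show ?thesis by (auto simp: co_mem)
  qed
  have co_self: "x \<in> co x" for x
    by (simp add: co_mem I0)
  have UN: "(\<Union>a\<in>co x. co (F a)) = co (F x)" if "\<And>a. a \<in> co x \<Longrightarrow> F a - F x \<in> I" for F x
    using co_eqI[OF that] co_self by blast
  have UN2: "(\<Union>a\<in>co x. \<Union>b\<in>co y. co (F a b)) = co (F x y)"
    if "\<And>a b. a \<in> co x \<Longrightarrow> b \<in> co y \<Longrightarrow> F a b - F x y \<in> I" for F x y
    using co_eqI[OF that] co_self by blast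
  have carrier: "lcarrier Q = co ` V"
    by (simp add: Q_def Der_log_quotient_def lie_quotient_def co_def I_def V_def Der_log_lie_def)
  have zero: "lzero Q = co 0"
    by (simp add: Q_def Der_log_quotient_def lie_quotient_def co_def I_def lcoset_def Der_log_lie_def)
  have Qadd: "ladd Q (co x) (co y) = co (x + y)" for x y
  proof -
    have "ladd Q (co x) (co y) = (\<Union>a\<in>co x. \<Union>b\<in>co y. co (a + b))"
      by (simp add: Q_def Der_log_quotient_def lie_quotient_def co_def I_def Der_log_lie_def)
    also have "\<dots> = co (x + y)"
      by (rule UN2) (use I_add in \<open>force simp: co_mem add_diff_add\<close>)
    finally show ?thesis .
  qed
  have Qscale: "lscale Q c (co x) = co (vscaleC c x)" for c x
  proof -
    have "lscale Q c (co x) = (\<Union>a\<in>co x. co (vscaleC c a))"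
      by (simp add: Q_def Der_log_quotient_def lie_quotient_def co_def I_def Der_log_lie_def)
    also have "\<dots> = co (vscaleC c x)"
      by (rule UN) (use I_scale in \<open>simp add: co_mem flip: vfieldC.scale_right_diff_distrib\<close>)
    finally show ?thesis .
  qed
  have Qbracket: "lbracket Q (co x) (co y) = co (vbracket x y)" if "x \<in> V" "y \<in> V" for x y
  proof -
    have "lbracket Q (co x) (co y) = (\<Union>a\<in>co x. \<Union>b\<in>co y. co (vbracket a b))"
      by (simp add: Q_def Der_log_quotient_def lie_quotient_def co_def I_def Der_log_lie_def)
    also have "\<dots> = co (vbracket x y)"
    proof (rule UN2)
      fix a b assume "a \<in> co x" "b \<in> co y"
      then have a: "a - x \<in> I" and b: "b - y \<in> I"
        by (simp_all add: co_mem)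
      have bV: "b \<in> V"
        using V_add[OF I_sub[OF b] that(2)] by simp
      have "vbracket a b - vbracket x y = vbracket (a - x) b + vbracket x (b - y)"
        using br_add_l[OF bV, of "a - x" x] br_add_r[OF that(1), of "b - y" y] by simp
      then show "vbracket a b - vbracket x y \<in> I"
        using I_add[OF I_br'[OF bV a] I_br[OF that(1) b]] by simp
    qed
    finally show ?thesis .
  qed
  have jac: "vbracket x (vbracket y z) + (vbracket y (vbracket z x) + vbracket z (vbracket x y)) = 0"
    if "x \<in> V" "y \<in> V" "z \<in> V" for x y z
    using Der_diff[OF Der[OF that(1)]] Der_diff[OF Der[OF that(2)]] Der_diff[OF Der[OF that(3)]]
    by (simp add: vbracket_def fun_eq_iff)
  have br_self: "vbracket x x = 0" for x :: "'a vfield"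
    by (simp add: vbracket_def fun_eq_iff)
  note rules = carrier zero Qadd Qscale Qbracket V0 V_add V_scale V_br
  have "complex_lie_algebra Q"
  proof
    show "\<exists>y\<in>lcarrier Q. ladd Q y x = lzero Q" if x: "x \<in> lcarrier Q" for x
    proof -
      obtain v where v: "v \<in> V" "x = co v" using x unfolding carrier by blast
      show ?thesis
        by (rule bexI[of _ "co (- v)"]) (simp_all add: rules v V_neg)
    qed
    show "ladd Q x y = ladd Q y x" if "x \<in> lcarrier Q" "y \<in> lcarrier Q" for x y
      using that unfolding carrier by (elim imageE) (simp add: Qadd add.commute)
    show "ladd Q (lbracket Q x (lbracket Q y z))
        (ladd Q (lbracket Q y (lbracket Q z x)) (lbracket Q z (lbracket Q x y))) = lzero Q"
      if "x \<in> lcarrier Q" "y \<in> lcarrier Q" "z \<in> lcarrier Q" for x y z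
      using that unfolding carrier by (elim imageE) (simp add: rules jac)
  qed (auto simp: rules br_add_l br_add_r br_scale_l br_scale_r
        br_self add.assoc vfieldC.scale_right_distrib vfieldC.scale_left_distrib)
  then show ?thesis
    by (simp add: Q_def)
qed

end

theory Submission
  imports Defs "HOL-Computational_Algebra.Fundamental_Theorem_Algebra" "HOL-Analysis.Cartesian_Space"
begin

text \<open>
  Write \<open>M = Der_log f\<close> and \<open>m\<close> for the maximal ideal. Since \<open>f\<close> is not a product, the fields in \<open>M\<close> preserve the
  powers of \<open>m\<close>, whence \<open>[m\<^sup>d M, m\<^sup>d M] \<subseteq> m\<^sup>d\<^sup>+\<^sup>1 M\<close> for \<open>d \<ge> 1\<close>. So it is enough that the derived series of \<open>M\<close>
  reaches \<open>m M\<close> (\<open>solvable_quotient_if_derived_subset\<close>), that is, that the Lie algebra \<open>M / m M\<close> is solvable. Its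
  dimension is at most the number \<open>s + r\<close> of generators of \<open>M\<close>.

  If \<open>r \<le> 1\<close>, transporting a basis of the diagonal symmetries of a suitable \<open>u \<cdot> \<phi> f\<close> back to \<open>M\<close> gives \<open>s\<close> commuting
  fields. They stay independent in \<open>M / m M\<close>, as a diagonal field is determined by its linear part while the
  fields in \<open>m M\<close> have linear part zero (\<open>commuting_fields_exist\<close>). So \<open>M / m M\<close> has an abelian subalgebra of
  codimension at most one, and any such Lie algebra is metabelian (\<open>solvable_if_abelian_codim_one\<close>). The same
  argument settles the case of two generators, the line through one of them being the abelian subalgebra.

  If \<open>s = 0\<close>, every \<open>\<delta> \<in> M\<close> is topologically nilpotent on power series (\<open>Der_log_nilpotent\<close>). Indeed, generalised
  eigenvectors of the linear part of \<open>\<delta>\<close> lift to generalised eigenvectors \<open>y\<^sub>i\<close> of \<open>\<delta>\<close> in the complete ring of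
  series (\<open>F_subset_span_top_geigen\<close>), which serve as coordinates; and if \<open>\<delta> f = a f\<close>, the same lifting for the
  operator \<open>u \<mapsto> \<delta> u + a u\<close> finds a unit \<open>u\<close> such that \<open>u f\<close> is a generalised eigenvector of \<open>\<delta>\<close>. In the
  coordinates \<open>y\<^sub>i\<close>, then, \<open>u f\<close> is quasi-homogeneous with the eigenvalues as weights, so that the semisimple part of
  \<open>\<delta>\<close> is a diagonal symmetry of a member of the contact class; as \<open>s = 0\<close>, the eigenvalues vanish. The lifting, now
  applied to coefficient vectors with respect to generators of \<open>M\<close>, shows that \<open>[\<delta>, -]\<close> is nilpotent on \<open>M / m M\<close>
  (\<open>ad_nilpotent\<close>), and Engel's theorem (\<open>solvable_if_ad_nilpotent\<close>) completes the proof.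
\<close>

section \<open>Generalised eigenvectors modulo an invariant subspace\<close>

locale linear_operator = vector_space scale
  for scale :: "complex \<Rightarrow> 'v::ab_group_add \<Rightarrow> 'v" (infixr \<open>*s\<close> 75) +
  fixes T :: "'v \<Rightarrow> 'v"
  assumes T_add: "T (u + v) = T u + T v"
    and T_scale: "T (c *s v) = c *s T v"
begin

lemma T_zero: "T 0 = 0"
  using T_scale[of 0 0] by simp

lemma T_diff: "T (u - v) = T u - T v"
  by (metis T_add add_diff_cancel diff_add_cancel)

definition shift :: "complex \<Rightarrow> 'v \<Rightarrow> 'v"
  where "shift \<mu> v = T v - \<mu> *s v"

lemma shift_add: "shift \<mu> (u + v) = shift \<mu> u + shift \<mu> v"
  by (simp add: shift_def T_add scale_right_distrib)

lemma shift_scale: "shift \<mu> (c *s v) = c *s shift \<mu> v"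
  by (simp add: shift_def T_scale scale_right_diff_distrib mult.commute)

lemma shift_zero: "shift \<mu> 0 = 0"
  by (simp add: shift_def T_zero)

lemma shift_diff: "shift \<mu> (u - v) = shift \<mu> u - shift \<mu> v"
  by (metis shift_add add_diff_cancel diff_add_cancel)

lemma shift_0: "shift 0 = T"
  by (simp add: shift_def fun_eq_iff)

lemma shift_pow_add: "(shift \<mu> ^^ N) (u + v) = (shift \<mu> ^^ N) u + (shift \<mu> ^^ N) v"
  by (induction N) (simp_all add: shift_add)

lemma shift_pow_scale: "(shift \<mu> ^^ N) (c *s v) = c *s (shift \<mu> ^^ N) v"
  by (induction N) (simp_all add: shift_scale)

lemma shift_pow_diff: "(shift \<mu> ^^ N) (u - v) = (shift \<mu> ^^ N) u - (shift \<mu> ^^ N) v"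
  by (induction N) (simp_all add: shift_diff)

lemma shift_mem:
  assumes "subspace U" and "T ` U \<subseteq> U" and "v \<in> U"
  shows "shift \<mu> v \<in> U"
  unfolding shift_def
proof (rule subspace_diff[OF assms(1)])
  show "T v \<in> U"
    using assms by blast
  show "\<mu> *s v \<in> U"
    using assms(1,3) by (rule subspace_scale)
qed

lemma shift_pow_mem:
  assumes "subspace U" and "T ` U \<subseteq> U" and "v \<in> U"
  shows "(shift \<mu> ^^ N) v \<in> U"
  by (induction N) (use assms shift_mem in auto)

lemma shift_pow_mono:
  assumes "subspace U" and "T ` U \<subseteq> U" and "(shift \<mu> ^^ N) v \<in> U" and "N \<le> N'"
  shows "(shift \<mu> ^^ N') v \<in> U"
proof -
  have "(shift \<mu> ^^ N') v = (shift \<mu> ^^ (N' - N)) ((shift \<mu> ^^ N) v)"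
    using assms(4) by (simp flip: funpow_add[unfolded o_def fun_eq_iff, rule_format])
  then show ?thesis
    using assms by (simp add: shift_pow_mem)
qed

text \<open>The action of \<open>p(T)\<close>, written so that it unfolds along the coefficients of \<open>p\<close>.\<close>

definition poly_action :: "complex poly \<Rightarrow> 'v \<Rightarrow> 'v"
  where "poly_action p = fold_coeffs (\<lambda>a r v. a *s v + r (T v)) p (\<lambda>_. 0)"

lemma poly_action_0 [simp]: "poly_action 0 v = 0"
  by (simp add: poly_action_def)

lemma poly_action_pCons [simp]: "poly_action (pCons a p) v = a *s v + poly_action p (T v)"
  by (cases "p = 0 \<and> a = 0") (auto simp: poly_action_def fold_coeffs_def cCons_def)

lemma poly_action_1 [simp]: "poly_action 1 v = v"
  by (simp add: one_pCons)

lemma poly_action_add: "poly_action (p + q) v = poly_action p v + poly_action q v"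
  by (induction p q arbitrary: v rule: poly_induct2) (simp_all add: scale_left_distrib algebra_simps)

lemma poly_action_smult: "poly_action (smult c p) v = c *s poly_action p v"
  by (induction p arbitrary: v) (simp_all add: scale_right_distrib)

lemma poly_action_vector_add: "poly_action p (u + v) = poly_action p u + poly_action p v"
  by (induction p arbitrary: u v) (simp_all add: T_add scale_right_distrib algebra_simps)

lemma poly_action_vector_scale: "poly_action p (c *s v) = c *s poly_action p v"
  by (induction p arbitrary: v) (simp_all add: T_scale scale_right_distrib mult.commute)

lemma poly_action_T: "poly_action p (T v) = T (poly_action p v)"
  by (induction p arbitrary: v) (simp_all add: T_zero T_add T_scale)

lemma poly_action_shift: "poly_action p (shift \<mu> v) = shift \<mu> (poly_action p v)"
proof -
  have "poly_action p (shift \<mu> v) + poly_action p (\<mu> *s v) = poly_action p (T v)"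
    by (simp add: shift_def flip: poly_action_vector_add)
  then show ?thesis
    by (simp add: shift_def poly_action_T poly_action_vector_scale algebra_simps)
qed

lemma poly_action_linear_factor: "poly_action ([:- \<mu>, 1:] * p) v = poly_action p (shift \<mu> v)"
proof -
  have "[:- \<mu>, 1:] * p = pCons 0 p + smult (- \<mu>) p"
    by simp
  then have "poly_action ([:- \<mu>, 1:] * p) v = poly_action (pCons 0 p) v + - \<mu> *s poly_action p v"
    by (simp only: poly_action_add poly_action_smult)
  then show ?thesis
    by (simp add: poly_action_shift) (simp add: poly_action_T shift_def)
qed

lemma poly_action_mult: "poly_action (p * q) v = poly_action p (poly_action q v)"
  by (induction p arbitrary: v) 
     (simp_all add: poly_action_add poly_action_smult poly_action_T)

lemma poly_action_mem:
  assumes "subspace U" and "T ` U \<subseteq> U" and "v \<in> U"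
  shows "poly_action p v \<in> U"
  using assms(3)
proof (induction p arbitrary: v)
  case (pCons a p)
  then have "T v \<in> U"
    using assms(2) by auto
  then show ?case
    using pCons assms(1) by (auto intro!: subspace_add subspace_scale)
qed (use assms subspace_0 in auto)

lemma poly_action_eigenvector_mod:
  assumes "subspace U" and "T ` U \<subseteq> U" and "shift \<mu> v \<in> U"
  shows "poly_action p v - poly p \<mu> *s v \<in> U"
proof (induction p)
  case (pCons a p)
  have "poly_action (pCons a p) v - poly (pCons a p) \<mu> *s v
      = T (poly_action p v - poly p \<mu> *s v) + poly p \<mu> *s shift \<mu> v"
    by (simp add: poly_action_T shift_def T_diff T_scale scale_left_distrib
        scale_right_diff_distrib mult.commute)
  then show ?case
    using pCons.IH assms by (simp only:) (intro subspace_add subspace_scale; auto)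
qed (use assms subspace_0 in auto)

text \<open>
  Finitely many linear conditions can be met by \<open>p(T) v\<close> with \<open>p \<noteq> 0\<close>: two solutions for all but
  one of the conditions, made independent by a gap in their degrees, have a combination that
  also meets the last one.
\<close>

lemma poly_action_annihilates_functionals:
  assumes "finite P"
    and "\<And>l. l \<in> P \<Longrightarrow> Vector_Spaces.linear scale (*) l"
  shows "\<exists>p. p \<noteq> 0 \<and> (\<forall>l\<in>P. l (poly_action p v) = 0)"
  using assms
proof (induction P arbitrary: v)
  case empty
  show ?case by (rule exI[of _ 1]) simp
next
  case (insert l P)
  obtain p where p: "p \<noteq> 0" "\<forall>l\<in>P. l (poly_action p v) = 0"
    using insert.IH[of v] insert.prems by auto
  obtain q where q: "q \<noteq> 0" "\<forall>l\<in>P. l (poly_action q ((T ^^ Suc (degree p)) v)) = 0"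
    using insert.IH[of "(T ^^ Suc (degree p)) v"] insert.prems by auto
  define q' where "q' = monom 1 (Suc (degree p)) * q"
  have mono: "poly_action (monom 1 m * r) w = poly_action r ((T ^^ m) w)" for m r w
  proof (induction m arbitrary: w)
    case (Suc m)
    have "monom 1 (Suc m) * r = pCons 0 (monom 1 m * r)"
      by (simp add: monom_Suc)
    then show ?case
      using Suc[of "T w"] by (simp add: funpow_swap1)
  qed simp
  have q': "\<forall>l\<in>P. l (poly_action q' v) = 0"
    using q by (simp add: q'_def mono)
  show ?case
  proof (cases "l (poly_action p v) = 0")
    case True
    then show ?thesis using p by auto
  next
    case False
    define r where "r = smult (l (poly_action q' v)) p - smult (l (poly_action p v)) q'"
    have deg: "degree q' > degree p"
      using q(1) by (simp add: q'_def degree_mult_eq monom_eq_0_iff degree_monom_eq)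
    have "coeff r (degree q') = - l (poly_action p v) * lead_coeff q'"
      using deg by (simp add: r_def coeff_eq_0)
    moreover have "q' \<noteq> 0"
      using deg by auto
    ultimately have "r \<noteq> 0"
      using False by force
    moreover have "r = smult (l (poly_action q' v)) p + smult (- l (poly_action p v)) q'"
      by (simp add: r_def)
    then have act: "poly_action r v = l (poly_action q' v) *s poly_action p v
        + (- l (poly_action p v)) *s poly_action q' v"
      by (simp only: poly_action_add poly_action_smult)
    have "h (poly_action r v) = 0" if "h \<in> insert l P" for h
    proof -
      interpret h: Vector_Spaces.linear scale "(*)" h
        using insert.prems that by blast
      show ?thesis
        unfolding act h.add h.scale using that p q' by auto
    qed
    ultimately show ?thesis by blast
  qed
qed

end

locale stable_pair = linear_operator scale T
  for scale :: "complex \<Rightarrow> 'v::ab_group_add \<Rightarrow> 'v" (infixr \<open>*s\<close> 75) and T :: "'v \<Rightarrow> 'v" +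
  fixes W W' :: "'v set"
  assumes subspace_W: "subspace W" and subspace_W': "subspace W'"
    and W'_subset: "W' \<subseteq> W"
    and T_W: "T ` W \<subseteq> W" and T_W': "T ` W' \<subseteq> W'"
begin

definition geigen :: "complex \<Rightarrow> 'v set"
  where "geigen \<mu> = {v \<in> W. \<exists>N. (shift \<mu> ^^ N) v \<in> W'}"

lemma geigenI: "v \<in> W \<Longrightarrow> (shift \<mu> ^^ N) v \<in> W' \<Longrightarrow> v \<in> geigen \<mu>"
  by (auto simp: geigen_def)

lemma W'_geigen: "W' \<subseteq> geigen \<mu>"
  using W'_subset by (auto intro: geigenI[where N = 0])

lemma geigen_subset: "geigen \<mu> \<subseteq> W"
  by (auto simp: geigen_def)

lemma subspace_geigen: "subspace (geigen \<mu>)"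
proof (rule subspaceI)
  show "0 \<in> geigen \<mu>"
    using W'_geigen subspace_0[OF subspace_W'] by auto
next
  fix u v assume "u \<in> geigen \<mu>" "v \<in> geigen \<mu>"
  then obtain M N where uv: "u \<in> W" "v \<in> W" "(shift \<mu> ^^ M) u \<in> W'" "(shift \<mu> ^^ N) v \<in> W'"
    by (auto simp: geigen_def)
  have "(shift \<mu> ^^ max M N) (u + v) \<in> W'"
    unfolding shift_pow_add
    using uv shift_pow_mono[OF subspace_W' T_W'] by (intro subspace_add[OF subspace_W']) auto
  then show "u + v \<in> geigen \<mu>"
    using uv subspace_add[OF subspace_W] by (auto intro: geigenI)
next
  fix c v assume "v \<in> geigen \<mu>"
  then show "c *s v \<in> geigen \<mu>"
    using subspace_scale[OF subspace_W] subspace_scale[OF subspace_W']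
    by (auto simp: geigen_def shift_pow_scale) blast
qed

lemma geigen_shiftD:
  assumes "v \<in> W" and "shift \<mu> v \<in> geigen \<mu>"
  shows "v \<in> geigen \<mu>"
proof -
  obtain N where "(shift \<mu> ^^ N) (shift \<mu> v) \<in> W'"
    using assms(2) by (auto simp: geigen_def)
  then have "(shift \<mu> ^^ Suc N) v \<in> W'"
    by (simp add: funpow_swap1)
  then show ?thesis
    using assms(1) by (rule geigenI[rotated])
qed

lemma shift_geigen:
  assumes "v \<in> geigen \<nu>"
  shows "shift \<mu> v \<in> geigen \<nu>"
proof -
  obtain N where "(shift \<nu> ^^ N) v \<in> W'"
    using assms by (auto simp: geigen_def)
  moreover have "(shift \<nu> ^^ N) (shift \<mu> v) = shift \<mu> ((shift \<nu> ^^ N) v)"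
    by (induction N) (simp_all add: shift_def T_diff T_scale scale_right_diff_distrib mult.commute)
  ultimately have "(shift \<nu> ^^ N) (shift \<mu> v) \<in> W'"
    using shift_mem[OF subspace_W' T_W'] by simp
  then show ?thesis
    using assms shift_mem[OF subspace_W T_W] by (auto simp: geigen_def)
qed

text \<open>
  On the generalised eigenspace for \<open>\<nu>\<close>, \<open>T - \<mu> = (\<nu> - \<mu>) + (T - \<nu>)\<close> is an invertible
  scalar plus a nilpotent operator.
\<close>

lemma shift_surj_on_geigen:
  assumes "\<nu> \<noteq> \<mu>" and "v \<in> geigen \<nu>"
  shows "\<exists>u\<in>geigen \<nu>. shift \<mu> u - v \<in> W'"
proof -
  obtain N where "(shift \<nu> ^^ N) v \<in> W'" "v \<in> W"
    using assms by (auto simp: geigen_def)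
  then show ?thesis
  proof (induction N arbitrary: v)
    case 0
    then show ?case
      using subspace_0[OF subspace_geigen] subspace_neg[OF subspace_W']
      by (intro bexI[of _ 0]) (auto simp: shift_zero)
  next
    case (Suc N)
    have "(shift \<nu> ^^ N) (shift \<nu> v) \<in> W'" "shift \<nu> v \<in> W"
      using Suc.prems shift_mem[OF subspace_W T_W] by (simp_all add: funpow_swap1)
    from Suc.IH[OF this] obtain w where w: "w \<in> geigen \<nu>" "shift \<mu> w - shift \<nu> v \<in> W'"
      by blast
    have v: "v \<in> geigen \<nu>"
      using Suc.prems by (intro geigenI[where N = "Suc N"])
    define c where "c = 1 / (\<nu> - \<mu>)"
    have "shift \<mu> (c *s (v - w)) - v = - (c *s (shift \<mu> w - shift \<nu> v))"
    proof -
      have "v = c *s ((\<nu> - \<mu>) *s v)"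
        using assms(1) by (simp add: c_def)
      then have "shift \<mu> (c *s (v - w)) - v = c *s (shift \<mu> v - shift \<mu> w - (\<nu> - \<mu>) *s v)"
        by (metis shift_diff shift_scale scale_right_diff_distrib)
      also have "shift \<mu> v - shift \<mu> w - (\<nu> - \<mu>) *s v = - (shift \<mu> w - shift \<nu> v)"
        by (simp add: shift_def scale_left_diff_distrib)
      finally show ?thesis by (metis scale_minus_right)
    qed
    then have "shift \<mu> (c *s (v - w)) - v \<in> W'"
      using w(2) subspace_W' by (simp only: subspace_neg subspace_scale)
    moreover have "c *s (v - w) \<in> geigen \<nu>"
      using v w subspace_geigen by (intro subspace_scale subspace_diff)
    ultimately show ?case by blast
  qed
qed

lemma shift_surj_mod_geigen:
  assumes "v \<in> span (\<Union>\<nu>. geigen \<nu>)"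
  shows "\<exists>u\<in>span (\<Union>\<nu>. geigen \<nu>). shift \<mu> u - v \<in> geigen \<mu>"
  using assms
proof (induction rule: span_induct_alt)
  case base
  then show ?case
    using span_zero subspace_0[OF subspace_geigen] by (intro bexI[of _ 0]) (auto simp: shift_zero)
next
  case (step c x y)
  then obtain u where u: "u \<in> span (\<Union>\<nu>. geigen \<nu>)" "shift \<mu> u - y \<in> geigen \<mu>"
    by blast
  obtain \<nu> where x: "x \<in> geigen \<nu>"
    using step by blast
  have "\<exists>w\<in>geigen \<nu>. shift \<mu> w - x \<in> geigen \<mu>"
  proof (cases "\<nu> = \<mu>")
    case True
    then show ?thesis
      using x subspace_0[OF subspace_geigen] subspace_neg[OF subspace_geigen]
      by (intro bexI[of _ 0]) (auto simp: shift_zero)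
  next
    case False
    then show ?thesis
      using shift_surj_on_geigen x W'_geigen by blast
  qed
  then obtain w where w: "w \<in> geigen \<nu>" "shift \<mu> w - x \<in> geigen \<mu>"
    by blast
  have "shift \<mu> (c *s w + u) - (c *s x + y) = c *s (shift \<mu> w - x) + (shift \<mu> u - y)"
    by (simp add: shift_add shift_scale scale_right_diff_distrib)
  then have "shift \<mu> (c *s w + u) - (c *s x + y) \<in> geigen \<mu>"
    using w u subspace_geigen by (simp only: subspace_add subspace_scale)
  moreover have "c *s w + u \<in> span (\<Union>\<nu>. geigen \<nu>)"
    using w u by (intro span_add span_scale) (auto intro: span_base)
  ultimately show ?case by blast
qed

text \<open>
  Splitting off a root \<open>\<mu>\<close> of \<open>p\<close> leaves a vector \<open>(T - \<mu>) v\<close> in the span; it can be hit by a vector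
  of the span up to an error in the generalised eigenspace for \<open>\<mu>\<close>, and this error absorbs the difference.
\<close>

lemma span_geigen_if_annihilated:
  assumes "p \<noteq> 0" and "v \<in> W" and "poly_action p v \<in> W'"
  shows "v \<in> span (\<Union>\<nu>. geigen \<nu>)"
  using assms
proof (induction "degree p" arbitrary: p v)
  case 0
  then obtain a where "p = [:a:]" "a \<noteq> 0"
    by (metis degree_eq_zeroE pCons_0_0)
  then have "v = (1 / a) *s (a *s v)" "a *s v \<in> W'"
    using 0 by simp_all
  then have "v \<in> W'"
    using subspace_scale[OF subspace_W'] by metis
  then show ?case
    using W'_geigen by (intro span_base) auto
next
  case (Suc m)
  then have "\<not> constant (poly p)"
    by (simp add: constant_degree)
  then obtain \<mu> where "poly p \<mu> = 0"
    using fundamental_theorem_of_algebra by blast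
  then obtain q where q: "p = [:- \<mu>, 1:] * q"
    by (auto simp: poly_eq_0_iff_dvd dvd_def)
  with Suc.prems have "q \<noteq> 0"
    by auto
  then have "degree q = m"
    using Suc.hyps(2) degree_mult_eq[of "[:- \<mu>, 1:]" q] by (simp add: q)
  moreover have "poly_action q (shift \<mu> v) \<in> W'"
    using Suc.prems(3) unfolding q poly_action_linear_factor .
  ultimately have "shift \<mu> v \<in> span (\<Union>\<nu>. geigen \<nu>)"
    using Suc.hyps(1) Suc.prems(2) \<open>q \<noteq> 0\<close> shift_mem[OF subspace_W T_W] by blast
  then obtain u where u: "u \<in> span (\<Union>\<nu>. geigen \<nu>)" "shift \<mu> u - shift \<mu> v \<in> geigen \<mu>"
    using shift_surj_mod_geigen by blast
  have "u \<in> W"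
    using u(1) span_minimal[OF _ subspace_W] geigen_subset by blast
  then have "u - v \<in> geigen \<mu>"
    using geigen_shiftD[OF subspace_diff[OF subspace_W]] u(2) Suc.prems(2) by (simp only: shift_diff)
  then have "u - v \<in> span (\<Union>\<nu>. geigen \<nu>)"
    by (auto intro: span_base)
  from span_diff[OF u(1) this] show ?case
    by simp
qed

lemma shift_pow_surj_mod_geigen:
  assumes "v \<in> span (\<Union>\<nu>. geigen \<nu>)"
  shows "\<exists>u\<in>span (\<Union>\<nu>. geigen \<nu>). (shift \<mu> ^^ N) u - v \<in> geigen \<mu>"
  using assms
proof (induction N arbitrary: v)
  case 0
  then show ?case
    using subspace_0[OF subspace_geigen] by (intro bexI[of _ v]) auto
next
  case (Suc N)
  obtain w where w: "w \<in> span (\<Union>\<nu>. geigen \<nu>)" "shift \<mu> w - v \<in> geigen \<mu>"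
    using shift_surj_mod_geigen[OF Suc.prems] by blast
  obtain u where u: "u \<in> span (\<Union>\<nu>. geigen \<nu>)" "(shift \<mu> ^^ N) u - w \<in> geigen \<mu>"
    using Suc.IH[OF w(1)] by blast
  have "(shift \<mu> ^^ Suc N) u - v = shift \<mu> ((shift \<mu> ^^ N) u - w) + (shift \<mu> w - v)"
    by (simp add: shift_diff)
  then have "(shift \<mu> ^^ Suc N) u - v \<in> geigen \<mu>"
    using subspace_add[OF subspace_geigen shift_geigen[OF u(2)] w(2)] by (simp only:)
  with u(1) show ?case by blast
qed

text \<open>Generalised eigenspaces are independent: a polynomial prime to \<open>T - \<mu>\<close> kills the other ones.\<close>

lemma geigen_Int_span_geigen:
  assumes "v \<in> geigen \<mu>" and "v \<in> span (\<Union>\<nu>\<in>- {\<mu>}. geigen \<nu>)"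
  shows "v \<in> W'"
proof -
  have "\<exists>p. poly p \<mu> \<noteq> 0 \<and> poly_action p v \<in> W'"
    using assms(2)
  proof (induction rule: span_induct_alt)
    case base
    then show ?case
      using subspace_0[OF subspace_W'] by (intro exI[of _ 1]) auto
  next
    case (step c x y)
    then obtain q where q: "poly q \<mu> \<noteq> 0" "poly_action q y \<in> W'"
      by blast
    obtain \<nu> N where x: "\<nu> \<noteq> \<mu>" "(shift \<nu> ^^ N) x \<in> W'"
      using step by (auto simp: geigen_def)
    define p where "p = [:- \<nu>, 1:] ^ N"
    have "poly_action p x = (shift \<nu> ^^ N) x"
      unfolding p_def
    proof (induction N arbitrary: x)
      case (Suc N)
      show ?case
        unfolding power_Suc poly_action_linear_factor Suc by (simp add: funpow_swap1)
    qed simp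
    then have p: "poly_action p x \<in> W'" "poly p \<mu> \<noteq> 0"
      using x by (simp_all add: p_def)
    have "poly_action (q * p) x \<in> W'" "poly_action (p * q) y \<in> W'"
      unfolding poly_action_mult
      using p q poly_action_mem[OF subspace_W' T_W'] by blast+
    then have "poly_action (p * q) (c *s x + y) \<in> W'"
      using subspace_W' by (simp add: poly_action_vector_add poly_action_vector_scale
          subspace_add subspace_scale mult.commute)
    moreover have "poly (p * q) \<mu> \<noteq> 0"
      using p q by simp
    ultimately show ?case by blast
  qed
  then obtain p where p: "poly p \<mu> \<noteq> 0" "poly_action p v \<in> W'"
    by blast
  obtain N where "(shift \<mu> ^^ N) v \<in> W'"
    using assms(1) by (auto simp: geigen_def)
  with p(2) show ?thesis
  proof (induction N arbitrary: v)
    case (Suc N)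
    have "poly_action p (shift \<mu> v) \<in> W'"
      using Suc.prems(1) shift_mem[OF subspace_W' T_W'] by (simp add: poly_action_shift)
    then have "shift \<mu> v \<in> W'"
      using Suc by (simp add: funpow_swap1)
    then have "poly_action p v - poly p \<mu> *s v \<in> W'"
      by (rule poly_action_eigenvector_mod[OF subspace_W' T_W'])
    from subspace_diff[OF subspace_W' Suc.prems(1) this] have "poly p \<mu> *s v \<in> W'"
      by simp
    from subspace_scale[OF subspace_W' this, of "1 / poly p \<mu>"] show ?case
      using p(1) by simp
  qed simp
qed

end


section \<open>Lifting generalised eigenvectors in a complete filtered space\<close>

text \<open>
  The last axiom says that each \<open>F\<^sub>k / F\<^sub>k\<^sub>+\<^sub>1\<close> is finite-dimensional. The intersection of the \<open>F\<^sub>k\<close> may be nonzero, so that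
  families of series indexed by a type may be filtered by finitely many of their members.
\<close>

locale complete_filtered_operator = linear_operator scale T
  for scale :: "complex \<Rightarrow> 'v::ab_group_add \<Rightarrow> 'v" (infixr \<open>*s\<close> 75) and T :: "'v \<Rightarrow> 'v" +
  fixes F :: "nat \<Rightarrow> 'v set"
  assumes subspace_F: "subspace (F k)"
    and F_Suc: "F (Suc k) \<subseteq> F k"
    and T_F: "T ` F k \<subseteq> F k"
    and F_complete: "(\<And>k. v (Suc k) - v k \<in> F k) \<Longrightarrow> \<exists>w. \<forall>k. w - v k \<in> F k"
    and F_finite: "\<exists>P. finite P \<and> (\<forall>l\<in>P. Vector_Spaces.linear scale (*) l) \<and>
        (\<forall>v\<in>F k. (\<forall>l\<in>P. l v = 0) \<longrightarrow> v \<in> F (Suc k))"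
begin

lemma F_antimono: "j \<le> k \<Longrightarrow> F k \<subseteq> F j"
  by (rule lift_Suc_antimono_le) (rule F_Suc)

text \<open>
  The exponent may grow with \<open>k\<close>: in an infinite-dimensional space no single power of \<open>T - \<mu>\<close> need kill the vector.
\<close>

definition top_geigen :: "complex \<Rightarrow> 'v set"
  where "top_geigen \<mu> = {v. \<forall>k. \<exists>N. (shift \<mu> ^^ N) v \<in> F k}"

lemma stable_pair_F: "stable_pair scale T (F k) (F (Suc k))"
  by unfold_locales (use subspace_F F_Suc T_F in auto)

lemma F_subset_span_geigen: "F k \<subseteq> span (\<Union>\<nu>. stable_pair.geigen scale T (F k) (F (Suc k)) \<nu>)"
proof
  fix v assume v: "v \<in> F k"
  obtain P where P: "finite P" "\<forall>l\<in>P. Vector_Spaces.linear scale (*) l"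
      "\<forall>v\<in>F k. (\<forall>l\<in>P. l v = 0) \<longrightarrow> v \<in> F (Suc k)"
    using F_finite[of k] by (elim exE conjE)
  obtain p where p: "p \<noteq> 0" "\<forall>l\<in>P. l (poly_action p v) = 0"
    using poly_action_annihilates_functionals[OF P(1) bspec[OF P(2)], of v] by blast
  then have "poly_action p v \<in> F (Suc k)"
    using P(3) poly_action_mem[OF subspace_F T_F v] by simp
  with p(1) show "v \<in> span (\<Union>\<nu>. stable_pair.geigen scale T (F k) (F (Suc k)) \<nu>)"
    by (intro stable_pair.span_geigen_if_annihilated[OF stable_pair_F _ v])
qed

text \<open>
  A vector that \<open>(T - \<mu>)\<^sup>N\<close> maps into \<open>F\<^sub>j\<close> can be corrected inside \<open>F\<^sub>j\<close> so that a power of \<open>T - \<mu>\<close> maps it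
  into \<open>F\<^sub>j\<^sub>+\<^sub>1\<close>: on the finite-dimensional quotient, \<open>(T - \<mu>)\<^sup>N\<close> is onto up to the generalised eigenspace
  for \<open>\<mu>\<close>. By completeness the corrections converge.
\<close>

lemma lift_geigen:
  assumes "(shift \<mu> ^^ N) v \<in> F k"
  shows "\<exists>w\<in>top_geigen \<mu>. w - v \<in> F k"
proof -
  define R where "R j w \<longleftrightarrow> (\<exists>N. (shift \<mu> ^^ N) w \<in> F (k + j))" for j w
  have "\<exists>w. R (Suc j) w \<and> w - x \<in> F (k + j)" if "R j x" for j x
  proof -
    interpret P: stable_pair scale T "F (k + j)" "F (Suc (k + j))"
      by (rule stable_pair_F)
    obtain N where "(shift \<mu> ^^ N) x \<in> F (k + j)"
      using \<open>R j x\<close> by (auto simp: R_def)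
    then have "(shift \<mu> ^^ N) x \<in> span (\<Union>\<nu>. P.geigen \<nu>)"
      using F_subset_span_geigen[of "k + j"] by (rule subsetD[rotated])
    from P.shift_pow_surj_mod_geigen[OF this, of N \<mu>]
    obtain u where u: "u \<in> span (\<Union>\<nu>. P.geigen \<nu>)"
        "(shift \<mu> ^^ N) u - (shift \<mu> ^^ N) x \<in> P.geigen \<mu>"
      by (elim bexE)
    then obtain M where "(shift \<mu> ^^ M) ((shift \<mu> ^^ N) (x - u)) \<in> F (Suc (k + j))"
      using subspace_neg[OF P.subspace_geigen u(2)] unfolding P.geigen_def
      by (simp add: shift_pow_diff) blast
    then have "R (Suc j) (x - u)"
      unfolding R_def by (auto intro: exI[of _ "M + N"] simp: funpow_add)
    moreover have "u \<in> F (k + j)"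
      using u(1) span_minimal[OF _ P.subspace_W, of "\<Union>\<nu>. P.geigen \<nu>"] P.geigen_subset by blast
    then have "(x - u) - x \<in> F (k + j)"
      using subspace_neg[OF subspace_F] by simp
    ultimately show ?thesis by blast
  qed
  moreover have "R 0 v"
    using assms by (auto simp: R_def)
  ultimately obtain w where w: "w 0 = v" "\<And>j. R j (w j)" "\<And>j. w (Suc j) - w j \<in> F (k + j)"
    using dependent_nat_choice[of "\<lambda>j x. (j = 0 \<longrightarrow> x = v) \<and> R j x" "\<lambda>j x y. y - x \<in> F (k + j)"]
    by (auto 4 3)
  have "\<And>j. w (Suc j) - w j \<in> F j"
    using w(3) F_antimono[OF le_add2] by (rule subsetD[rotated])
  then obtain z where z: "\<And>j. z - w j \<in> F j"
    using F_complete[of w] by blast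
  have tail: "w j - v \<in> F k" for j
  proof (induction j)
    case (Suc j)
    have "w (Suc j) - w j \<in> F k"
      using w(3) F_antimono[of k "k + j"] by auto
    from subspace_add[OF subspace_F this Suc] show ?case by simp
  qed (use w(1) subspace_0[OF subspace_F] in simp)
  have "z - v \<in> F k"
    using subspace_add[OF subspace_F z[of k] tail[of k]] by simp
  moreover have "\<exists>N. (shift \<mu> ^^ N) z \<in> F j" for j
  proof -
    obtain N where "(shift \<mu> ^^ N) (w j) \<in> F j"
      using w(2)[of j] F_antimono[of j "k + j"] by (auto simp: R_def)
    moreover have "(shift \<mu> ^^ N) (z - w j) \<in> F j"
      using z by (rule shift_pow_mem[OF subspace_F T_F])
    ultimately have "(shift \<mu> ^^ N) (z - w j) + (shift \<mu> ^^ N) (w j) \<in> F j"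
      by (intro subspace_add[OF subspace_F])
    then show ?thesis
      by (auto simp flip: shift_pow_add)
  qed
  ultimately show ?thesis
    by (auto simp: top_geigen_def)
qed

text \<open>
  The decomposition into generalised eigenvectors, modulo the next step of the filtration. It yields both
  coordinates adapted to a vector field and adapted coefficient vectors.
\<close>

theorem F_subset_span_top_geigen:
  "F k \<subseteq> span ((\<Union>\<nu>. top_geigen \<nu> \<inter> F k) \<union> F (Suc k))"
proof -
  interpret P: stable_pair scale T "F k" "F (Suc k)"
    by (rule stable_pair_F)
  have "v \<in> span ((\<Union>\<nu>. top_geigen \<nu> \<inter> F k) \<union> F (Suc k))" if v: "v \<in> P.geigen \<nu>" for v \<nu>
  proof -
    obtain w where w: "w \<in> top_geigen \<nu>" "w - v \<in> F (Suc k)"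
      using v lift_geigen[where k = "Suc k"] by (fastforce simp: P.geigen_def)
    have "w \<in> F k"
      using subspace_add[OF subspace_F, of "w - v" k v] w(2) F_Suc[of k] v P.geigen_subset by auto
    then have "w - (w - v) \<in> span ((\<Union>\<nu>. top_geigen \<nu> \<inter> F k) \<union> F (Suc k))"
      using w by (intro span_diff span_base) auto
    then show ?thesis by simp
  qed
  then have "span (\<Union>\<nu>. P.geigen \<nu>) \<subseteq> span ((\<Union>\<nu>. top_geigen \<nu> \<inter> F k) \<union> F (Suc k))"
    by (intro span_minimal) auto
  with F_subset_span_geigen[of k] show ?thesis
    by (rule order_trans)
qed

end

section \<open>Lie algebras modulo an ideal\<close>

context vector_space
begin

text \<open>Steinitz exchange modulo the span of \<open>N\<close>: only the members of \<open>G\<close> are counted.\<close>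

lemma exchange_one_mod:
  assumes "finite G" and "x \<in> span (G \<union> N)" and "x \<notin> span N"
  shows "\<exists>g\<in>G. g \<in> span (insert x (G - {g} \<union> N))"
  using assms
proof (induction G rule: finite_induct)
  case (insert g G)
  show ?case
  proof (cases "x \<in> span (G \<union> N)")
    case True
    then obtain h where h: "h \<in> G" "h \<in> span (insert x (G - {h} \<union> N))"
      using insert by blast
    moreover have "insert x (G - {h} \<union> N) \<subseteq> insert x (insert g G - {h} \<union> N)"
      by blast
    ultimately show ?thesis
      using span_mono by blast
  next
    case False
    moreover have "x \<in> span (insert g (G \<union> N))"
      using insert.prems by simp
    ultimately have "g \<in> span (insert x (G \<union> N))"
      by (metis in_span_insert)
    moreover have "insert g G - {g} = G"
      using insert.hyps by blast
    ultimately show ?thesis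
      by auto
  qed
qed simp

lemma exchange_mod:
  assumes "finite G" and "finite B" and "B \<subseteq> span (G \<union> N)"
    and "\<And>b. b \<in> B \<Longrightarrow> b \<notin> span (B - {b} \<union> N)"
  shows "\<exists>G'\<subseteq>G. card G' + card B \<le> card G \<and> G \<subseteq> span (G' \<union> (B \<union> N))"
  using assms(2-4)
proof (induction B rule: finite_induct)
  case empty
  then show ?case
    by (intro exI[of _ G]) (auto intro: span_base)
next
  case (insert b B)
  have indep: "c \<notin> span (B - {c} \<union> N)" if "c \<in> B" for c
  proof
    assume "c \<in> span (B - {c} \<union> N)"
    moreover have "B - {c} \<union> N \<subseteq> insert b B - {c} \<union> N"
      by blast
    ultimately show False
      using insert.prems(2)[of c] that span_mono by blast
  qed
  then obtain G' where G': "G' \<subseteq> G" "card G' + card B \<le> card G" "G \<subseteq> span (G' \<union> (B \<union> N))"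
    using insert.IH insert.prems(1) by blast
  have "span (G \<union> N) \<subseteq> span (G' \<union> (B \<union> N))"
    using G'(3) by (intro span_minimal) (auto intro: span_base)
  then have "b \<in> span (G' \<union> (B \<union> N))"
    using insert.prems(1) by blast
  moreover have "b \<notin> span (B \<union> N)"
    using insert.prems(2)[of b] insert.hyps(2) by simp
  moreover have fin: "finite G'"
    using G'(1) assms(1) finite_subset by blast
  ultimately obtain g where g: "g \<in> G'" "g \<in> span (insert b (G' - {g} \<union> (B \<union> N)))"
    using exchange_one_mod by blast
  have "G' \<union> (B \<union> N) \<subseteq> span ((G' - {g}) \<union> (insert b B \<union> N))"
  proof
    fix y assume "y \<in> G' \<union> (B \<union> N)"
    then show "y \<in> span ((G' - {g}) \<union> (insert b B \<union> N))"
      using g(2) by (cases "y = g") (auto intro: span_base simp: Un_assoc insert_commute)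
  qed
  then have "G \<subseteq> span ((G' - {g}) \<union> (insert b B \<union> N))"
    using G'(3) span_minimal[OF _ subspace_span] by blast
  moreover have "card (G' - {g}) + card (insert b B) \<le> card G"
    using G'(2) g(1) fin insert.hyps card_gt_0_iff[of G'] by auto
  ultimately show ?case
    using G'(1) by blast
qed

end

text \<open>
  Quotients are avoided by working in \<open>M\<close> with inclusions into the ideal \<open>I\<close>; the bracket is only required to be
  one on \<open>M\<close>, because commutators of arbitrary maps are not bilinear.
\<close>

locale lie_algebra_mod = vector_space scale
  for scale :: "'k::field \<Rightarrow> 'v::ab_group_add \<Rightarrow> 'v" (infixr \<open>*s\<close> 75) +
  fixes br :: "'v \<Rightarrow> 'v \<Rightarrow> 'v" and M I :: "'v set"
  assumes subspace_M: "subspace M" and subspace_I: "subspace I" and I_subset: "I \<subseteq> M"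
    and br_closed: "x \<in> M \<Longrightarrow> y \<in> M \<Longrightarrow> br x y \<in> M"
    and br_add_left: "x \<in> M \<Longrightarrow> y \<in> M \<Longrightarrow> z \<in> M \<Longrightarrow> br (x + y) z = br x z + br y z"
    and br_scale_left: "x \<in> M \<Longrightarrow> y \<in> M \<Longrightarrow> br (c *s x) y = c *s br x y"
    and br_antisym: "x \<in> M \<Longrightarrow> y \<in> M \<Longrightarrow> br x y = - br y x"
    and br_self: "x \<in> M \<Longrightarrow> br x x = 0"
    and br_leibniz: "x \<in> M \<Longrightarrow> y \<in> M \<Longrightarrow> z \<in> M \<Longrightarrow> br x (br y z) = br (br x y) z + br y (br x z)"
    and br_ideal: "x \<in> M \<Longrightarrow> y \<in> I \<Longrightarrow> br x y \<in> I"
begin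

lemma br_add_right: "x \<in> M \<Longrightarrow> y \<in> M \<Longrightarrow> z \<in> M \<Longrightarrow> br z (x + y) = br z x + br z y"
  using br_antisym[of z "x + y"] br_antisym[of z x] br_antisym[of z y] br_add_left[of x y z]
    subspace_add[OF subspace_M] by simp

lemma br_scale_right: "x \<in> M \<Longrightarrow> y \<in> M \<Longrightarrow> br y (c *s x) = c *s br y x"
  using br_antisym[of y "c *s x"] br_antisym[of y x] br_scale_left[of x y]
    subspace_scale[OF subspace_M] by simp

lemma br_zero: "x \<in> M \<Longrightarrow> br 0 x = 0" "x \<in> M \<Longrightarrow> br x 0 = 0"
  using br_scale_left[of x x 0] br_scale_right[of x x 0] by simp_all

lemma br_ideal_left: "x \<in> I \<Longrightarrow> y \<in> M \<Longrightarrow> br x y \<in> I"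
  using br_antisym[of x y] br_ideal[of y x] subspace_neg[OF subspace_I] I_subset by auto

lemma br_combination:
  assumes "x \<in> M" "y \<in> M" "x' \<in> M" "y' \<in> M"
  shows "br (c *s x + y) (c' *s x' + y')
    = (c * c') *s br x x' + c *s br x y' + c' *s br y x' + br y y'"
  using assms subspace_scale[OF subspace_M] subspace_add[OF subspace_M]
  by (simp add: br_add_left br_add_right br_scale_left br_scale_right br_closed scale_right_distrib
      add.assoc)

primrec derived :: "nat \<Rightarrow> 'v set"
  where
    "derived 0 = M"
  | "derived (Suc i) = span {br x y | x y. x \<in> derived i \<and> y \<in> derived i}"

lemma derived_Suc_subset:
  assumes "derived i \<subseteq> N" and "subspace N'" and "\<And>x y. x \<in> N \<Longrightarrow> y \<in> N \<Longrightarrow> br x y \<in> N'"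
  shows "derived (Suc i) \<subseteq> N'"
proof -
  have "{br x y | x y. x \<in> derived i \<and> y \<in> derived i} \<subseteq> N'"
    using assms(1,3) by blast
  from span_minimal[OF this assms(2)] show ?thesis
    by simp
qed

text \<open>
  If \<open>[A, \<nu>] \<subseteq> A\<close>, then \<open>A\<close> is an abelian ideal with abelian quotient. Otherwise some \<open>[\<tau>, \<nu>] = \<nu>'\<close> is
  a new complement of \<open>A\<close>, and applying \<open>[\<tau>, -]\<close> to \<open>[t, \<nu>] \<in> K\<nu> + A\<close> shows, since \<open>\<tau>\<close> and \<open>t\<close> commute,
  that \<open>[t, \<nu>'] \<in> K\<nu>'\<close>: the derived algebra is the line spanned by \<open>\<nu>'\<close>.
\<close>

lemma solvable_if_abelian_codim_one:
  assumes A: "subspace A" "I \<subseteq> A" "A \<subseteq> M" and abelian: "\<And>x y. x \<in> A \<Longrightarrow> y \<in> A \<Longrightarrow> br x y \<in> I"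
    and \<nu>: "\<nu> \<in> M" and M: "\<And>x. x \<in> M \<Longrightarrow> \<exists>c. \<exists>t\<in>A. x = c *s \<nu> + t"
  shows "derived 2 \<subseteq> I"
proof (cases "\<forall>t\<in>A. br t \<nu> \<in> A")
  case True
  have "derived 1 \<subseteq> A"
    unfolding One_nat_def
  proof (rule derived_Suc_subset[where N = M])
    fix x y assume "x \<in> M" "y \<in> M"
    then obtain c t c' t' where xy: "t \<in> A" "t' \<in> A" "x = c *s \<nu> + t" "y = c' *s \<nu> + t'"
      using M by meson
    have "br \<nu> t' \<in> A"
      using br_antisym[of \<nu> t'] True xy A \<nu> subspace_neg by auto
    then have "(c * c') *s br \<nu> \<nu> + c *s br \<nu> t' + c' *s br t \<nu> + br t t' \<in> A"
      using True xy abelian[of t t'] A \<nu>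
      by (intro subspace_add[OF A(1)] subspace_scale[OF A(1)]) (auto simp: br_self subspace_0)
    then show "br x y \<in> A"
      using xy A \<nu> by (auto simp: br_combination subset_iff)
  qed (use A in auto)
  then have "derived (Suc 1) \<subseteq> I"
    by (rule derived_Suc_subset) (use subspace_I abelian in auto)
  then show ?thesis
    by (simp add: numeral_2_eq_2)
next
  case False
  then obtain \<tau> where \<tau>: "\<tau> \<in> A" "br \<tau> \<nu> \<notin> A"
    by blast
  define \<nu>' where "\<nu>' = br \<tau> \<nu>"
  have \<tau>M: "\<tau> \<in> M" and \<nu>': "\<nu>' \<in> M"
    using \<tau> \<nu> A by (auto simp: \<nu>'_def intro: br_closed)
  obtain b t\<^sub>0 where t\<^sub>0: "t\<^sub>0 \<in> A" "\<nu>' = b *s \<nu> + t\<^sub>0"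
    using M[OF \<nu>'] by blast
  have b: "b \<noteq> 0"
    using t\<^sub>0 \<tau>(2) by (auto simp: \<nu>'_def)
  define L where "L = {x. \<exists>c. x - c *s \<nu>' \<in> I}"
  have L: "subspace L"
  proof (rule subspaceI)
    show "0 \<in> L"
      using subspace_0[OF subspace_I] by (auto simp: L_def intro!: exI[of _ 0])
  next
    fix x y assume "x \<in> L" "y \<in> L"
    then obtain c c' where "x - c *s \<nu>' \<in> I" "y - c' *s \<nu>' \<in> I"
      by (auto simp: L_def)
    from subspace_add[OF subspace_I this] have "(x + y) - (c + c') *s \<nu>' \<in> I"
      by (simp add: scale_left_distrib algebra_simps)
    then show "x + y \<in> L"
      by (auto simp: L_def)
  next
    fix a x assume "x \<in> L"
    then obtain c where "x - c *s \<nu>' \<in> I"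
      by (auto simp: L_def)
    from subspace_scale[OF subspace_I this, of a] have "a *s x - (a * c) *s \<nu>' \<in> I"
      by (simp add: scale_right_diff_distrib)
    then show "a *s x \<in> L"
      by (auto simp: L_def)
  qed
  have I_L: "x \<in> L" if "x \<in> I" for x
    using that by (auto simp: L_def intro!: exI[of _ 0])
  have eig: "br t \<nu>' \<in> L" if t: "t \<in> A" for t
  proof -
    have tM: "t \<in> M"
      using t A by blast
    obtain c t\<^sub>1 where t\<^sub>1: "t\<^sub>1 \<in> A" "br t \<nu> = c *s \<nu> + t\<^sub>1"
      using M[OF br_closed[OF tM \<nu>]] by blast
    \<comment> \<open>As \<open>[t, \<tau>]\<close> and \<open>[\<tau>, t\<^sub>1]\<close> lie in \<open>I\<close>, only the multiple of \<open>\<nu>'\<close> survives.\<close>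
    have "br \<tau> (c *s \<nu> + t\<^sub>1) = c *s \<nu>' + br \<tau> t\<^sub>1"
      using \<tau>M t\<^sub>1 \<nu> A subspace_scale[OF subspace_M]
      by (simp add: br_add_right br_scale_right \<nu>'_def subset_iff)
    moreover have "br t \<nu>' = br (br t \<tau>) \<nu> + br \<tau> (c *s \<nu> + t\<^sub>1)"
      using br_leibniz[OF tM \<tau>M \<nu>] t\<^sub>1 by (simp add: \<nu>'_def)
    ultimately have "br t \<nu>' - c *s \<nu>' = br (br t \<tau>) \<nu> + br \<tau> t\<^sub>1"
      by simp
    also have "\<dots> \<in> I"
      using abelian t \<tau> t\<^sub>1 \<nu> br_ideal_left by (intro subspace_add[OF subspace_I]) auto
    finally show ?thesis
      by (auto simp: L_def)
  qed
  have "derived 1 \<subseteq> L"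
    unfolding One_nat_def
  proof (rule derived_Suc_subset[where N = M])
    have M': "\<exists>c. \<exists>t\<in>A. x = c *s \<nu>' + t" if x: "x \<in> M" for x
    proof -
      obtain c t where ct: "t \<in> A" "x = c *s \<nu> + t"
        using M[OF x] by blast
      have "x = (c / b) *s \<nu>' + (t - (c / b) *s t\<^sub>0)"
        using b by (simp add: ct(2) t\<^sub>0(2) scale_right_distrib)
      then show ?thesis
        using subspace_diff[OF A(1) ct(1) subspace_scale[OF A(1) t\<^sub>0(1)]] by blast
    qed
    fix x y assume "x \<in> M" "y \<in> M"
    then obtain c t c' t' where xy: "t \<in> A" "t' \<in> A" "x = c *s \<nu>' + t" "y = c' *s \<nu>' + t'"
      using M' by meson
    have "br \<nu>' t' \<in> L"
      using br_antisym[of \<nu>' t'] eig[OF xy(2)] xy A \<nu>' subspace_neg[OF L] by auto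
    then have "(c * c') *s br \<nu>' \<nu>' + c *s br \<nu>' t' + c' *s br t \<nu>' + br t t' \<in> L"
      using eig[OF xy(1)] I_L[OF abelian[OF xy(1,2)]] \<nu>'
      by (intro subspace_add[OF L] subspace_scale[OF L]) (auto simp: br_self subspace_0[OF L])
    then show "br x y \<in> L"
      using xy A \<nu>' by (auto simp: br_combination subset_iff)
  qed (use L in auto)
  then have "derived (Suc 1) \<subseteq> I"
  proof (rule derived_Suc_subset)
    fix x y assume "x \<in> L" "y \<in> L"
    then obtain c c' where *: "x - c *s \<nu>' \<in> I" "y - c' *s \<nu>' \<in> I"
      by (auto simp: L_def)
    define i j where "i = x - c *s \<nu>'" and "j = y - c' *s \<nu>'"
    have ij: "i \<in> I" "j \<in> I" "i \<in> M" "j \<in> M"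
      using * I_subset by (auto simp: i_def j_def)
    have "br x y = br (c *s \<nu>' + i) (c' *s \<nu>' + j)"
      by (simp add: i_def j_def)
    also have "\<dots> = (c * c') *s br \<nu>' \<nu>' + c *s br \<nu>' j + c' *s br i \<nu>' + br i j"
      using ij \<nu>' by (intro br_combination)
    also have "\<dots> \<in> I"
      using ij \<nu>' br_ideal br_ideal_left
      by (intro subspace_add[OF subspace_I] subspace_scale[OF subspace_I])
        (auto simp: br_self subspace_0[OF subspace_I])
    finally show "br x y \<in> I" .
  qed (rule subspace_I)
  then show ?thesis
    by (simp add: numeral_2_eq_2)
qed

lemma br_span_subset_I:
  assumes "B \<subseteq> M" and "\<And>x y. x \<in> B \<Longrightarrow> y \<in> B \<Longrightarrow> br x y \<in> I"
    and "x \<in> span (B \<union> I)" and "y \<in> span (B \<union> I)"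
  shows "br x y \<in> I"
proof -
  have BI: "B \<union> I \<subseteq> M"
    using assms(1) I_subset by blast
  have 1: "z \<in> M \<and> br b z \<in> I" if b: "b \<in> B" and "z \<in> span (B \<union> I)" for b z
    using that(2)
  proof (induction rule: span_induct_alt)
    case base
    then show ?case
      using subspace_0[OF subspace_M] subspace_0[OF subspace_I] br_zero b assms(1) by auto
  next
    case (step c v w)
    have "v \<in> M" "br b v \<in> I" "b \<in> M"
      using step(1) BI b assms(1,2) br_ideal by auto
    with step(2) show ?case
      using subspace_add[OF subspace_I] subspace_scale[OF subspace_I] subspace_add[OF subspace_M]
        subspace_scale[OF subspace_M] by (simp add: br_add_right br_scale_right)
  qed
  have "z \<in> M \<and> br z y \<in> I" if "z \<in> span (B \<union> I)" for z
    using that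
  proof (induction rule: span_induct_alt)
    case base
    have "y \<in> M"
      using assms(4) span_minimal[OF BI subspace_M] by blast
    then show ?case
      using subspace_0[OF subspace_M] subspace_0[OF subspace_I] br_zero by auto
  next
    case (step c v w)
    have yM: "y \<in> M"
      using assms(4) span_minimal[OF BI subspace_M] by blast
    have "v \<in> M" "br v y \<in> I"
      using step(1) BI 1[of v y] assms(4) br_ideal_left[OF _ yM] by auto
    with step(2) yM show ?case
      using subspace_add[OF subspace_I] subspace_scale[OF subspace_I] subspace_add[OF subspace_M]
        subspace_scale[OF subspace_M] by (simp add: br_add_left br_scale_left)
  qed
  with assms(3) show ?thesis by blast
qed

lemma derived_subset_I_if_commuting_and_one:
  assumes B: "B \<subseteq> M" "\<And>x y. x \<in> B \<Longrightarrow> y \<in> B \<Longrightarrow> br x y \<in> I"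
    and "\<nu> \<in> M" and M: "M \<subseteq> span (insert \<nu> (B \<union> I))"
  shows "derived 2 \<subseteq> I"
proof (rule solvable_if_abelian_codim_one[where A = "span (B \<union> I)" and \<nu> = \<nu>])
  show "I \<subseteq> span (B \<union> I)"
    using span_superset by blast
  show "span (B \<union> I) \<subseteq> M"
    using B(1) I_subset by (intro span_minimal subspace_M) auto
  show "\<exists>c. \<exists>t\<in>span (B \<union> I). x = c *s \<nu> + t" if "x \<in> M" for x
    using that M span_breakdown_eq[of x \<nu> "B \<union> I"] by (metis add.commute diff_add_cancel subsetD)
qed (use assms br_span_subset_I[OF B] in auto)

text \<open>
  Subalgebras that are solvable modulo \<open>I\<close> by construction, since each is an ideal with abelian quotient in
  the next. Engel's theorem amounts to \<open>M\<close> itself being one of them.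
\<close>

inductive subnormal :: "'v set \<Rightarrow> bool"
  where
    base: "subnormal I"
  | adjoin: "subnormal N \<Longrightarrow> x \<in> M \<Longrightarrow> (\<And>y. y \<in> N \<Longrightarrow> br x y \<in> N) \<Longrightarrow> subnormal (span (insert x N))"

lemma span_insert_subspace: "subspace N \<Longrightarrow> y \<in> span (insert x N) \<Longrightarrow> \<exists>c. \<exists>n\<in>N. y = c *s x + n"
  using span_breakdown_eq[of y x N] span_eq_iff[of N] by (metis add.commute diff_add_cancel)

lemma adjoin_br:
  assumes N: "subspace N" "N \<subseteq> M" and "\<And>y z. y \<in> N \<Longrightarrow> z \<in> N \<Longrightarrow> br y z \<in> N"
    and x: "x \<in> M" "\<And>y. y \<in> N \<Longrightarrow> br x y \<in> N"
    and yz: "y \<in> span (insert x N)" "z \<in> span (insert x N)"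
  shows "br y z \<in> N"
proof -
  obtain c n c' n' where *: "n \<in> N" "n' \<in> N" "y = c *s x + n" "z = c' *s x + n'"
    using span_insert_subspace[OF N(1)] yz by meson
  have "br n x \<in> N"
    using x * N br_antisym[of n x] subspace_neg[OF N(1)] by auto
  then have "(c * c') *s br x x + c *s br x n' + c' *s br n x + br n n' \<in> N"
    using assms(3) * x by (intro subspace_add[OF N(1)] subspace_scale[OF N(1)])
      (auto simp: br_self subspace_0[OF N(1)])
  then show ?thesis
    using * N x by (auto simp: br_combination subset_iff)
qed

lemma subnormal_props:
  assumes "subnormal N"
  shows "subspace N \<and> I \<subseteq> N \<and> N \<subseteq> M \<and> (\<forall>x\<in>N. \<forall>y\<in>N. br x y \<in> N)"
  using assms
proof induction
  case base
  then show ?case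
    using subspace_I I_subset br_ideal by blast
next
  case (adjoin N x)
  have N: "N \<subseteq> span (insert x N)"
    using span_superset by blast
  then have "br y z \<in> span (insert x N)" if "y \<in> span (insert x N)" "z \<in> span (insert x N)" for y z
    using adjoin_br[of N x y z] adjoin that by blast
  moreover have "span (insert x N) \<subseteq> M"
    using adjoin by (intro span_minimal subspace_M) auto
  ultimately show ?case
    using adjoin N by auto
qed

lemma derived_subset_I_if_subnormal:
  assumes "subnormal N" and "derived i \<subseteq> N"
  shows "\<exists>k. derived k \<subseteq> I"
  using assms
proof (induction arbitrary: i)
  case (adjoin N x)
  note N = subnormal_props[OF adjoin(1)]
  have "derived (Suc i) \<subseteq> N"
    using adjoin.prems by (rule derived_Suc_subset) (use adjoin_br[of N x] N adjoin in auto)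
  then show ?case
    by (rule adjoin.IH)
qed blast

text \<open>
  This is the common zero vector of Engel's theorem, for the action on \<open>W / U\<close>. The vectors of \<open>W / U\<close> killed
  by \<open>N\<close> are stable under an element \<open>x\<close> normalising \<open>N\<close>, so the nilpotent operator \<open>[x, -]\<close> has a kernel there.
\<close>

lemma engel_vector:
  assumes "subnormal N" and nil: "\<And>x y. x \<in> M \<Longrightarrow> y \<in> M \<Longrightarrow> \<exists>n. (br x ^^ n) y \<in> I"
    and "subspace U" "subspace W" "I \<subseteq> U" "W \<subseteq> M" "\<not> W \<subseteq> U" "U \<subseteq> W"
    and "\<And>x u. x \<in> N \<Longrightarrow> u \<in> U \<Longrightarrow> br x u \<in> U"
    and "\<And>x w. x \<in> N \<Longrightarrow> w \<in> W \<Longrightarrow> br x w \<in> W"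
  shows "\<exists>w\<in>W - U. \<forall>x\<in>N. br x w \<in> U"
  using assms(1,3-)
proof induction
  case base
  then show ?case
    using br_ideal_left by blast
next
  case (adjoin N x)
  note N = subnormal_props[OF adjoin(1)]
  have xN: "x \<in> span (insert x N)" "N \<subseteq> span (insert x N)"
    by (auto intro: span_base)
  have U: "\<And>y u. y \<in> N \<Longrightarrow> u \<in> U \<Longrightarrow> br y u \<in> U" "\<And>u. u \<in> U \<Longrightarrow> br x u \<in> U"
    and W: "\<And>y w. y \<in> N \<Longrightarrow> w \<in> W \<Longrightarrow> br y w \<in> W" "\<And>w. w \<in> W \<Longrightarrow> br x w \<in> W"
    using adjoin.prems xN by blast+
  define W' where "W' = {w \<in> W. \<forall>y\<in>N. br y w \<in> U}"
  obtain w where w: "w \<in> W'" "w \<notin> U"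
    using adjoin.IH[OF adjoin.prems(1-6) U(1) W(1)] unfolding W'_def by blast
  have x_W': "br x v \<in> W'" if v: "v \<in> W'" for v
  proof -
    have "br y (br x v) \<in> U" if y: "y \<in> N" for y
    proof -
      have "br y x \<in> N"
        using br_antisym[of y x] adjoin.hyps y N subspace_neg[of N] by auto
      then have "br (br y x) v + br x (br y v) \<in> U"
        using v y U adjoin.prems(1) by (intro subspace_add) (auto simp: W'_def)
      then show ?thesis
        using br_leibniz[of y x v] y N adjoin.hyps(2) v \<open>W \<subseteq> M\<close> by (auto simp: W'_def subset_iff)
    qed
    then show ?thesis
      using v W by (auto simp: W'_def)
  qed
  define m where "m = (LEAST m. (br x ^^ m) w \<in> U)"
  \<comment> \<open>The last nonzero vector in the orbit of \<open>w\<close> modulo \<open>U\<close>.\<close>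
  have "\<exists>m. (br x ^^ m) w \<in> U"
    using nil[OF adjoin.hyps(2), of w] w(1) \<open>W \<subseteq> M\<close> \<open>I \<subseteq> U\<close> unfolding W'_def by blast
  then have m: "(br x ^^ m) w \<in> U"
    unfolding m_def by (rule LeastI_ex)
  then have "m \<noteq> 0"
    using w by (metis funpow_0)
  then obtain l where l: "m = Suc l"
    by (cases m) auto
  define v where "v = (br x ^^ l) w"
  have "v \<notin> U"
    using not_less_Least[of l "\<lambda>m. (br x ^^ m) w \<in> U"] by (simp add: v_def l flip: m_def)
  moreover have v: "v \<in> W'"
    unfolding v_def by (induction l) (use w x_W' in auto)
  moreover have "br y v \<in> U" if "y \<in> span (insert x N)" for y
  proof -
    obtain c n where *: "n \<in> N" "y = c *s x + n"
      using span_insert_subspace N \<open>y \<in> _\<close> by meson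
    have "br y v = c *s br x v + br n v"
      using * N adjoin v subspace_scale[OF subspace_M]
      by (auto simp: br_add_left br_scale_left W'_def subset_iff)
    also have "\<dots> \<in> U"
      using m l * v adjoin.prems(1) by (intro subspace_add subspace_scale) (auto simp: W'_def v_def)
    finally show ?thesis .
  qed
  ultimately show ?case
    by (auto simp: W'_def)
qed

text \<open>
  As long as \<open>N\<close> is not everything, the zero vector of \<open>N\<close> in \<open>M / N\<close> normalises \<open>N\<close> and can be adjoined;
  each time one of the finitely many generators becomes superfluous.
\<close>

lemma subnormal_M_if_ad_nilpotent:
  assumes nil: "\<And>x y. x \<in> M \<Longrightarrow> y \<in> M \<Longrightarrow> \<exists>n. (br x ^^ n) y \<in> I"
    and "finite G" "M \<subseteq> span (G \<union> N)" "subnormal N"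
  shows "subnormal M"
  using assms(2-)
proof (induction "card G" arbitrary: G N rule: less_induct)
  case less
  note N = subnormal_props[OF less.prems(3)]
  show ?case
  proof (cases "M \<subseteq> N")
    case True
    with N less.prems(3) show ?thesis
      by (metis subset_antisym)
  next
    case False
    then obtain x where x: "x \<in> M - N" "\<forall>y\<in>N. br y x \<in> N"
      using engel_vector[OF less.prems(3) nil, of N M] N subspace_M br_closed by blast
    have span_N: "span N = N"
      using N by simp
    then obtain g where g: "g \<in> G" "g \<in> span (insert x (G - {g} \<union> N))"
      using exchange_one_mod[OF less.prems(1), of x N] x less.prems(2) unfolding span_N by blast
    have "br x y \<in> N" if "y \<in> N" for y
      using br_antisym[of x y] x N that subspace_neg[of N] by auto
    then have sub: "subnormal (span (insert x N))"
      using less.prems(3) x by (intro adjoin) auto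
    have "insert x (G - {g} \<union> N) \<subseteq> span (G - {g} \<union> span (insert x N))"
      by (auto intro!: span_base)
    then have "g \<in> span (G - {g} \<union> span (insert x N))"
      using g(2) span_minimal[OF _ subspace_span] by blast
    then have "G \<union> N \<subseteq> span (G - {g} \<union> span (insert x N))"
      by (auto intro: span_base)
    then have "M \<subseteq> span (G - {g} \<union> span (insert x N))"
      using less.prems(2) span_minimal[OF _ subspace_span] by blast
    moreover have "card (G - {g}) < card G"
      using g(1) less.prems(1) by (metis card_Diff1_less)
    ultimately show ?thesis
      using less.hyps less.prems(1) sub by blast
  qed
qed

theorem solvable_if_ad_nilpotent:
  assumes "\<And>x y. x \<in> M \<Longrightarrow> y \<in> M \<Longrightarrow> \<exists>n. (br x ^^ n) y \<in> I"
    and "finite G" "M \<subseteq> span (G \<union> I)"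
  shows "\<exists>k. derived k \<subseteq> I"
  using derived_subset_I_if_subnormal[where i = 0] subnormal_M_if_ad_nilpotent[OF assms base] by simp

end

hide_const (open) Polynomial.coeff

section \<open>The order filtration of the power series ring\<close>

definition total_degree :: "('n::finite \<Rightarrow> nat) \<Rightarrow> nat"
  where "total_degree \<alpha> = (\<Sum>i\<in>UNIV. \<alpha> i)"

lemma total_degree_add: "total_degree (\<alpha> + \<beta>) = total_degree \<alpha> + total_degree \<beta>"
  by (simp add: total_degree_def sum.distrib)

lemma total_degree_eq_0_iff: "total_degree \<alpha> = 0 \<longleftrightarrow> \<alpha> = 0"
  by (auto simp: total_degree_def fun_eq_iff)

lemma total_degree_upd: "total_degree (\<alpha>(i := m)) + \<alpha> i = total_degree \<alpha> + m"
proof -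
  have "total_degree (\<alpha>(i := m)) = m + (\<Sum>j\<in>UNIV - {i}. \<alpha> j)"
    unfolding total_degree_def by (subst sum.remove[of _ i]) auto
  moreover have "total_degree \<alpha> = \<alpha> i + (\<Sum>j\<in>UNIV - {i}. \<alpha> j)"
    unfolding total_degree_def by (subst sum.remove[of _ i]) auto
  ultimately show ?thesis by simp
qed

lemma finite_total_degree_le: "finite {\<alpha> :: 'n::finite \<Rightarrow> nat. total_degree \<alpha> \<le> k}"
proof (rule finite_subset)
  show "{\<alpha> :: 'n \<Rightarrow> nat. total_degree \<alpha> \<le> k} \<subseteq> PiE UNIV (\<lambda>_. {..k})"
  proof
    fix \<alpha> :: "'n \<Rightarrow> nat" assume "\<alpha> \<in> {\<alpha>. total_degree \<alpha> \<le> k}"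
    moreover have "\<alpha> i \<le> total_degree \<alpha>" for i
      unfolding total_degree_def by (rule member_le_sum) auto
    ultimately show "\<alpha> \<in> PiE UNIV (\<lambda>_. {..k})"
      by (auto intro: order_trans)
  qed
qed (auto intro: finite_PiE)

lemma finite_total_degree_less: "finite {\<alpha> :: 'n::finite \<Rightarrow> nat. total_degree \<alpha> < k}"
  by (rule finite_subset[OF _ finite_total_degree_le[of k]]) auto

lemmas coeff_simps = plus_cps.rep_eq minus_cps.rep_eq uminus_cps.rep_eq zero_cps.rep_eq
  one_cps.rep_eq cps_const.rep_eq coeff_const_mult

lemma coeff_sum: "coeff (sum f A) \<alpha> = (\<Sum>a\<in>A. coeff (f a :: 'n::finite cps) \<alpha>)"
  by (induction A rule: infinite_finite_induct) (simp_all add: coeff_simps)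

lemma coeff_mult_0: "coeff (f * g) 0 = coeff f 0 * coeff (g :: 'n::finite cps) 0"
  by (simp add: times_cps.rep_eq)

lemma coeff_X_mult:
  "coeff (cps_X i * g) \<alpha> = (if \<alpha> i = 0 then 0 else coeff (g :: 'n::finite cps) (\<alpha>(i := \<alpha> i - 1)))"
proof -
  let ?e = "0(i := 1) :: 'n \<Rightarrow> nat"
  have *: "p = (?e, \<alpha>(i := \<alpha> i - 1))" if "p \<in> splits \<alpha>" "fst p = ?e" for p
  proof -
    have "?e + snd p = \<alpha>"
      using that by (auto simp: splits_def)
    then have "?e j + snd p j = \<alpha> j" for j
      by (metis plus_fun_apply)
    from this[symmetric] have "snd p = \<alpha>(i := \<alpha> i - 1)"
      by (auto simp: fun_eq_iff)
    then show ?thesis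
      using that by (simp add: prod_eq_iff)
  qed
  have "coeff (cps_X i * g) \<alpha> = (\<Sum>p\<in>splits \<alpha>. if fst p = ?e then coeff g (snd p) else 0)"
    by (simp add: times_cps.rep_eq cps_X.rep_eq case_prod_beta if_distrib[of "\<lambda>x. x * _"] cong: if_cong)
  also have "\<dots> = (\<Sum>p\<in>splits \<alpha>. if p = (?e, \<alpha>(i := \<alpha> i - 1)) then coeff g (\<alpha>(i := \<alpha> i - 1)) else 0)"
  proof (intro sum.cong refl if_cong)
    fix p assume "p \<in> splits \<alpha>"
    then show "fst p = ?e \<longleftrightarrow> p = (?e, \<alpha>(i := \<alpha> i - 1))"
      using *[of p] by (auto simp only: fst_conv)
  qed simp
  also have "\<dots> = (if (?e, \<alpha>(i := \<alpha> i - 1)) \<in> splits \<alpha> then coeff g (\<alpha>(i := \<alpha> i - 1)) else 0)"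
    by (rule sum.delta) (rule finite_splits)
  also have "(?e, \<alpha>(i := \<alpha> i - 1)) \<in> splits \<alpha> \<longleftrightarrow> \<alpha> i \<noteq> 0"
    by (auto simp: splits_def fun_eq_iff)
  finally show ?thesis
    by (cases "\<alpha> i = 0") simp_all
qed

text \<open>The power \<open>m\<^sup>k\<close> of the maximal ideal, in terms of coefficients.\<close>

definition order_ge :: "nat \<Rightarrow> 'n::finite cps set"
  where "order_ge k = {g. \<forall>\<alpha>. total_degree \<alpha> < k \<longrightarrow> coeff g \<alpha> = 0}"

lemma order_ge_0 [simp]: "order_ge 0 = UNIV"
  by (simp add: order_ge_def)

lemma order_ge_1: "order_ge (Suc 0) = max_ideal"
  by (auto simp: order_ge_def max_ideal_def total_degree_eq_0_iff)

lemma order_ge_antimono: "j \<le> k \<Longrightarrow> order_ge k \<subseteq> order_ge j"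
  by (auto simp: order_ge_def)

lemma order_ge_zero [simp]: "0 \<in> order_ge k"
  and order_ge_add: "g \<in> order_ge k \<Longrightarrow> h \<in> order_ge k \<Longrightarrow> g + h \<in> order_ge k"
  and order_ge_diff: "g \<in> order_ge k \<Longrightarrow> h \<in> order_ge k \<Longrightarrow> g - h \<in> order_ge k"
  and order_ge_const_mult: "g \<in> order_ge k \<Longrightarrow> cps_const c * g \<in> order_ge k"
  by (auto simp: order_ge_def coeff_simps)

lemma order_ge_sum: "(\<And>a. a \<in> A \<Longrightarrow> f a \<in> order_ge k) \<Longrightarrow> sum f A \<in> order_ge k"
  by (induction A rule: infinite_finite_induct) (auto intro: order_ge_add)

lemma order_ge_mult: "g \<in> order_ge j \<Longrightarrow> h \<in> order_ge k \<Longrightarrow> g * h \<in> order_ge (j + k)"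
  unfolding order_ge_def
proof safe
  fix \<alpha> :: "'a \<Rightarrow> nat"
  assume g: "\<forall>\<alpha>. total_degree \<alpha> < j \<longrightarrow> coeff g \<alpha> = 0"
    and h: "\<forall>\<alpha>. total_degree \<alpha> < k \<longrightarrow> coeff h \<alpha> = 0" and \<alpha>: "total_degree \<alpha> < j + k"
  have "coeff g \<beta> * coeff h \<gamma> = 0" if "(\<beta>, \<gamma>) \<in> splits \<alpha>" for \<beta> \<gamma>
  proof -
    have "total_degree \<beta> + total_degree \<gamma> < j + k"
      using that \<alpha> by (auto simp: splits_def total_degree_add)
    then have "total_degree \<beta> < j \<or> total_degree \<gamma> < k"
      by linarith
    then show ?thesis
      using g h by auto
  qed
  then show "coeff (g * h) \<alpha> = 0"
    unfolding times_cps.rep_eq by (intro sum.neutral) auto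
qed

lemma order_ge_mult_left: "h \<in> order_ge k \<Longrightarrow> g * h \<in> order_ge k"
  using order_ge_mult[of g 0 h k] by simp

lemma order_ge_mult_right: "h \<in> order_ge k \<Longrightarrow> h * g \<in> order_ge k"
  using order_ge_mult_left[of h k g] by (simp add: mult.commute)

lemma order_ge_Suc_mult: "g \<in> order_ge (Suc 0) \<Longrightarrow> h \<in> order_ge k \<Longrightarrow> g * h \<in> order_ge (Suc k)"
  using order_ge_mult[of g 1 h k] by simp

lemma order_ge_separated: "(\<And>k. g \<in> order_ge k) \<Longrightarrow> g = 0"
  by (rule cps_eqI) (auto simp: order_ge_def zero_cps.rep_eq)

lemma order_ge_complete:
  fixes v :: "nat \<Rightarrow> 'n::finite cps"
  assumes "\<And>k. v (Suc k) - v k \<in> order_ge k"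
  shows "\<exists>w. \<forall>k. w - v k \<in> order_ge k"
proof -
  define w where "w = Abs_cps (\<lambda>\<alpha>. coeff (v (Suc (total_degree \<alpha>))) \<alpha>)"
  have w: "coeff w \<alpha> = coeff (v (Suc (total_degree \<alpha>))) \<alpha>" for \<alpha>
    by (simp add: w_def Abs_cps_inverse)
  have stable: "coeff (v k) \<alpha> = coeff (v (Suc (total_degree \<alpha>))) \<alpha>" if "Suc (total_degree \<alpha>) \<le> k" for \<alpha> k
    using that
  proof (induction k rule: dec_induct)
    case (step k)
    then show ?case
      using assms[of k] by (simp add: order_ge_def coeff_simps)
  qed simp
  have "w - v k \<in> order_ge k" for k
    unfolding order_ge_def
  proof safe
    fix \<alpha> :: "'n \<Rightarrow> nat" assume "total_degree \<alpha> < k"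
    then show "coeff (w - v k) \<alpha> = 0"
      using stable[of \<alpha> k] by (simp add: minus_cps.rep_eq w)
  qed
  then show ?thesis by blast
qed

lemma X_order_ge: "cps_X i \<in> order_ge (Suc 0)"
  by (auto simp: order_ge_1 max_ideal_def cps_X.rep_eq fun_eq_iff)

text \<open>Each monomial of \<open>g\<close> is divisible by some variable; choosing one sorts the monomials into the \<open>h\<^sub>i\<close>.\<close>

lemma order_ge_Suc_decompose:
  fixes g :: "'n::finite cps"
  assumes "g \<in> order_ge (Suc k)"
  shows "\<exists>h. (\<forall>i. h i \<in> order_ge k) \<and> g = (\<Sum>i\<in>UNIV. cps_X i * h i)"
proof -
  define c where "c \<alpha> = (SOME i. \<alpha> i \<noteq> 0)" for \<alpha> :: "'n \<Rightarrow> nat"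
  have c: "\<alpha> (c \<alpha>) \<noteq> 0" if "\<alpha> \<noteq> 0" for \<alpha>
    using that someI_ex[of "\<lambda>i. \<alpha> i \<noteq> 0"] by (auto simp: c_def fun_eq_iff)
  define h where "h i = Abs_cps (\<lambda>\<beta>. if c (\<beta>(i := Suc (\<beta> i))) = i then coeff g (\<beta>(i := Suc (\<beta> i))) else 0)" for i
  have h: "coeff (h i) \<beta> = (if c (\<beta>(i := Suc (\<beta> i))) = i then coeff g (\<beta>(i := Suc (\<beta> i))) else 0)" for i \<beta>
    by (simp add: h_def Abs_cps_inverse)
  have "h i \<in> order_ge k" for i
  proof -
    have "total_degree (\<beta>(i := Suc (\<beta> i))) = Suc (total_degree \<beta>)" for \<beta> :: "'n \<Rightarrow> nat"
      using total_degree_upd[of \<beta> i "Suc (\<beta> i)"] by simp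
    then show ?thesis
      using assms by (auto simp: order_ge_def h)
  qed
  moreover have "g = (\<Sum>i\<in>UNIV. cps_X i * h i)"
  proof (rule cps_eqI)
    fix \<alpha> :: "'n \<Rightarrow> nat"
    have *: "coeff (cps_X i * h i) \<alpha> = (if i = c \<alpha> \<and> \<alpha> \<noteq> 0 then coeff g \<alpha> else 0)" for i
      using c[of \<alpha>] by (cases "\<alpha> i = 0") (auto simp: coeff_X_mult h)
    show "coeff g \<alpha> = coeff (\<Sum>i\<in>UNIV. cps_X i * h i) \<alpha>"
    proof (cases "\<alpha> = 0")
      case True
      have "coeff g \<alpha> = 0"
        using assms by (simp add: True order_ge_def total_degree_def)
      with True show ?thesis
        by (simp add: coeff_sum coeff_X_mult)
    next
      case False
      then show ?thesis
        by (simp add: coeff_sum *)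
    qed
  qed
  ultimately show ?thesis by blast
qed

lemma diff_const_coeff_0: "g - cps_const (coeff g 0) \<in> order_ge (Suc 0)"
  by (simp add: order_ge_1 max_ideal_def coeff_simps)

lemma linear_part:
  fixes g :: "'n::finite cps"
  assumes "g \<in> order_ge (Suc 0)"
  shows "\<exists>c. g - (\<Sum>i\<in>UNIV. cps_const (c i) * cps_X i) \<in> order_ge (Suc (Suc 0))"
proof -
  obtain h where h: "g = (\<Sum>i\<in>UNIV. cps_X i * h i)"
    using order_ge_Suc_decompose[OF assms] by blast
  have "g - (\<Sum>i\<in>UNIV. cps_const (coeff (h i) 0) * cps_X i)
      = (\<Sum>i\<in>UNIV. cps_X i * (h i - cps_const (coeff (h i) 0)))"
    by (simp add: h right_diff_distrib sum_subtractf mult.commute)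
  also have "\<dots> \<in> order_ge (Suc (Suc 0))"
    by (intro order_ge_sum order_ge_Suc_mult X_order_ge diff_const_coeff_0)
  finally show ?thesis
    by (rule exI[where x = "\<lambda>i. coeff (h i) 0"])
qed

text \<open>The geometric series inverts a series with constant term \<open>1\<close>.\<close>

lemma unit_iff: "u dvd 1 \<longleftrightarrow> coeff (u :: 'n::finite cps) 0 \<noteq> 0"
proof
  assume "u dvd 1"
  then obtain v where "1 = u * v" ..
  then have "coeff u 0 * coeff v 0 = 1"
    by (metis coeff_mult_0 one_cps.rep_eq)
  then show "coeff u 0 \<noteq> 0" by auto
next
  assume u: "coeff u 0 \<noteq> 0"
  define h where "h = 1 - cps_const (1 / coeff u 0) * u"
  have h: "h \<in> order_ge (Suc 0)"
    using u by (simp add: h_def order_ge_1 max_ideal_def coeff_simps)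
  have h_pow: "h ^ k \<in> order_ge k" for k
    by (induction k) (auto intro: order_ge_Suc_mult h)
  then obtain w where w: "\<And>k. w - (\<Sum>i<k. h ^ i) \<in> order_ge k"
    using order_ge_complete[of "\<lambda>k. \<Sum>i<k. h ^ i"] by auto
  have "(1 - h) * w - 1 = 0"
  proof (rule order_ge_separated)
    fix k
    have "(1 - h) * w - 1 = (1 - h) * (w - (\<Sum>i<k. h ^ i)) - h ^ k"
      using one_diff_power_eq[of h k] by (simp add: algebra_simps)
    also have "\<dots> \<in> order_ge k"
      by (intro order_ge_diff order_ge_mult_left w h_pow)
    finally show "(1 - h) * w - 1 \<in> order_ge k" .
  qed
  then have "1 = u * (cps_const (1 / coeff u 0) * w)"
    by (simp add: h_def algebra_simps)
  then show "u dvd 1" ..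
qed

text \<open>A separate constant keeps the simplification rules for scalar multiples away from products of series.\<close>

definition cscale :: "complex \<Rightarrow> 'n::finite cps \<Rightarrow> 'n cps"
  where "cscale c g = cps_const c * g"

global_interpretation cpsC: vector_space "cscale :: complex \<Rightarrow> 'n::finite cps \<Rightarrow> 'n cps"
  by standard (simp_all add: cscale_def algebra_simps cps_const_mult cps_const_add)

lemma coeff_cscale: "coeff (cscale c g) \<alpha> = c * coeff g \<alpha>"
  by (simp add: cscale_def coeff_const_mult)

lemma cscale_mult_left: "cscale c g * h = cscale c (g * h)"
  and cscale_mult_right: "g * cscale c h = cscale c (g * h)"
  by (simp_all add: cscale_def mult_ac)

lemma subspace_order_ge: "cpsC.subspace (order_ge k)"
  by (rule cpsC.subspaceI) (auto simp: cscale_def intro: order_ge_add order_ge_const_mult)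


section \<open>Algebra homomorphisms and changes of coordinates\<close>

locale cps_hom =
  fixes \<phi> :: "'n::finite cps \<Rightarrow> 'n cps"
  assumes hom_add: "\<phi> (g + h) = \<phi> g + \<phi> h"
    and hom_mult: "\<phi> (g * h) = \<phi> g * \<phi> h"
    and hom_const: "\<phi> (cps_const c) = cps_const c"
begin

lemma hom_diff: "\<phi> (g - h) = \<phi> g - \<phi> h"
  by (metis hom_add add_diff_cancel diff_add_cancel)

lemma hom_zero: "\<phi> 0 = 0"
  by (metis hom_diff diff_self)

lemma hom_one: "\<phi> 1 = 1"
  using hom_const[of 1] by simp

lemma hom_sum: "\<phi> (sum f A) = (\<Sum>a\<in>A. \<phi> (f a))"
  by (induction A rule: infinite_finite_induct) (simp_all add: hom_zero hom_add)

lemma hom_cscale: "\<phi> (cscale c g) = cscale c (\<phi> g)"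
  by (simp add: cscale_def hom_mult hom_const)

lemma hom_unit: "u dvd 1 \<Longrightarrow> \<phi> u dvd 1"
  by (metis dvd_def hom_mult hom_one)

text \<open>If \<open>\<phi> g\<close> had constant term \<open>c \<noteq> 0 = g(0)\<close>, then the unit \<open>g - c\<close> would have a non-unit as image.\<close>

lemma hom_max_ideal: "g \<in> order_ge (Suc 0) \<Longrightarrow> \<phi> g \<in> order_ge (Suc 0)"
proof (rule ccontr)
  assume g: "g \<in> order_ge (Suc 0)" and "\<phi> g \<notin> order_ge (Suc 0)"
  then have "coeff (\<phi> g) 0 \<noteq> 0"
    by (simp add: order_ge_1 max_ideal_def)
  then have "g - cps_const (coeff (\<phi> g) 0) dvd 1"
    using g by (simp add: unit_iff coeff_simps order_ge_1 max_ideal_def)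
  then have "\<phi> g - cps_const (coeff (\<phi> g) 0) dvd 1"
    by (metis hom_unit hom_diff hom_const)
  then show False
    by (simp add: unit_iff coeff_simps)
qed

lemma hom_order_ge: "g \<in> order_ge k \<Longrightarrow> \<phi> g \<in> order_ge k"
proof (induction k arbitrary: g)
  case (Suc k)
  then obtain h where h: "\<And>i. h i \<in> order_ge k" "g = (\<Sum>i\<in>UNIV. cps_X i * h i)"
    using order_ge_Suc_decompose by blast
  show ?case
    unfolding h(2) hom_sum hom_mult
    by (intro order_ge_sum order_ge_Suc_mult hom_max_ideal X_order_ge Suc.IH h)
qed simp

lemma coeff_hom_0: "coeff (\<phi> g) 0 = coeff g 0"
  using hom_order_ge[OF diff_const_coeff_0[of g]]
  by (simp add: hom_diff hom_const order_ge_1 max_ideal_def coeff_simps)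

text \<open>The difference \<open>\<phi> - id\<close> gains one order of vanishing for each variable split off.\<close>

lemma hom_eq_id:
  assumes "\<And>i. \<phi> (cps_X i) = cps_X i"
  shows "\<phi> g = g"
proof -
  have "\<phi> g - g \<in> order_ge k" for k
  proof (induction k arbitrary: g)
    case (Suc k)
    obtain h where h: "g - cps_const (coeff g 0) = (\<Sum>i\<in>UNIV. cps_X i * h i)"
      using order_ge_Suc_decompose[OF diff_const_coeff_0] by blast
    have g: "g = cps_const (coeff g 0) + (\<Sum>i\<in>UNIV. cps_X i * h i)"
      by (simp flip: h)
    have "\<phi> g - g = (\<Sum>i\<in>UNIV. cps_X i * (\<phi> (h i) - h i))"
      by (subst (1 2) g) 
         (simp add: hom_add hom_const hom_sum hom_mult assms right_diff_distrib sum_subtractf)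
    also have "\<dots> \<in> order_ge (Suc k)"
      by (intro order_ge_sum order_ge_Suc_mult X_order_ge Suc.IH)
    finally show ?case .
  qed simp
  then show ?thesis
    using order_ge_separated[of "\<phi> g - g"] by simp
qed

text \<open>Successive approximation: if the linear parts of all variables are hit, so are the leading forms of all series.\<close>

lemma hom_surj:
  assumes X: "\<And>i. \<exists>v\<in>order_ge (Suc 0). cps_X i - \<phi> v \<in> order_ge (Suc (Suc 0))"
  shows "surj \<phi>"
proof -
  have approx: "\<exists>g\<in>order_ge k. h - \<phi> g \<in> order_ge (Suc k)" if "h \<in> order_ge k" for k h
    using that
  proof (induction k arbitrary: h)
    case 0
    then show ?case
      using diff_const_coeff_0 by (intro bexI[of _ "cps_const (coeff h 0)"]) (auto simp: hom_const)
  next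
    case (Suc k)
    obtain l where l: "\<And>i. l i \<in> order_ge k" "h = (\<Sum>i\<in>UNIV. cps_X i * l i)"
      using order_ge_Suc_decompose[OF Suc.prems] by blast
    obtain g where g: "\<And>i. g i \<in> order_ge k" "\<And>i. l i - \<phi> (g i) \<in> order_ge (Suc k)"
      using Suc.IH[OF l(1)] by metis
    obtain v where v: "\<And>i. v i \<in> order_ge (Suc 0)" "\<And>i. cps_X i - \<phi> (v i) \<in> order_ge (Suc (Suc 0))"
      using X by metis
    define w where "w = (\<Sum>i\<in>UNIV. v i * g i)"
    have "h - \<phi> w = (\<Sum>i\<in>UNIV. cps_X i * (l i - \<phi> (g i)) + (cps_X i - \<phi> (v i)) * \<phi> (g i))"
      by (simp add: l(2) w_def hom_sum hom_mult algebra_simps flip: sum_subtractf)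
    also have "\<dots> \<in> order_ge (Suc (Suc k))"
    proof (intro order_ge_sum order_ge_add)
      fix i
      show "cps_X i * (l i - \<phi> (g i)) \<in> order_ge (Suc (Suc k))"
        by (intro order_ge_Suc_mult X_order_ge g)
      show "(cps_X i - \<phi> (v i)) * \<phi> (g i) \<in> order_ge (Suc (Suc k))"
        using order_ge_mult[OF v(2) hom_order_ge[OF g(1)]] by simp
    qed
    finally have "h - \<phi> w \<in> order_ge (Suc (Suc k))" .
    moreover have "w \<in> order_ge (Suc k)"
      unfolding w_def by (intro order_ge_sum order_ge_Suc_mult v g)
    ultimately show ?case by blast
  qed
  have "\<exists>g. \<phi> g = h" for h
  proof -
    have "\<exists>g'. h - \<phi> g' \<in> order_ge (Suc k) \<and> g' - g \<in> order_ge k" if "h - \<phi> g \<in> order_ge k" for k g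
      using approx[OF that] by (metis add_diff_cancel_left' diff_diff_eq hom_add)
    then obtain g where g: "\<And>k. h - \<phi> (g k) \<in> order_ge k" "\<And>k. g (Suc k) - g k \<in> order_ge k"
      using dependent_nat_choice[of "\<lambda>k g. h - \<phi> g \<in> order_ge k" "\<lambda>k g g'. g' - g \<in> order_ge k"]
      by auto
    then obtain w where w: "\<And>k. w - g k \<in> order_ge k"
      using order_ge_complete by blast
    have "h - \<phi> w = 0"
    proof (rule order_ge_separated)
      fix k
      have "(h - \<phi> (g k)) - \<phi> (w - g k) \<in> order_ge k"
        by (intro order_ge_diff g hom_order_ge w)
      then show "h - \<phi> w \<in> order_ge k"
        by (simp add: hom_diff)
    qed
    then show ?thesis by auto
  qed
  then show ?thesis by (metis surj_def)
qed

end

lemma cps_automorphism_iff: "cps_automorphism \<phi> \<longleftrightarrow> bij \<phi> \<and> cps_hom \<phi>"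
  by (auto simp: cps_automorphism_def cps_hom_def)

lemma cps_automorphism_inv:
  assumes "cps_automorphism \<phi>"
  shows "cps_automorphism (inv \<phi>)"
proof -
  interpret cps_hom \<phi>
    using assms by (simp add: cps_automorphism_iff)
  have "bij \<phi>"
    using assms by (simp add: cps_automorphism_iff)
  then have \<phi>: "\<phi> (inv \<phi> g) = g" "inv \<phi> (\<phi> g) = g" "bij (inv \<phi>)" for g
    by (simp_all add: bij_is_surj surj_f_inv_f bij_is_inj bij_imp_bij_inv)
  have "inv \<phi> (g + h) = inv \<phi> g + inv \<phi> h" "inv \<phi> (g * h) = inv \<phi> g * inv \<phi> h"
    "inv \<phi> (cps_const c) = cps_const c" for g h c
    by (metis \<phi> hom_add, metis \<phi> hom_mult, metis \<phi> hom_const)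
  then show ?thesis
    using \<phi>(3) by (simp add: cps_automorphism_def)
qed

definition monomial :: "('n::finite \<Rightarrow> 'n cps) \<Rightarrow> ('n \<Rightarrow> nat) \<Rightarrow> 'n cps"
  where "monomial y \<alpha> = (\<Prod>i\<in>UNIV. y i ^ \<alpha> i)"

lemma monomial_0 [simp]: "monomial y 0 = 1"
  by (simp add: monomial_def)

lemma monomial_add: "monomial y (\<alpha> + \<beta>) = monomial y \<alpha> * monomial y \<beta>"
  by (simp add: monomial_def power_add prod.distrib)

lemma monomial_single: "monomial y (0(i := 1)) = y i"
proof -
  have "monomial y (0(i := 1)) = (\<Prod>j\<in>UNIV. if j = i then y j else 1)"
    unfolding monomial_def by (intro prod.cong) auto
  then show ?thesis by simp
qed

lemma monomial_upd_Suc: "monomial y (\<alpha>(i := Suc (\<alpha> i))) = y i * monomial y \<alpha>"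
proof -
  have "\<alpha>(i := Suc (\<alpha> i)) = 0(i := 1) + \<alpha>"
    by (auto simp: fun_eq_iff)
  then show ?thesis
    by (simp only: monomial_add monomial_single)
qed

lemma exponent_induct [case_names zero upd]:
  fixes P :: "('n::finite \<Rightarrow> nat) \<Rightarrow> bool"
  assumes "P 0" and "\<And>\<alpha> i. P \<alpha> \<Longrightarrow> P (\<alpha>(i := Suc (\<alpha> i)))"
  shows "P \<alpha>"
proof (induction "total_degree \<alpha>" arbitrary: \<alpha>)
  case 0
  then have "\<alpha> = 0"
    using total_degree_eq_0_iff[of \<alpha>] by simp
  then show ?case
    using assms(1) by (simp only:)
next
  case (Suc m)
  then have "\<alpha> \<noteq> 0"
    using total_degree_eq_0_iff[of \<alpha>] by simp
  then obtain i where i: "\<alpha> i \<noteq> 0"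
    by (auto simp: fun_eq_iff)
  define \<beta> where "\<beta> = \<alpha>(i := \<alpha> i - 1)"
  have "total_degree \<beta> = m"
    using total_degree_upd[of \<alpha> i "\<alpha> i - 1"] i Suc.hyps(2) by (simp add: \<beta>_def)
  then have "P (\<beta>(i := Suc (\<beta> i)))"
    using Suc.hyps(1) assms(2) by simp
  then show ?case
    using i by (simp add: \<beta>_def)
qed

text \<open>The substitution \<open>g(y)\<close>; for \<open>y\<^sub>i\<close> without constant term only finitely many monomials meet each degree.\<close>

definition subst :: "('n::finite \<Rightarrow> 'n cps) \<Rightarrow> 'n cps \<Rightarrow> 'n cps"
  where "subst y g = Abs_cps (\<lambda>\<beta>. \<Sum>\<alpha> | total_degree \<alpha> \<le> total_degree \<beta>.
    coeff g \<alpha> * coeff (monomial y \<alpha>) \<beta>)"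

context
  fixes y :: "'n::finite \<Rightarrow> 'n cps"
  assumes y: "\<And>i. y i \<in> order_ge (Suc 0)"
begin

lemma coeff_subst:
  "coeff (subst y g) \<beta> = (\<Sum>\<alpha> | total_degree \<alpha> \<le> total_degree \<beta>. coeff g \<alpha> * coeff (monomial y \<alpha>) \<beta>)"
  by (simp add: subst_def Abs_cps_inverse)

lemma monomial_order_ge: "monomial y \<alpha> \<in> order_ge (total_degree \<alpha>)"
proof (induction \<alpha> rule: exponent_induct)
  case zero
  then show ?case by (simp add: total_degree_def)
next
  case (upd \<alpha> i)
  have "total_degree (\<alpha>(i := Suc (\<alpha> i))) = Suc (total_degree \<alpha>)"
    using total_degree_upd[of \<alpha> i "Suc (\<alpha> i)"] by simp
  then show ?case
    using upd by (simp only: monomial_upd_Suc) (intro order_ge_Suc_mult y)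
qed

lemma subst_approx:
  "subst y g - (\<Sum>\<alpha> | total_degree \<alpha> < k. cscale (coeff g \<alpha>) (monomial y \<alpha>)) \<in> order_ge k"
  unfolding order_ge_def
proof safe
  fix \<beta> :: "'n \<Rightarrow> nat" assume \<beta>: "total_degree \<beta> < k"
  have "(\<Sum>\<alpha> | total_degree \<alpha> < k. coeff g \<alpha> * coeff (monomial y \<alpha>) \<beta>) = coeff (subst y g) \<beta>"
    unfolding coeff_subst
    using \<beta> monomial_order_ge by (intro sum.mono_neutral_right finite_total_degree_less)
      (auto simp: order_ge_def)
  then show "coeff (subst y g - (\<Sum>\<alpha> | total_degree \<alpha> < k. cscale (coeff g \<alpha>) (monomial y \<alpha>))) \<beta> = 0"
    by (simp add: coeff_simps coeff_sum coeff_cscale)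
qed

lemma subst_X: "subst y (cps_X i) = y i"
proof (rule cps_eqI)
  fix \<beta> :: "'n \<Rightarrow> nat"
  have e: "total_degree (0(i := 1)) = 1"
    using total_degree_upd[of 0 i 1] by (simp add: total_degree_def)
  have "coeff (subst y (cps_X i)) \<beta>
      = (\<Sum>\<alpha> | total_degree \<alpha> \<le> total_degree \<beta>. if \<alpha> = 0(i := 1) then coeff (y i) \<beta> else 0)"
    unfolding coeff_subst cps_X.rep_eq by (intro sum.cong) (auto simp: monomial_single[unfolded One_nat_def])
  also have "\<dots> = (if 1 \<le> total_degree \<beta> then coeff (y i) \<beta> else 0)"
    by (subst sum.delta[OF finite_total_degree_le]) (simp add: e[unfolded One_nat_def])
  also have "\<dots> = coeff (y i) \<beta>"
    using y[of i] by (auto simp: order_ge_def)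
  finally show "coeff (subst y (cps_X i)) \<beta> = coeff (y i) \<beta>" .
qed

lemma cps_hom_subst: "cps_hom (subst y)"
proof
  show "subst y (g + h) = subst y g + subst y h" for g h
    by (rule cps_eqI) (simp add: coeff_subst coeff_simps distrib_right sum.distrib)
  show "subst y (cps_const c) = cps_const c" for c
  proof (rule cps_eqI)
    fix \<beta> :: "'n \<Rightarrow> nat"
    have "coeff (subst y (cps_const c)) \<beta>
        = (\<Sum>\<alpha> :: 'n \<Rightarrow> nat | total_degree \<alpha> \<le> total_degree \<beta>. if \<alpha> = 0 then c * coeff (1 :: 'n cps) \<beta> else 0)"
      unfolding coeff_subst cps_const.rep_eq by (intro sum.cong) auto
    also have "\<dots> = c * coeff (1 :: 'n cps) \<beta>"
      by (subst sum.delta[OF finite_total_degree_le]) (simp add: total_degree_def)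
    finally show "coeff (subst y (cps_const c)) \<beta> = coeff (cps_const c) \<beta>"
      by (simp add: coeff_simps)
  qed
  show "subst y (g * h) = subst y g * subst y h" for g h
  proof -
    have "subst y (g * h) - subst y g * subst y h \<in> order_ge k" for k
    proof -
      \<comment> \<open>\<open>P g\<close> is the substitution in the truncation of \<open>g\<close>; the excess of \<open>P g * P h\<close> over \<open>P (g * h)\<close>
          consists of monomials of degree at least \<open>k\<close>.\<close>
      define P where "P g = (\<Sum>\<alpha> | total_degree \<alpha> < k. cscale (coeff g \<alpha>) (monomial y \<alpha>))" for g
      define c where "c p = cscale (coeff g (fst p) * coeff h (snd p)) (monomial y (fst p + snd p))" for p
      let ?D = "{\<alpha> :: 'n \<Rightarrow> nat. total_degree \<alpha> < k}"
      have P: "subst y g - P g \<in> order_ge k" for g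
        unfolding P_def by (rule subst_approx)
      have "P (g * h) = (\<Sum>\<alpha>\<in>?D. \<Sum>p\<in>splits \<alpha>. c p)"
        unfolding P_def times_cps.rep_eq cpsC.scale_sum_left
        by (intro sum.cong) (auto simp: c_def splits_def case_prod_beta)
      also have "\<dots> = (\<Sum>q\<in>(SIGMA \<alpha>:?D. splits \<alpha>). c (snd q))"
        by (subst sum.Sigma) (auto simp: finite_total_degree_less case_prod_beta)
      also have "\<dots> = (\<Sum>p\<in>{p \<in> ?D \<times> ?D. total_degree (fst p + snd p) < k}. c p)"
        by (rule sum.reindex_bij_witness[where i = "\<lambda>p. (fst p + snd p, p)" and j = snd])
           (auto simp: splits_def total_degree_add)
      finally have Pgh: "P (g * h) = (\<Sum>p\<in>{p \<in> ?D \<times> ?D. total_degree (fst p + snd p) < k}. c p)" .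
      have "P g * P h = (\<Sum>p\<in>?D \<times> ?D. c p)"
        unfolding P_def sum_product sum.cartesian_product
        by (intro sum.cong) (auto simp: c_def cscale_mult_left cscale_mult_right monomial_add)
      also have "\<dots> = (\<Sum>p\<in>{p \<in> ?D \<times> ?D. total_degree (fst p + snd p) < k}. c p)
          + (\<Sum>p\<in>{p \<in> ?D \<times> ?D. \<not> total_degree (fst p + snd p) < k}. c p)"
        by (subst sum.union_disjoint[symmetric])
           (auto simp: finite_total_degree_less intro!: sum.cong)
      finally have "P g * P h - P (g * h) = (\<Sum>p\<in>{p \<in> ?D \<times> ?D. \<not> total_degree (fst p + snd p) < k}. c p)"
        by (simp add: Pgh)
      also have "\<dots> \<in> order_ge k"
      proof (rule order_ge_sum)
        fix p assume "p \<in> {p \<in> ?D \<times> ?D. \<not> total_degree (fst p + snd p) < k}"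
        then have "monomial y (fst p + snd p) \<in> order_ge k"
          using monomial_order_ge[of "fst p + snd p"] order_ge_antimono[of k "total_degree (fst p + snd p)"]
          by auto
        then show "c p \<in> order_ge k"
          unfolding c_def cscale_def by (rule order_ge_const_mult)
      qed
      finally have gh: "P g * P h - P (g * h) \<in> order_ge k" .
      have "subst y (g * h) - subst y g * subst y h = (subst y (g * h) - P (g * h))
          - (P g * P h - P (g * h)) - (subst y g - P g) * subst y h - P g * (subst y h - P h)"
        by (simp add: algebra_simps)
      also have "\<dots> \<in> order_ge k"
        by (intro order_ge_diff P gh order_ge_mult_left order_ge_mult_right)
      finally show ?thesis .
    qed
    then show ?thesis
      using order_ge_separated[of "subst y (g * h) - subst y g * subst y h"] by simp
  qed
qed

end

text \<open>The linear parts of the \<open>y\<^sub>i\<close> form a basis of \<open>m / m\<^sup>2\<close>.\<close>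

definition coordinates :: "('n::finite \<Rightarrow> 'n cps) \<Rightarrow> bool"
  where "coordinates y \<longleftrightarrow> (\<forall>i. y i \<in> order_ge (Suc 0)) \<and>
    (\<forall>i. \<exists>a. cps_X i - (\<Sum>j\<in>UNIV. cscale (a j) (y j)) \<in> order_ge (Suc (Suc 0))) \<and>
    (\<forall>c. (\<Sum>j\<in>UNIV. cscale (c j) (y j)) \<in> order_ge (Suc (Suc 0)) \<longrightarrow> c = (\<lambda>_. 0))"

lemma surj_subst:
  assumes "coordinates y"
  shows "surj (subst y)"
proof -
  have y: "\<And>i. y i \<in> order_ge (Suc 0)"
    using assms by (simp add: coordinates_def)
  interpret cps_hom "subst y"
    by (rule cps_hom_subst[OF y])
  show ?thesis
  proof (rule hom_surj)
    fix i
    obtain a where a: "cps_X i - (\<Sum>j\<in>UNIV. cscale (a j) (y j)) \<in> order_ge (Suc (Suc 0))"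
      using assms unfolding coordinates_def by blast
    define v where "v = (\<Sum>j\<in>UNIV. cscale (a j) (cps_X j))"
    have "v \<in> order_ge (Suc 0)"
      unfolding v_def cscale_def by (intro order_ge_sum order_ge_const_mult X_order_ge)
    moreover have "subst y v = (\<Sum>j\<in>UNIV. cscale (a j) (y j))"
      by (simp add: v_def hom_sum hom_cscale subst_X[OF y])
    ultimately show "\<exists>v\<in>order_ge (Suc 0). cps_X i - subst y v \<in> order_ge (Suc (Suc 0))"
      using a by (intro bexI[of _ v]) simp_all
  qed
qed

text \<open>
  Preimages \<open>z\<^sub>i\<close> of the variables are again coordinates, so substituting \<open>z\<close> is a
  homomorphism which is surjective as well as a right inverse of substituting \<open>y\<close>.
\<close>

theorem cps_automorphism_subst:
  fixes y :: "'n::finite \<Rightarrow> 'n cps"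
  assumes "coordinates y"
  shows "cps_automorphism (subst y)"
proof -
  have y: "\<And>i. y i \<in> order_ge (Suc 0)"
    and indep: "\<And>c. (\<Sum>j\<in>UNIV. cscale (c j) (y j)) \<in> order_ge (Suc (Suc 0)) \<Longrightarrow> c = (\<lambda>_. 0)"
    using assms by (simp_all add: coordinates_def)
  interpret cps_hom "subst y"
    by (rule cps_hom_subst[OF y])
  define z where "z i = inv (subst y) (cps_X i)" for i
  have z: "subst y (z i) = cps_X i" for i
    by (simp add: z_def surj_f_inv_f[OF surj_subst[OF assms]])
  have z1: "z i \<in> order_ge (Suc 0)" for i
    using coeff_hom_0[of "z i"] X_order_ge[of i] by (simp add: z order_ge_1 max_ideal_def)
  have "coordinates z"
    unfolding coordinates_def
  proof (intro conjI allI impI z1)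
    fix i
    obtain a where a: "y i - (\<Sum>j\<in>UNIV. cscale (a j) (cps_X j)) \<in> order_ge (Suc (Suc 0))"
      using linear_part[OF y] by (auto simp: cscale_def)
    define h where "h = cps_X i - (\<Sum>j\<in>UNIV. cscale (a j) (z j))"
    have "h \<in> order_ge (Suc 0)"
      unfolding h_def cscale_def
      by (intro order_ge_diff order_ge_sum order_ge_const_mult X_order_ge z1)
    then obtain c where c: "h - (\<Sum>j\<in>UNIV. cscale (c j) (cps_X j)) \<in> order_ge (Suc (Suc 0))"
      using linear_part by (auto simp: cscale_def)
    have "subst y h \<in> order_ge (Suc (Suc 0))"
      using a by (simp add: h_def hom_diff hom_sum hom_cscale z subst_X[OF y])
    from order_ge_diff[OF this hom_order_ge[OF c]]
    have "(\<Sum>j\<in>UNIV. cscale (c j) (y j)) \<in> order_ge (Suc (Suc 0))"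
      by (simp add: hom_diff hom_sum hom_cscale subst_X[OF y])
    then have "c = (\<lambda>_. 0)"
      by (rule indep)
    then show "\<exists>a. cps_X i - (\<Sum>j\<in>UNIV. cscale (a j) (z j)) \<in> order_ge (Suc (Suc 0))"
      using c unfolding h_def by (auto intro!: exI[of _ a])
  next
    fix c assume "(\<Sum>j\<in>UNIV. cscale (c j) (z j)) \<in> order_ge (Suc (Suc 0))"
    from hom_order_ge[OF this] have *: "(\<Sum>j\<in>UNIV. cscale (c j) (cps_X j)) \<in> order_ge (Suc (Suc 0))"
      by (simp add: hom_sum hom_cscale z)
    have "c i = 0" for i
    proof -
      have "total_degree (0(i := 1)) = 1"
        using total_degree_upd[of 0 i 1] by (simp add: total_degree_def)
      then have "coeff (\<Sum>j\<in>UNIV. cscale (c j) (cps_X j)) (0(i := 1)) = 0"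
        using * unfolding order_ge_def by fastforce
      moreover have "coeff (cscale (c j) (cps_X j)) (0(i := 1)) = (if j = i then c j else 0)" for j
        by (auto simp: coeff_cscale cps_X.rep_eq fun_upd_def fun_eq_iff)
      ultimately show ?thesis
        by (simp add: coeff_sum)
    qed
    then show "c = (\<lambda>_. 0)"
      by blast
  qed
  interpret z: cps_hom "subst z"
    by (rule cps_hom_subst[OF z1])
  interpret c: cps_hom "\<lambda>g. subst y (subst z g)"
    by unfold_locales (simp_all add: hom_add hom_mult hom_const z.hom_add z.hom_mult z.hom_const)
  have right_inv: "subst y (subst z g) = g" for g
    by (rule c.hom_eq_id) (simp add: subst_X[OF z1] z)
  then have "inj (subst y)"
    using surjD[OF surj_subst[OF \<open>coordinates z\<close>]] by (metis injI)
  then show ?thesis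
    using surj_subst[OF assms] cps_hom_axioms by (simp add: cps_automorphism_iff bij_def)
qed

text \<open>A basis of \<open>m / m\<^sup>2\<close> is chosen among the linear parts of the spanning set.\<close>

lemma coordinates_from_spanning_set:
  fixes S :: "'n::finite cps set"
  assumes "S \<subseteq> order_ge (Suc 0)" and "order_ge (Suc 0) \<subseteq> cpsC.span (S \<union> order_ge (Suc (Suc 0)))"
  shows "\<exists>y. (\<forall>i. y i \<in> S) \<and> coordinates y"
proof -
  define lin :: "'n cps \<Rightarrow> complex ^ 'n" where "lin g = (\<chi> i. coeff g (0(i := 1)))" for g
  have lin_add: "lin (g + h) = lin g + lin h" and lin_scale: "lin (cscale c g) = c *s lin g" for g h c
    by (simp_all add: lin_def vec_eq_iff coeff_simps coeff_cscale)
  have lin_diff: "lin (g - h) = lin g - lin h" for g h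
    by (simp add: lin_def vec_eq_iff coeff_simps)
  have lin_sum: "lin (\<Sum>j\<in>A. cscale (c j) (y j)) = (\<Sum>j\<in>A. c j *s lin (y j))" for A c and y :: "'n \<Rightarrow> 'n cps"
    by (simp add: lin_def vec_eq_iff coeff_sum coeff_cscale)
  have deg: "total_degree (0(i := 1)) = 1" for i :: 'n
    using total_degree_upd[of 0 i 1] by (simp add: total_degree_def)
  have lin_eq_0: "lin g = 0 \<longleftrightarrow> g \<in> order_ge (Suc (Suc 0))" if g: "g \<in> order_ge (Suc 0)" for g
  proof
    assume "lin g = 0"
    then have 0: "coeff g (0(i := 1)) = 0" for i
      by (simp add: lin_def vec_eq_iff)
    have "coeff g \<alpha> = 0" if "total_degree \<alpha> < Suc (Suc 0)" for \<alpha>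
    proof (cases "\<alpha> = 0")
      case True
      then show ?thesis
        using g by (simp add: order_ge_1 max_ideal_def)
    next
      case False
      then obtain i where i: "\<alpha> i \<noteq> 0"
        by (auto simp: fun_eq_iff)
      have "\<alpha> i \<le> total_degree \<alpha>"
        unfolding total_degree_def by (rule member_le_sum) auto
      then have "\<alpha> i = 1"
        using i that by linarith
      moreover from this have "total_degree (\<alpha>(i := 0)) = 0"
        using total_degree_upd[of \<alpha> i 0] that by linarith
      then have "\<alpha>(i := 0) = 0"
        by (simp only: total_degree_eq_0_iff)
      ultimately have "\<alpha> = 0(i := 1)"
        by (metis fun_upd_triv fun_upd_upd)
      then show ?thesis
        using 0 by simp
    qed
    then show "g \<in> order_ge (Suc (Suc 0))"
      by (simp add: order_ge_def)
  next
    assume "g \<in> order_ge (Suc (Suc 0))"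
    then show "lin g = 0"
      using deg by (auto simp: lin_def vec_eq_iff order_ge_def)
  qed
  have "lin g \<in> vec.span (lin ` S)" if "g \<in> cpsC.span (S \<union> order_ge (Suc (Suc 0)))" for g
    using that
  proof (induction rule: cpsC.span_induct_alt)
    case base
    then show ?case
      using lin_eq_0[of 0] vec.span_zero by simp
  next
    case (step c x y)
    have "lin x \<in> vec.span (lin ` S)"
    proof (cases "x \<in> S")
      case True
      then show ?thesis
        by (intro vec.span_base) blast
    next
      case False
      then have "x \<in> order_ge (Suc (Suc 0))" "x \<in> order_ge (Suc 0)"
        using step(1) order_ge_antimono[of "Suc 0" "Suc (Suc 0)"] by auto
      then show ?thesis
        using lin_eq_0[of x] vec.span_zero by simp
    qed
    then show ?case
      using step by (simp add: lin_add lin_scale vec.span_add vec.span_scale)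
  qed
  then have X: "axis i 1 \<in> vec.span (lin ` S)" for i
  proof -
    have "lin (cps_X i) = axis i 1"
      by (auto simp: lin_def vec_eq_iff axis_def cps_X.rep_eq fun_upd_def fun_eq_iff)
    then show ?thesis
      using \<open>\<And>g. g \<in> cpsC.span _ \<Longrightarrow> lin g \<in> _\<close> assms(2) X_order_ge[of i] by (metis subsetD)
  qed
  have "v \<in> vec.span (lin ` S)" for v
  proof -
    have "v = (\<Sum>i\<in>UNIV. v $ i *s axis i 1)"
      by (rule basis_expansion[symmetric])
    also have "\<dots> \<in> vec.span (lin ` S)"
      by (intro vec.span_sum vec.span_scale X)
    finally show ?thesis .
  qed
  then have span: "vec.span (lin ` S) = UNIV"
    by blast
  obtain B where B: "B \<subseteq> lin ` S" "vec.independent B" "lin ` S \<subseteq> vec.span B" "card B = vec.dim (lin ` S)"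
    using vec.basis_exists by blast
  have spanB: "vec.span B = UNIV"
    using vec.span_minimal[OF B(3) vec.subspace_span] span by auto
  have "finite B"
    using B(2) by (rule vec.finiteI_independent)
  moreover have "card B = CARD('n)"
    using vec.dim_eq_card[of B UNIV] B(2) spanB by (simp add: card_cart_basis)
  ultimately obtain b :: "'n \<Rightarrow> complex ^ 'n" where b: "bij_betw b UNIV B"
    by (metis finite_same_card_bij finite_class.finite_UNIV)
  have "\<exists>x\<in>S. lin x = b i" for i
    using b B(1) by (metis bij_betwE UNIV_I imageE subsetD)
  then obtain y where y: "\<And>i. y i \<in> S" "\<And>i. lin (y i) = b i"
    by metis
  have y1: "y i \<in> order_ge (Suc 0)" for i
    using y(1) assms(1) by blast
  have comb: "(\<Sum>j\<in>UNIV. cscale (a j) (y j)) \<in> order_ge (Suc 0)" for a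
    unfolding cscale_def by (intro order_ge_sum order_ge_const_mult y1)
  have "coordinates y"
    unfolding coordinates_def
  proof (intro conjI allI impI y1)
    fix i
    have "axis i 1 \<in> vec.span B"
      by (simp add: spanB)
    then obtain u where u: "axis i 1 = (\<Sum>v\<in>B. u v *s v)"
      using vec.span_finite[OF \<open>finite B\<close>] by auto
    have "(\<Sum>v\<in>B. u v *s v) = (\<Sum>j\<in>UNIV. u (b j) *s b j)"
      by (rule sum.reindex_bij_betw[OF b, symmetric])
    moreover have "lin (cps_X i) = axis i 1"
      by (auto simp: lin_def vec_eq_iff axis_def cps_X.rep_eq fun_upd_def fun_eq_iff)
    ultimately have "lin (cps_X i - (\<Sum>j\<in>UNIV. cscale (u (b j)) (y j))) = 0"
      using u by (simp add: lin_diff lin_sum y(2))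
    then have "cps_X i - (\<Sum>j\<in>UNIV. cscale (u (b j)) (y j)) \<in> order_ge (Suc (Suc 0))"
      using lin_eq_0[OF order_ge_diff[OF X_order_ge comb]] by simp
    then show "\<exists>a. cps_X i - (\<Sum>j\<in>UNIV. cscale (a j) (y j)) \<in> order_ge (Suc (Suc 0))"
      by (rule exI[where x = "\<lambda>j. u (b j)"])
  next
    fix c assume "(\<Sum>j\<in>UNIV. cscale (c j) (y j)) \<in> order_ge (Suc (Suc 0))"
    then have "(\<Sum>j\<in>UNIV. c j *s b j) = 0"
      using lin_eq_0[OF comb] by (simp add: lin_sum y(2))
    also have "(\<Sum>j\<in>UNIV. c j *s b j) = (\<Sum>v\<in>B. c (inv_into UNIV b v) *s v)"
      using b by (subst sum.reindex_bij_betw[OF b, symmetric]) (simp add: bij_betw_def)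
    finally have "\<forall>v\<in>B. c (inv_into UNIV b v) = 0"
      using B(2) \<open>finite B\<close> vec.independentD[of B B "\<lambda>v. c (inv_into UNIV b v)"] by blast
    then show "c = (\<lambda>_. 0)"
      using b by (auto simp: bij_betw_def fun_eq_iff)
  qed
  with y(1) show ?thesis by blast
qed

section \<open>The semisimple part of a logarithmic vector field\<close>

lemma Der_const_eq_0:
  assumes "\<delta> \<in> Der"
  shows "\<delta> (cps_const c) = 0"
proof -
  have "\<delta> 1 = 0"
    using Der_mult[OF assms, of 1 1] by simp
  then show ?thesis
    using Der_const[OF assms, of c 1] by simp
qed

lemma Der_sum: "\<delta> \<in> Der \<Longrightarrow> \<delta> (sum f A) = (\<Sum>a\<in>A. \<delta> (f a))"
  by (induction A rule: infinite_finite_induct) (simp_all add: Der_zero Der_add)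

lemma Der_cscale: "\<delta> \<in> Der \<Longrightarrow> \<delta> (cscale c g) = cscale c (\<delta> g)"
  by (simp add: cscale_def Der_const)

lemma Der_order_ge:
  assumes "\<delta> \<in> Der" and "\<And>g. g \<in> max_ideal \<Longrightarrow> \<delta> g \<in> max_ideal" and "g \<in> order_ge k"
  shows "\<delta> g \<in> order_ge k"
  using assms(3)
proof (induction k arbitrary: g)
  case (Suc k)
  then obtain h where h: "\<And>i. h i \<in> order_ge k" "g = (\<Sum>i\<in>UNIV. cps_X i * h i)"
    using order_ge_Suc_decompose by blast
  have "\<delta> (cps_X i) \<in> order_ge (Suc 0)" for i
    using assms(2) X_order_ge by (auto simp: order_ge_1)
  then show ?case
    unfolding h(2) Der_sum[OF assms(1)] Der_mult[OF assms(1)]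
    by (intro order_ge_sum order_ge_add order_ge_Suc_mult X_order_ge Suc.IH h(1)) auto
qed simp

lemma complete_filtered_cps:
  assumes "\<And>g h. T (g + h) = T g + T h" and "\<And>c g. T (cscale c g) = cscale c (T g)"
    and "\<And>k g. g \<in> order_ge k \<Longrightarrow> T g \<in> order_ge k"
  shows "complete_filtered_operator cscale T (order_ge :: nat \<Rightarrow> 'n::finite cps set)"
proof
  show "T (u + v) = T u + T v" "T (cscale c v) = cscale c (T v)" for u v c
    by (fact assms)+
  show "cpsC.subspace (order_ge k :: 'n cps set)" for k
    by (rule subspace_order_ge)
  show "(order_ge (Suc k) :: 'n cps set) \<subseteq> order_ge k" for k
    by (rule order_ge_antimono) simp
  show "T ` order_ge k \<subseteq> order_ge k" for k
    using assms(3) by blast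
  show "\<exists>w. \<forall>k. w - v k \<in> order_ge k" if "\<And>k. v (Suc k) - v k \<in> order_ge k" for v :: "nat \<Rightarrow> 'n cps"
    using that by (rule order_ge_complete)
  show "\<exists>P. finite P \<and> (\<forall>l\<in>P. Vector_Spaces.linear cscale (*) l) \<and>
      (\<forall>v\<in>order_ge k :: 'n cps set. (\<forall>l\<in>P. l v = 0) \<longrightarrow> v \<in> order_ge (Suc k))" for k
  proof (intro exI conjI ballI impI)
    show "finite ((\<lambda>\<alpha> g. coeff (g :: 'n cps) \<alpha>) ` {\<alpha>. total_degree \<alpha> \<le> k})"
      by (intro finite_imageI finite_total_degree_le)
    show "Vector_Spaces.linear cscale (*) l"
      if "l \<in> (\<lambda>\<alpha> g. coeff (g :: 'n cps) \<alpha>) ` {\<alpha>. total_degree \<alpha> \<le> k}" for l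
      using that by (elim imageE) (unfold_locales; simp add: coeff_simps coeff_cscale distrib_left distrib_right)
    show "v \<in> order_ge (Suc k)"
      if "\<forall>l\<in>(\<lambda>\<alpha> g. coeff (g :: 'n cps) \<alpha>) ` {\<alpha>. total_degree \<alpha> \<le> k}. l v = 0" for v
      using that by (auto simp: order_ge_def less_Suc_eq_le)
  qed
qed

text \<open>
  In the binomial expansion of \<open>C\<^sup>p\<^sup>+\<^sup>q (\<beta> a b)\<close> every term contains a multiple of \<open>A\<^sup>p a\<close> or of \<open>B\<^sup>q b\<close>. The factors may
  be series, or a vector field and the series that it is applied to.
\<close>

lemma leibniz_funpow:
  fixes \<beta> :: "'a \<Rightarrow> 'b \<Rightarrow> 'c::ab_group_add"
  assumes leibniz: "\<And>a b. a \<in> D \<Longrightarrow> C (\<beta> a b) = \<beta> (A a) b + \<beta> a (B b)"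
    and D: "\<And>a. a \<in> D \<Longrightarrow> A a \<in> D"
    and C: "\<And>x y. C (x + y) = C x + C y"
    and F: "\<And>x y. x \<in> F \<Longrightarrow> y \<in> F \<Longrightarrow> x + y \<in> F" "\<And>x. x \<in> F \<Longrightarrow> C x \<in> F"
    and left: "\<And>a b. a \<in> D \<Longrightarrow> a \<in> FA \<Longrightarrow> \<beta> a b \<in> F"
    and right: "\<And>a b. a \<in> D \<Longrightarrow> b \<in> FB \<Longrightarrow> \<beta> a b \<in> F"
    and "a \<in> D" and "(A ^^ p) a \<in> FA" and "(B ^^ q) b \<in> FB"
  shows "(C ^^ (p + q)) (\<beta> a b) \<in> F"
  using assms(8-)
proof (induction "p + q" arbitrary: p q a b)
  case 0
  then show ?case
    using left by simp
next
  case (Suc m)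
  have F_pow: "x \<in> F \<Longrightarrow> (C ^^ n) x \<in> F" for n x
    by (induction n) (auto intro: F)
  have C_pow: "(C ^^ n) (x + y) = (C ^^ n) x + (C ^^ n) y" for n x y
    by (induction n) (simp_all add: C)
  show ?case
  proof (cases "p = 0 \<or> q = 0")
    case True
    then have "\<beta> a b \<in> F"
      using left right Suc.prems by auto
    then show ?thesis
      by (rule F_pow)
  next
    case False
    then obtain p' q' where pq: "p = Suc p'" "q = Suc q'"
      by (metis not0_implies_Suc)
    have "(A ^^ p') (A a) \<in> FA" "(B ^^ q') (B b) \<in> FB"
      using Suc.prems by (simp_all add: pq funpow_swap1)
    then have "(C ^^ m) (\<beta> (A a) b) \<in> F" "(C ^^ m) (\<beta> a (B b)) \<in> F"
      using Suc.hyps(1)[of p' q "A a" b] Suc.hyps(1)[of p q' a "B b"] Suc.hyps(2) Suc.prems D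
      by (simp_all add: pq)
    then have "(C ^^ m) (C (\<beta> a b)) \<in> F"
      using F(1) by (simp add: leibniz Suc.prems(1) C_pow)
    then show ?thesis
      by (simp flip: Suc.hyps(2) add: funpow_swap1)
  qed
qed

definition weight :: "('n::finite \<Rightarrow> complex) \<Rightarrow> ('n \<Rightarrow> nat) \<Rightarrow> complex"
  where "weight w \<alpha> = (\<Sum>i\<in>UNIV. w i * of_nat (\<alpha> i))"

lemma weight_upd_Suc: "weight w (\<alpha>(i := Suc (\<alpha> i))) = w i + weight w \<alpha>"
proof -
  have "weight w (\<alpha>(i := Suc (\<alpha> i))) = (\<Sum>j\<in>UNIV. (if j = i then w i else 0) + w j * of_nat (\<alpha> j))"
    unfolding weight_def by (intro sum.cong) (auto simp: algebra_simps)
  then show ?thesis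
    by (simp add: sum.distrib weight_def)
qed

lemma weight_0 [simp]: "weight w 0 = 0"
  by (simp add: weight_def)

lemma weight_single: "weight w (0(i := 1)) = w i"
  using weight_upd_Suc[of w 0 i] by simp

locale vanishing_field =
  fixes \<delta> :: "'n::finite vfield"
  assumes Der: "\<delta> \<in> Der" and max_ideal: "g \<in> max_ideal \<Longrightarrow> \<delta> g \<in> max_ideal"
begin

lemma order_ge: "g \<in> order_ge k \<Longrightarrow> \<delta> g \<in> order_ge k"
  using Der max_ideal by (rule Der_order_ge)

sublocale complete_filtered_operator cscale \<delta> order_ge
  by (rule complete_filtered_cps) (use Der order_ge in \<open>auto simp: Der_add Der_cscale\<close>)

lemma stable_pair_UNIV: "stable_pair cscale \<delta> UNIV (order_ge k)"
  by unfold_locales (use subspace_order_ge order_ge in auto)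

lemma geigen_UNIV_iff:
  "v \<in> stable_pair.geigen cscale \<delta> UNIV (order_ge k) \<mu> \<longleftrightarrow> (\<exists>N. (shift \<mu> ^^ N) v \<in> order_ge k)"
  by (simp add: stable_pair.geigen_def[OF stable_pair_UNIV])

lemma top_geigen_mult:
  assumes "g \<in> top_geigen \<mu>" and "h \<in> top_geigen \<nu>"
  shows "g * h \<in> top_geigen (\<mu> + \<nu>)"
  unfolding top_geigen_def
proof safe
  fix k
  obtain p q where pq: "(shift \<mu> ^^ p) g \<in> order_ge k" "(shift \<nu> ^^ q) h \<in> order_ge k"
    using assms unfolding top_geigen_def by blast
  have "(shift (\<mu> + \<nu>) ^^ (p + q)) (g * h) \<in> order_ge k"
  proof (rule leibniz_funpow[where D = UNIV and \<beta> = "(*)"])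
    show "shift (\<mu> + \<nu>) (a * b) = shift \<mu> a * b + a * shift \<nu> b" for a b
      by (simp add: shift_def Der_mult[OF Der] cscale_def cps_const_add algebra_simps)
    show "x \<in> order_ge k \<Longrightarrow> shift (\<mu> + \<nu>) x \<in> order_ge k" for x
      by (rule shift_mem[OF subspace_order_ge]) (use order_ge in auto)
  qed (use pq in \<open>auto simp: shift_add intro: order_ge_add order_ge_mult_left order_ge_mult_right\<close>)
  then show "\<exists>N. (shift (\<mu> + \<nu>) ^^ N) (g * h) \<in> order_ge k"
    by blast
qed

lemma monomial_top_geigen:
  assumes "\<And>i. y i \<in> top_geigen (w i)"
  shows "monomial y \<alpha> \<in> top_geigen (weight w \<alpha>)"
proof (induction \<alpha> rule: exponent_induct)
  case zero
  have "(shift 0 ^^ 1) 1 = (0 :: 'n cps)"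
    using Der_const_eq_0[OF Der, of 1] by (simp add: shift_0)
  then have "\<exists>N. (shift 0 ^^ N) 1 \<in> order_ge k" for k
    by (metis order_ge_zero)
  then show ?case
    unfolding monomial_0 weight_0 top_geigen_def by blast
next
  case (upd \<alpha> i)
  then show ?case
    unfolding monomial_upd_Suc weight_upd_Suc by (intro top_geigen_mult assms)
qed

lemma subst_geigen:
  assumes y: "\<And>i. y i \<in> order_ge (Suc 0)" "\<And>i. y i \<in> top_geigen (w i)"
    and S: "cpsC.subspace S" "order_ge k \<subseteq> S"
    and "\<And>\<alpha>. coeff g \<alpha> \<noteq> 0 \<Longrightarrow> stable_pair.geigen cscale \<delta> UNIV (order_ge k) (weight w \<alpha>) \<subseteq> S"
  shows "subst y g \<in> S"
proof -
  have "cscale (coeff g \<alpha>) (monomial y \<alpha>) \<in> S" for \<alpha>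
  proof (cases "coeff g \<alpha> = 0")
    case True
    then show ?thesis
      using cpsC.subspace_0[OF S(1)] by simp
  next
    case False
    have "monomial y \<alpha> \<in> stable_pair.geigen cscale \<delta> UNIV (order_ge k) (weight w \<alpha>)"
      using monomial_top_geigen[OF y(2)] by (auto simp: geigen_UNIV_iff top_geigen_def)
    then show ?thesis
      using assms(5)[OF False] cpsC.subspace_scale[OF S(1)] by blast
  qed
  then have "(\<Sum>\<alpha> | total_degree \<alpha> < k. cscale (coeff g \<alpha>) (monomial y \<alpha>)) \<in> S"
    by (intro cpsC.subspace_sum[OF S(1)])
  from cpsC.subspace_add[OF S(1) subsetD[OF S(2) subst_approx[of y g k, OF y(1)]] this] show ?thesis
    by simp
qed

text \<open>
  In coordinates which are generalised eigenvectors, the monomials of a generalised eigenvector all have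
  its eigenvalue as weight: the part of other weights is both in the generalised eigenspace and in the
  span of the others.
\<close>

lemma weight_eq_if_top_geigen:
  assumes y: "coordinates y" "\<And>i. y i \<in> top_geigen (w i)"
    and g: "subst y g \<in> top_geigen c" and \<alpha>: "coeff g \<alpha> \<noteq> 0"
  shows "weight w \<alpha> = c"
proof (rule ccontr)
  assume "weight w \<alpha> \<noteq> c"
  have y1: "\<And>i. y i \<in> order_ge (Suc 0)"
    using y(1) by (simp add: coordinates_def)
  interpret y: cps_hom "subst y"
    by (rule cps_hom_subst[OF y1])
  define h where "h = Abs_cps (\<lambda>\<alpha>. if weight w \<alpha> = c then 0 else coeff g \<alpha>)"
  have h: "coeff h \<alpha> = (if weight w \<alpha> = c then 0 else coeff g \<alpha>)" for \<alpha>
    by (simp add: h_def Abs_cps_inverse)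
  have "subst y h = 0"
  proof (rule order_ge_separated)
    fix k
    interpret P: stable_pair cscale \<delta> UNIV "order_ge k"
      by (rule stable_pair_UNIV)
    have "subst y (g - h) \<in> P.geigen c"
      using y1 y(2) P.subspace_geigen P.W'_geigen
    proof (rule subst_geigen)
      show "coeff (g - h) \<alpha> \<noteq> 0 \<Longrightarrow> P.geigen (weight w \<alpha>) \<subseteq> P.geigen c" for \<alpha>
        by (auto simp: coeff_simps h split: if_splits)
    qed
    moreover have "subst y g \<in> P.geigen c"
      using g by (auto simp: geigen_UNIV_iff top_geigen_def)
    ultimately have "subst y g - subst y (g - h) \<in> P.geigen c"
      by (intro cpsC.subspace_diff[OF P.subspace_geigen])
    then have 1: "subst y h \<in> P.geigen c"
      by (simp add: y.hom_diff)
    have "subst y h \<in> cpsC.span (\<Union>\<nu>\<in>- {c}. P.geigen \<nu>)"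
      using y1 y(2) cpsC.subspace_span
    proof (rule subst_geigen)
      have "order_ge k \<subseteq> P.geigen (c + 1)"
        by (rule P.W'_geigen)
      also have "\<dots> \<subseteq> (\<Union>\<nu>\<in>- {c}. P.geigen \<nu>)"
        by (intro UN_upper) simp
      also have "\<dots> \<subseteq> cpsC.span (\<Union>\<nu>\<in>- {c}. P.geigen \<nu>)"
        by (rule cpsC.span_superset)
      finally show "order_ge k \<subseteq> cpsC.span (\<Union>\<nu>\<in>- {c}. P.geigen \<nu>)" .
      show "P.geigen (weight w \<alpha>) \<subseteq> cpsC.span (\<Union>\<nu>\<in>- {c}. P.geigen \<nu>)" if "coeff h \<alpha> \<noteq> 0" for \<alpha>
        using that by (intro order_trans[OF UN_upper cpsC.span_superset]) (auto simp: h split: if_splits)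
    qed
    with 1 show "subst y h \<in> order_ge k"
      by (rule P.geigen_Int_span_geigen)
  qed
  then have "subst y h = subst y 0"
    by (simp add: y.hom_zero)
  moreover have "inj (subst y)"
    using cps_automorphism_subst[OF y(1)] by (simp add: cps_automorphism_iff bij_is_inj)
  ultimately have "h = 0"
    by (metis injD)
  with \<alpha> \<open>weight w \<alpha> \<noteq> c\<close> h[of \<alpha>] show False
    by (simp add: zero_cps.rep_eq)
qed

lemma geigen_coordinates_exist: "\<exists>y w. coordinates y \<and> (\<forall>i. y i \<in> top_geigen (w i))"
proof -
  define S where "S = (\<Union>\<nu>. top_geigen \<nu> \<inter> order_ge (Suc 0))"
  have "order_ge (Suc 0) \<subseteq> cpsC.span (S \<union> order_ge (Suc (Suc 0)))"
    unfolding S_def by (rule F_subset_span_top_geigen)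
  moreover have "S \<subseteq> order_ge (Suc 0)"
    by (auto simp: S_def)
  ultimately obtain y where y: "\<And>i. y i \<in> S" "coordinates y"
    using coordinates_from_spanning_set by blast
  have "\<forall>i. \<exists>\<nu>. y i \<in> top_geigen \<nu>"
    using y(1) by (auto simp: S_def)
  with y(2) show ?thesis
    by metis
qed

text \<open>
  If \<open>\<delta> f = a f\<close>, then \<open>\<delta> (u f) = (\<delta> u + a u) f\<close>. The generalised eigenvectors of the operator
  \<open>u \<mapsto> \<delta> u + a u\<close> span the power series modulo \<open>m\<close>, so one of them is a unit.
\<close>

lemma unit_multiple_top_geigen:
  assumes "\<delta> f = a * f"
  shows "\<exists>u c. u dvd 1 \<and> u * f \<in> top_geigen c"
proof -
  define E where "E u = \<delta> u + a * u" for u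
  interpret E: complete_filtered_operator cscale E order_ge
    by (rule complete_filtered_cps)
       (auto simp: E_def Der_add[OF Der] Der_cscale[OF Der] cscale_mult_right cpsC.scale_right_distrib
         distrib_left intro!: order_ge_add order_ge order_ge_mult_left)
  have "\<not> (\<Union>\<nu>. E.top_geigen \<nu>) \<subseteq> order_ge (Suc 0)"
  proof
    assume "(\<Union>\<nu>. E.top_geigen \<nu>) \<subseteq> order_ge (Suc 0)"
    then have "cpsC.span ((\<Union>\<nu>. E.top_geigen \<nu> \<inter> order_ge 0) \<union> order_ge (Suc 0)) \<subseteq> order_ge (Suc 0)"
      by (intro cpsC.span_minimal subspace_order_ge) auto
    with E.F_subset_span_top_geigen[of 0] have "(1 :: 'n cps) \<in> order_ge (Suc 0)"
      by auto
    then show False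
      by (simp add: order_ge_1 max_ideal_def one_cps.rep_eq)
  qed
  then obtain u c where u: "u \<in> E.top_geigen c" "u dvd 1"
    by (auto simp: unit_iff order_ge_1 max_ideal_def)
  have "shift c (v * f) = E.shift c v * f" for v
    by (simp add: shift_def E.shift_def E_def Der_mult[OF Der] assms cscale_def algebra_simps)
  then have "(shift c ^^ N) (u * f) = (E.shift c ^^ N) u * f" for N
    by (induction N) simp_all
  then have "u * f \<in> top_geigen c"
    using u(1) order_ge_mult_right unfolding top_geigen_def E.top_geigen_def by fastforce
  with u(2) show ?thesis by blast
qed

lemma nilpotent_if_weights_0:
  assumes "coordinates y" and "\<And>i. y i \<in> top_geigen 0"
  shows "\<exists>N. (\<delta> ^^ N) x \<in> order_ge k"
proof -
  interpret P: stable_pair cscale \<delta> UNIV "order_ge k"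
    by (rule stable_pair_UNIV)
  obtain g where g: "x = subst y g"
    using surj_subst[OF assms(1)] by (metis surjD)
  have "subst y g \<in> P.geigen 0"
    using _ _ P.subspace_geigen P.W'_geigen
    by (rule subst_geigen[where w = "\<lambda>_. 0"])
       (use assms in \<open>auto simp: coordinates_def weight_def\<close>)
  then show ?thesis
    by (simp add: g geigen_UNIV_iff shift_0)
qed

end

section \<open>Diagonal symmetries\<close>

definition diagonal_field :: "('n::finite \<Rightarrow> complex) \<Rightarrow> 'n vfield"
  where "diagonal_field w = (\<Sum>i\<in>UNIV. vscale (cps_const (w i) * cps_X i) (partial i))"

lemma diagonal_iff: "diagonal \<sigma> \<longleftrightarrow> (\<exists>w. \<sigma> = diagonal_field w)"
  by (simp add: diagonal_def diagonal_field_def)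

lemma sum_vfield_apply: "(sum f A :: 'n::finite vfield) x = (\<Sum>a\<in>A. f a x)"
  by (induction A rule: infinite_finite_induct) simp_all

lemma coeff_diagonal_field: "coeff (diagonal_field w g) \<alpha> = weight w \<alpha> * coeff g \<alpha>"
proof -
  have "coeff (cps_X i * partial i g) \<alpha> = of_nat (\<alpha> i) * coeff g \<alpha>" for i
    by (auto simp: coeff_X_mult partial.rep_eq)
  then have "coeff (cps_const (w i) * cps_X i * partial i g) \<alpha> = w i * of_nat (\<alpha> i) * coeff g \<alpha>" for i
    by (simp add: mult.assoc coeff_const_mult)
  then show ?thesis
    by (simp add: diagonal_field_def sum_vfield_apply coeff_sum vscale_def weight_def sum_distrib_right)
qed

lemma diagonal_field_Der: "diagonal_field w \<in> Der"
  unfolding diagonal_field_def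
  by (intro vfield.subspace_sum[OF subspace_Der] vfield.subspace_scale[OF subspace_Der] partial_in_Der)

lemma diagonal_field_X: "diagonal_field w (cps_X i) = cscale (w i) (cps_X i)"
proof (rule cps_eqI)
  fix \<alpha>
  show "coeff (diagonal_field w (cps_X i)) \<alpha> = coeff (cscale (w i) (cps_X i)) \<alpha>"
    using weight_single[of w i] by (simp add: coeff_diagonal_field coeff_cscale cps_X.rep_eq)
qed

lemma diagonal_field_eq_0_iff: "diagonal_field w = 0 \<longleftrightarrow> w = (\<lambda>_. 0)"
proof
  assume 0: "diagonal_field w = 0"
  have "w i = 0" for i
  proof -
    have "coeff (cscale (w i) (cps_X i)) (0(i := 1)) = 0"
      unfolding diagonal_field_X[symmetric] by (simp add: 0 zero_cps.rep_eq)
    then show ?thesis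
      by (simp add: coeff_cscale cps_X.rep_eq)
  qed
  then show "w = (\<lambda>_. 0)" by blast
next
  assume "w = (\<lambda>_. 0)"
  then show "diagonal_field w = 0"
    by (auto intro!: cps_eqI simp: fun_eq_iff coeff_diagonal_field weight_def zero_cps.rep_eq)
qed

lemma diagonal_symmetries_basis:
  fixes g :: "'n::finite cps"
  obtains B where "B \<subseteq> diagonal_symmetries g" "finite B" "vfieldC.independent B"
    "card B = vfieldC.dim (diagonal_symmetries g)" "diagonal_symmetries g \<subseteq> vfieldC.span B"
proof -
  obtain B where B: "B \<subseteq> diagonal_symmetries g" "vfieldC.independent B"
    "diagonal_symmetries g \<subseteq> vfieldC.span B" "card B = vfieldC.dim (diagonal_symmetries g)"
    using vfieldC.basis_exists by blast
  have "diagonal_symmetries g \<subseteq> vfieldC.span (range (\<lambda>i :: 'n. vscale (cps_X i) (partial i)))"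
  proof
    fix \<sigma> assume "\<sigma> \<in> diagonal_symmetries g"
    then obtain w where "\<sigma> = (\<Sum>i\<in>UNIV. vscaleC (w i) (vscale (cps_X i) (partial i)))"
      by (auto simp: diagonal_symmetries_def diagonal_def vscaleC_def)
    also have "\<dots> \<in> vfieldC.span (range (\<lambda>i :: 'n. vscale (cps_X i) (partial i)))"
      by (intro vfieldC.span_sum vfieldC.span_scale vfieldC.span_base) auto
    finally show "\<sigma> \<in> vfieldC.span (range (\<lambda>i :: 'n. vscale (cps_X i) (partial i)))" .
  qed
  then have "finite B"
    using vfieldC.independent_span_bound[OF _ B(2), of "range (\<lambda>i :: 'n. vscale (cps_X i) (partial i))"] B(1)
    by auto
  with B show ?thesis
    by (intro that)
qed

lemma vanishing_field_Der_log:
  "\<not> is_product f \<Longrightarrow> \<delta> \<in> Der_log f \<Longrightarrow> vanishing_field \<delta>"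
  using Der_log_max_ideal by unfold_locales (auto simp: Der_log_def)

text \<open>
  In coordinates \<open>y\<^sub>i\<close> of generalised eigenvectors with eigenvalues \<open>w\<^sub>i\<close>, the semisimple part of \<open>\<delta>\<close> is the sum of the
  \<open>w\<^sub>i y\<^sub>i \<partial> / \<partial> y\<^sub>i\<close>. It multiplies a unit multiple of \<open>f\<close> by a constant, and so vanishes if \<open>s = 0\<close>.
\<close>

theorem Der_log_nilpotent:
  assumes "\<not> is_product f" and "s_invariant f = 0" and "\<delta> \<in> Der_log f"
  shows "\<exists>N. (\<delta> ^^ N) x \<in> order_ge k"
proof -
  interpret vanishing_field \<delta>
    using assms(1,3) by (rule vanishing_field_Der_log)
  obtain a where a: "\<delta> f = a * f"
    using assms(3) by (auto simp: Der_log_def dvd_def mult.commute)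
  obtain y w where y: "coordinates y" "\<And>i. y i \<in> top_geigen (w i)"
    using geigen_coordinates_exist by blast
  obtain u c where u: "u dvd 1" "u * f \<in> top_geigen c"
    using unit_multiple_top_geigen[OF a] by blast
  have aut: "cps_automorphism (subst y)"
    by (rule cps_automorphism_subst[OF y(1)])
  then have aut': "cps_automorphism (inv (subst y))"
    by (rule cps_automorphism_inv)
  interpret \<psi>: cps_hom "inv (subst y)"
    using aut' by (simp add: cps_automorphism_iff)
  define g where "g = inv (subst y) (u * f)"
  have "g = inv (subst y) u * inv (subst y) f"
    by (simp add: g_def \<psi>.hom_mult)
  then have g: "g \<in> contact_class f"
    unfolding contact_class_def using aut' \<psi>.hom_unit[OF u(1)] by blast
  have "subst y g = u * f"
    unfolding g_def using surj_subst[OF y(1)] by (rule surj_f_inv_f)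
  then have "subst y g \<in> top_geigen c"
    using u(2) by simp
  then have wt: "coeff g \<alpha> \<noteq> 0 \<Longrightarrow> weight w \<alpha> = c" for \<alpha>
    by (rule weight_eq_if_top_geigen[OF y])
  \<comment> \<open>Transported to the coordinates \<open>y\<close>, the semisimple part is diagonal and scales \<open>g\<close>.\<close>
  have "diagonal_field w g = cps_const c * g"
    using wt by (intro cps_eqI) (auto simp: coeff_diagonal_field coeff_const_mult)
  then have "diagonal_field w \<in> diagonal_symmetries g"
    unfolding diagonal_symmetries_def Der_log_def
    using diagonal_field_Der[of w] by (auto simp: diagonal_iff)
  moreover obtain B where B: "finite B" "card B = vfieldC.dim (diagonal_symmetries g)"
      "diagonal_symmetries g \<subseteq> vfieldC.span B"
    by (rule diagonal_symmetries_basis)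
  moreover have "card B = 0"
    using s_invariant_maximum(2)[OF g] assms(2) B(2) by simp
  ultimately have "diagonal_field w = 0"
    by auto
  then have "w = (\<lambda>_. 0)"
    by (simp only: diagonal_field_eq_0_iff)
  then show ?thesis
    using nilpotent_if_weights_0[OF y(1)] y(2) by simp
qed

section \<open>The adjoint action of logarithmic fields\<close>

lemma subspaceC_if_subspace: "vfield.subspace S \<Longrightarrow> vfieldC.subspace S"
  by (auto simp: vfield.subspace_def vfieldC.subspace_def vscaleC_def)

lemma vscaleC_apply: "vscaleC c \<delta> g = cscale c (\<delta> g)"
  by (simp add: vscaleC_def vscale_def cscale_def)

lemma subspaceC_Der_log: "vfieldC.subspace (Der_log f)"
  by (intro subspaceC_if_subspace subspace_Der_log)

lemma subspaceC_Der_log_ideal: "vfieldC.subspace (Der_log_ideal f d)"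
  by (intro subspaceC_if_subspace subspace_ideal_prod vfield.module_axioms)

lemma Der_log_Der: "\<delta> \<in> Der_log f \<Longrightarrow> \<delta> \<in> Der"
  by (simp add: Der_log_def)

lemma vbracket_vscale_right:
  "\<delta> \<in> Der \<Longrightarrow> vbracket \<delta> (vscale a \<epsilon>) = vscale (\<delta> a) \<epsilon> + vscale a (vbracket \<delta> \<epsilon>)"
  by (auto simp: vbracket_def vscale_def fun_eq_iff Der_mult algebra_simps)

lemma lie_algebra_mod_Der_log:
  fixes f :: "'n::finite cps"
  assumes "\<not> is_product f"
  shows "lie_algebra_mod vscaleC vbracket (Der_log f) (Der_log_ideal f d)"
proof
  show "vfieldC.subspace (Der_log f)" "vfieldC.subspace (Der_log_ideal f d)"
    by (rule subspaceC_Der_log subspaceC_Der_log_ideal)+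
  show "Der_log_ideal f d \<subseteq> Der_log f"
    by (rule Der_log_ideal_subset)
  fix x y z :: "'n vfield" and c
  show "vbracket x y = - vbracket y x"
    by (simp add: vbracket_def fun_eq_iff)
  show "vbracket x x = 0"
    by (simp add: vbracket_def fun_eq_iff)
  assume x: "x \<in> Der_log f"
  show "vbracket x y \<in> Der_log_ideal f d" if "y \<in> Der_log_ideal f d"
    using assms x that by (rule vbracket_Der_log_ideal)
  assume y: "y \<in> Der_log f"
  show "vbracket x y \<in> Der_log f"
    using x y by (rule vbracket_Der_log)
  show "vbracket (vscaleC c x) y = vscaleC c (vbracket x y)"
    using y by (simp add: vbracket_def fun_eq_iff vscaleC_apply Der_cscale Der_log_Der cpsC.scale_right_diff_distrib)
  assume z: "z \<in> Der_log f"
  show "vbracket (x + y) z = vbracket x z + vbracket y z"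
    using z by (simp add: vbracket_def fun_eq_iff Der_add Der_log_Der)
  show "vbracket x (vbracket y z) = vbracket (vbracket x y) z + vbracket y (vbracket x z)"
    using x y z by (simp add: vbracket_def fun_eq_iff Der_diff Der_log_Der)
qed

lemma max_ideal_subset_power: "(max_ideal :: 'n::finite cps set) \<subseteq> max_ideal_power 1"
proof
  fix g :: "'n::finite cps" assume "g \<in> max_ideal"
  then have "g * 1 \<in> ideal_prod (*) max_ideal UNIV"
    by (intro ideal_prod_mem module_cps) auto
  then show "g \<in> max_ideal_power 1"
    by simp
qed

text \<open>Modulo \<open>m \<cdot> Der_log f\<close> the coefficients of a combination of generators may be replaced by their constant terms.\<close>

lemma Der_log_subset_span_generators:
  assumes "finite G" and "vfield.span G = Der_log f"
  shows "Der_log f \<subseteq> vfieldC.span (G \<union> Der_log_ideal f 1)"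
proof
  fix \<delta> assume "\<delta> \<in> Der_log f"
  then obtain a where a: "\<delta> = (\<Sum>g\<in>G. vscale (a g) g)"
    unfolding assms(2)[symmetric] vfield.span_finite[OF assms(1)] by auto
  have "vscale (a g) g \<in> vfieldC.span (G \<union> Der_log_ideal f 1)" if g: "g \<in> G" for g
  proof -
    have "g \<in> Der_log f"
      using g assms(2) vfield.span_base by blast
    moreover have "a g - cps_const (coeff (a g) 0) \<in> max_ideal_power 1"
      using diff_const_coeff_0[of "a g"] max_ideal_subset_power unfolding order_ge_1 by blast
    ultimately have "vscale (a g - cps_const (coeff (a g) 0)) g \<in> Der_log_ideal f 1"
      by (intro ideal_prod_mem vfield.module_axioms)
    then have "vscaleC (coeff (a g) 0) g + vscale (a g - cps_const (coeff (a g) 0)) g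
        \<in> vfieldC.span (G \<union> Der_log_ideal f 1)"
      using g by (intro vfieldC.span_add vfieldC.span_scale) (auto intro: vfieldC.span_base)
    then show ?thesis
      by (simp add: vscaleC_def flip: vfield.scale_left_distrib)
  qed
  then show "\<delta> \<in> vfieldC.span (G \<union> Der_log_ideal f 1)"
    unfolding a by (rule vfieldC.span_sum)
qed

text \<open>Families of series serve as coefficient vectors with respect to generators of \<open>Der_log f\<close>.\<close>

definition fscale :: "complex \<Rightarrow> ('j \<Rightarrow> 'n::finite cps) \<Rightarrow> 'j \<Rightarrow> 'n cps"
  where "fscale c a = (\<lambda>j. cscale c (a j))"

definition fam_order_ge :: "'j set \<Rightarrow> nat \<Rightarrow> ('j \<Rightarrow> 'n::finite cps) set"
  where "fam_order_ge J k = {a. \<forall>j\<in>J. a j \<in> order_ge k}"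

lemma complete_filtered_families:
  fixes T :: "('j \<Rightarrow> 'n::finite cps) \<Rightarrow> 'j \<Rightarrow> 'n cps"
  assumes "finite J"
    and "\<And>a b. T (a + b) = T a + T b" and "\<And>c a. T (fscale c a) = fscale c (T a)"
    and "\<And>k a. a \<in> fam_order_ge J k \<Longrightarrow> T a \<in> fam_order_ge J k"
  shows "complete_filtered_operator fscale T (fam_order_ge J)"
proof -
  interpret fam: vector_space "fscale :: complex \<Rightarrow> ('j \<Rightarrow> 'n cps) \<Rightarrow> _"
    by unfold_locales (simp_all add: fscale_def fun_eq_iff cpsC.scale_right_distrib cpsC.scale_left_distrib)
  show ?thesis
  proof
    show "T (u + v) = T u + T v" "T (fscale c v) = fscale c (T v)" for u v c
      by (fact assms)+
    show "fam.subspace (fam_order_ge J k)" for k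
      by (rule fam.subspaceI)
         (auto simp: fam_order_ge_def fscale_def cscale_def intro: order_ge_add order_ge_const_mult)
    show "(fam_order_ge J (Suc k) :: ('j \<Rightarrow> 'n cps) set) \<subseteq> fam_order_ge J k" for k
      using order_ge_antimono[of k "Suc k"] by (auto simp: fam_order_ge_def)
    show "T ` fam_order_ge J k \<subseteq> fam_order_ge J k" for k
      using assms(4) by blast
    show "\<exists>w. \<forall>k. w - v k \<in> fam_order_ge J k"
      if v: "\<And>k. v (Suc k) - v k \<in> fam_order_ge J k" for v :: "nat \<Rightarrow> 'j \<Rightarrow> 'n cps"
    proof -
      have "\<exists>w. \<forall>k. w - v k j \<in> order_ge k" if "j \<in> J" for j
        using v that by (intro order_ge_complete) (auto simp: fam_order_ge_def)
      then obtain w where "\<And>j k. j \<in> J \<Longrightarrow> w j - v k j \<in> order_ge k"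
        by metis
      then show ?thesis
        by (auto simp: fam_order_ge_def intro!: exI[of _ w])
    qed
    show "\<exists>P. finite P \<and> (\<forall>l\<in>P. Vector_Spaces.linear fscale (*) l) \<and>
        (\<forall>v\<in>fam_order_ge J k :: ('j \<Rightarrow> 'n cps) set. (\<forall>l\<in>P. l v = 0) \<longrightarrow> v \<in> fam_order_ge J (Suc k))" for k
    proof (intro exI conjI ballI impI)
      let ?P = "(\<lambda>(j, \<alpha>) a. coeff (a j :: 'n cps) \<alpha>) ` (J \<times> {\<alpha>. total_degree \<alpha> \<le> k})"
      show "finite ?P"
        by (intro finite_imageI finite_cartesian_product finite_total_degree_le assms(1))
      show "Vector_Spaces.linear fscale (*) l" if "l \<in> ?P" for l
        using that by (elim imageE)
          (unfold_locales; auto simp: coeff_simps coeff_cscale fscale_def distrib_left distrib_right)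
      show "v \<in> fam_order_ge J (Suc k)" if "\<forall>l\<in>?P. l v = 0" for v
        using that by (auto simp: fam_order_ge_def order_ge_def less_Suc_eq_le)
    qed
  qed
qed

text \<open>
  On coefficient vectors with respect to generators \<open>G\<close>, the bracket with \<open>\<delta>\<close> becomes the operator \<open>E\<close>.
  A generalised eigenvector of \<open>E\<close> with eigenvalue \<open>\<mu> \<noteq> 0\<close> gives a field \<open>\<epsilon>\<close> that maps every series to a
  generalised eigenvector of \<open>\<delta>\<close> with eigenvalue \<open>\<mu>\<close>; as \<open>\<delta>\<close> is topologically nilpotent, \<open>\<epsilon> = 0\<close>. Hence only
  the eigenvalue \<open>0\<close> is left modulo \<open>m \<cdot> Der_log f\<close>.
\<close>

lemma ad_nilpotent:
  fixes f :: "'n::finite cps"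
  assumes f: "\<not> is_product f" and G: "finite G" "vfield.span G = Der_log f"
    and \<delta>: "\<delta> \<in> Der_log f" and nil: "\<And>x k. \<exists>N. (\<delta> ^^ N) x \<in> order_ge k"
    and "\<epsilon> \<in> Der_log f"
  shows "\<exists>N. (vbracket \<delta> ^^ N) \<epsilon> \<in> Der_log_ideal f 1"
proof -
  interpret vanishing_field \<delta>
    using f \<delta> by (rule vanishing_field_Der_log)
  interpret L: lie_algebra_mod vscaleC vbracket "Der_log f" "Der_log_ideal f 1"
    using f by (rule lie_algebra_mod_Der_log)
  have GM: "g \<in> Der_log f" if "g \<in> G" for g
    using that G(2) vfield.span_base by blast
  have "\<exists>C. vbracket \<delta> g = (\<Sum>h\<in>G. vscale (C h) h)" if "g \<in> G" for g
    using vbracket_Der_log[OF \<delta> GM[OF that]]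
    unfolding G(2)[symmetric] vfield.span_finite[OF G(1)] by auto
  then obtain C where C: "\<And>g. g \<in> G \<Longrightarrow> vbracket \<delta> g = (\<Sum>h\<in>G. vscale (C g h) h)"
    by metis
  define \<pi> where "\<pi> a = (\<Sum>g\<in>G. vscale (a g) g)" for a :: "'n vfield \<Rightarrow> 'n cps"
  define E where "E a h = \<delta> (a h) + (\<Sum>g\<in>G. a g * C g h)" for a :: "'n vfield \<Rightarrow> 'n cps" and h
  interpret E: complete_filtered_operator fscale E "fam_order_ge G"
  proof (rule complete_filtered_families[OF G(1)])
    show "E (a + b) = E a + E b" for a b
      by (simp add: E_def fun_eq_iff Der_add[OF Der] distrib_right sum.distrib)
    show "E (fscale c a) = fscale c (E a)" for c a
      by (simp add: E_def fun_eq_iff fscale_def Der_cscale[OF Der] cscale_mult_left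
          cpsC.scale_right_distrib cpsC.scale_sum_right)
    show "E a \<in> fam_order_ge G k" if "a \<in> fam_order_ge G k" for a k
      using that by (auto simp: fam_order_ge_def E_def intro!: order_ge_add order_ge order_ge_sum order_ge_mult_right)
  qed
  have \<pi>_add: "\<pi> (a + b) = \<pi> a + \<pi> b" for a b
    by (simp add: \<pi>_def vfield.scale_left_distrib sum.distrib)
  have \<pi>_scale: "\<pi> (fscale c a) = vscaleC c (\<pi> a)" for c a
    by (simp add: \<pi>_def fscale_def cscale_def vscaleC_def vfield.scale_sum_right)
  have \<pi>_diff: "\<pi> (a - b) = \<pi> a - \<pi> b" for a b
    by (metis \<pi>_add add_diff_cancel diff_add_cancel)
  have \<pi>_M: "\<pi> a \<in> Der_log f" for a
    unfolding \<pi>_def using GM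
    by (intro vfield.subspace_sum[OF subspace_Der_log] vfield.subspace_scale[OF subspace_Der_log])
  have \<pi>_E: "vbracket \<delta> (\<pi> a) = \<pi> (E a)" for a
  proof -
    have "vbracket \<delta> (\<pi> a) = (\<Sum>g\<in>G. vbracket \<delta> (vscale (a g) g))"
      by (simp add: \<pi>_def vbracket_def fun_eq_iff sum_vfield_apply Der_sum[OF Der] sum_subtractf)
    also have "\<dots> = (\<Sum>g\<in>G. vscale (\<delta> (a g)) g) + (\<Sum>g\<in>G. \<Sum>h\<in>G. vscale (a g * C g h) h)"
      by (simp add: vbracket_vscale_right[OF Der] C vfield.scale_sum_right sum.distrib)
    also have "(\<Sum>g\<in>G. \<Sum>h\<in>G. vscale (a g * C g h) h) = (\<Sum>h\<in>G. \<Sum>g\<in>G. vscale (a g * C g h) h)"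
      by (rule sum.swap)
    also have "(\<Sum>g\<in>G. vscale (\<delta> (a g)) g) + (\<Sum>h\<in>G. \<Sum>g\<in>G. vscale (a g * C g h) h) = \<pi> (E a)"
      by (simp add: \<pi>_def E_def fun_eq_iff sum_vfield_apply vscale_def distrib_right sum.distrib sum_distrib_right)
    finally show ?thesis .
  qed
  have \<pi>_I: "\<pi> a \<in> Der_log_ideal f 1" if "a \<in> fam_order_ge G (Suc 0)" for a
    unfolding \<pi>_def
  proof (rule vfieldC.subspace_sum[OF subspaceC_Der_log_ideal])
    fix g assume "g \<in> G"
    then have "a g \<in> max_ideal_power 1" "g \<in> Der_log f"
      using that GM max_ideal_subset_power by (auto simp: fam_order_ge_def order_ge_1)
    then show "vscale (a g) g \<in> Der_log_ideal f 1"
      by (rule ideal_prod_mem[OF vfield.module_axioms])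
  qed
  have \<pi>_eigen: "\<pi> a = 0" if a: "a \<in> E.top_geigen \<mu>" and \<mu>: "\<mu> \<noteq> 0" for a \<mu>
  proof -
    define A where "A \<eta> = vbracket \<delta> \<eta> - vscaleC \<mu> \<eta>" for \<eta>
    have "A (\<pi> b) = \<pi> (E.shift \<mu> b)" for b
      by (simp add: A_def E.shift_def \<pi>_diff \<pi>_scale \<pi>_E)
    then have A_pow: "(A ^^ N) (\<pi> a) = \<pi> ((E.shift \<mu> ^^ N) a)" for N
      by (induction N) simp_all
    have "\<pi> a x \<in> order_ge k" for x k
    proof -
      define FA where "FA = {\<eta> :: 'n vfield. \<forall>x. \<eta> x \<in> order_ge k}"
      interpret P: stable_pair cscale \<delta> UNIV "order_ge k"
        by (rule stable_pair_UNIV)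
      obtain N where "(E.shift \<mu> ^^ N) a \<in> fam_order_ge G k"
        using a unfolding E.top_geigen_def by blast
      then have "(A ^^ N) (\<pi> a) \<in> FA"
        unfolding A_pow
        by (auto simp: FA_def \<pi>_def sum_vfield_apply vscale_def fam_order_ge_def
            intro!: order_ge_sum order_ge_mult_right)
      moreover obtain q where "(\<delta> ^^ q) x \<in> order_ge k"
        using nil by blast
      ultimately have "(shift \<mu> ^^ (N + q)) (\<pi> a x) \<in> order_ge k"
      proof (rule leibniz_funpow[where D = "Der_log f" and \<beta> = "\<lambda>\<eta> x. \<eta> x", rotated -2])
        show "shift \<mu> (\<eta> z) = A \<eta> z + \<eta> (\<delta> z)" for \<eta> z
          by (simp add: shift_def A_def vbracket_def vscaleC_apply)
        show "A \<eta> \<in> Der_log f" if "\<eta> \<in> Der_log f" for \<eta>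
          unfolding A_def using that \<delta> vbracket_Der_log
          by (intro vfieldC.subspace_diff[OF subspaceC_Der_log] vfieldC.subspace_scale[OF subspaceC_Der_log])
        show "\<eta> z \<in> order_ge k" if "\<eta> \<in> Der_log f" "z \<in> order_ge k" for \<eta> z
          using vanishing_field.order_ge[OF vanishing_field_Der_log[OF f that(1)] that(2)] .
        show "shift \<mu> z \<in> order_ge k" if "z \<in> order_ge k" for z
          using that by (intro shift_mem[OF subspace_order_ge T_F])
      qed (auto simp: shift_add FA_def \<pi>_M intro: order_ge_add)
      then have "\<pi> a x \<in> P.geigen \<mu>"
        by (auto simp: geigen_UNIV_iff)
      moreover have "\<pi> a x \<in> P.geigen 0"
        using nil by (auto simp: geigen_UNIV_iff shift_0)
      ultimately show ?thesis
        using \<mu> by (intro P.geigen_Int_span_geigen[of _ \<mu>]) (auto intro: cpsC.span_base)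
    qed
    then have "\<pi> a x = 0" for x
      by (rule order_ge_separated)
    then show ?thesis
      by (simp add: fun_eq_iff)
  qed
  have I_pow: "(vbracket \<delta> ^^ N) \<eta> \<in> Der_log_ideal f 1" if "\<eta> \<in> Der_log_ideal f 1" for N \<eta>
    by (induction N) (use that L.br_ideal[OF \<delta>] in auto)
  have nilpotent: "\<exists>N. (vbracket \<delta> ^^ N) (\<pi> a) \<in> Der_log_ideal f 1"
    if "a \<in> (\<Union>\<nu>. E.top_geigen \<nu> \<inter> fam_order_ge G 0) \<union> fam_order_ge G (Suc 0)" for a
  proof (cases "a \<in> E.top_geigen 0")
    case True
    then obtain N where N: "(E ^^ N) a \<in> fam_order_ge G (Suc 0)"
      unfolding E.top_geigen_def E.shift_0 by blast
    have "(vbracket \<delta> ^^ N) (\<pi> a) = \<pi> ((E ^^ N) a)" for N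
      by (induction N) (simp_all add: \<pi>_E)
    then show ?thesis
      using \<pi>_I[OF N] by metis
  next
    case False
    have "\<pi> a \<in> Der_log_ideal f 1"
      using that
    proof
      assume "a \<in> (\<Union>\<nu>. E.top_geigen \<nu> \<inter> fam_order_ge G 0)"
      then obtain \<mu> where \<mu>: "a \<in> E.top_geigen \<mu>"
        by blast
      with False have "\<mu> \<noteq> 0"
        by metis
      with \<mu> have "\<pi> a = 0"
        by (rule \<pi>_eigen)
      then show ?thesis
        by (simp only: vfieldC.subspace_0[OF subspaceC_Der_log_ideal])
    qed (rule \<pi>_I)
    then have "(vbracket \<delta> ^^ 0) (\<pi> a) \<in> Der_log_ideal f 1"
      by simp
    then show ?thesis by blast
  qed
  have "\<exists>N. (vbracket \<delta> ^^ N) (\<pi> a) \<in> Der_log_ideal f 1"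
    if "a \<in> E.span ((\<Union>\<nu>. E.top_geigen \<nu> \<inter> fam_order_ge G 0) \<union> fam_order_ge G (Suc 0))" for a
    using that
  proof (induction rule: E.span_induct_alt)
    case base
    have "\<pi> 0 = 0"
      by (simp only: \<pi>_def zero_fun_apply vfield.scale_zero_left sum.neutral_const)
    then have "(vbracket \<delta> ^^ 0) (\<pi> 0) \<in> Der_log_ideal f 1"
      by (simp only: funpow_0 vfieldC.subspace_0[OF subspaceC_Der_log_ideal])
    then show ?case by blast
  next
    case (step c a b)
    obtain p q where pq: "(vbracket \<delta> ^^ p) (\<pi> a) \<in> Der_log_ideal f 1"
        "(vbracket \<delta> ^^ q) (\<pi> b) \<in> Der_log_ideal f 1"
      using nilpotent[OF step(1)] step(2) by blast
    have pow: "(vbracket \<delta> ^^ n) (vscaleC c x + y) = vscaleC c ((vbracket \<delta> ^^ n) x) + (vbracket \<delta> ^^ n) y"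
      for n x y
      by (induction n) (simp_all add: vbracket_def fun_eq_iff Der_add[OF Der] vscaleC_apply Der_cscale[OF Der]
          cpsC.scale_right_diff_distrib)
    have "(vbracket \<delta> ^^ (q + p)) (\<pi> a) \<in> Der_log_ideal f 1" "(vbracket \<delta> ^^ (p + q)) (\<pi> b) \<in> Der_log_ideal f 1"
      using I_pow[OF pq(1)] I_pow[OF pq(2)] by (simp_all add: funpow_add)
    then have "(vbracket \<delta> ^^ (p + q)) (\<pi> (fscale c a + b)) \<in> Der_log_ideal f 1"
      unfolding \<pi>_add \<pi>_scale pow
      by (intro vfieldC.subspace_add[OF subspaceC_Der_log_ideal]
          vfieldC.subspace_scale[OF subspaceC_Der_log_ideal]) (simp_all add: add.commute)
    then show ?case by blast
  qed
  moreover obtain a where "\<epsilon> = \<pi> a"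
    using assms(6) unfolding G(2)[symmetric] vfield.span_finite[OF G(1)] \<pi>_def by auto
  moreover have "a \<in> E.span ((\<Union>\<nu>. E.top_geigen \<nu> \<inter> fam_order_ge G 0) \<union> fam_order_ge G (Suc 0))"
    using E.F_subset_span_top_geigen[of 0] by (auto simp: fam_order_ge_def)
  ultimately show ?thesis by blast
qed

section \<open>The derived series of the quotients\<close>

lemma max_ideal_power_antimono:
  assumes "j \<le> d"
  shows "(max_ideal_power d :: 'n::finite cps set) \<subseteq> max_ideal_power j"
proof -
  have "(max_ideal_power (Suc d) :: 'n cps set) \<subseteq> max_ideal_power d" for d
  proof
    fix g :: "'n cps" assume "g \<in> max_ideal_power (Suc d)"
    then have "g \<in> ideal_prod (*) max_ideal (max_ideal_power d)"
      by simp
    with module_cps show "g \<in> max_ideal_power d"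
      by (rule ideal_prod_induct) (use max_ideal_power_closed[of d] max_ideal_closed in auto)
  qed
  then show ?thesis
    using assms by (rule lift_Suc_antimono_le)
qed

lemma Der_log_ideal_antimono:
  assumes "j \<le> d"
  shows "Der_log_ideal f d \<subseteq> Der_log_ideal f j"
  unfolding ideal_prod_def using max_ideal_power_antimono[OF assms] by (intro vfield.span_mono) blast

lemma max_ideal_power_1_subset: "(max_ideal_power (Suc 0) :: 'n::finite cps set) \<subseteq> max_ideal"
proof
  fix g :: "'n cps" assume "g \<in> max_ideal_power (Suc 0)"
  then have "g \<in> ideal_prod (*) max_ideal UNIV"
    by simp
  with module_cps show "g \<in> max_ideal"
    by (rule ideal_prod_induct) (auto simp: max_ideal_def coeff_simps coeff_mult_0)
qed

text \<open>
  In \<open>[a \<delta>, b \<epsilon>] = a \<delta>(b) \<epsilon> - b \<epsilon>(a) \<delta> + a b [\<delta>, \<epsilon>]\<close> all coefficients lie in \<open>m\<^sup>d \<cdot> m\<^sup>d \<subseteq> m\<^sup>d\<^sup>+\<^sup>1\<close>, because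
  \<open>\<delta>\<close> and \<open>\<epsilon>\<close> preserve \<open>m\<^sup>d\<close>.
\<close>

lemma vbracket_Der_log_ideal_Suc:
  assumes f: "\<not> is_product f" and "0 < d"
    and "\<delta> \<in> Der_log_ideal f d" and "\<epsilon> \<in> Der_log_ideal f d"
  shows "vbracket \<delta> \<epsilon> \<in> Der_log_ideal f (Suc d)"
proof -
  interpret L: lie_algebra_mod vscaleC vbracket "Der_log f" "Der_log_ideal f d"
    using f by (rule lie_algebra_mod_Der_log)
  let ?I = "Der_log_ideal f (Suc d)"
  note add = vfieldC.subspace_add[OF subspaceC_Der_log_ideal[of "Suc d" f]]
    and diff = vfieldC.subspace_diff[OF subspaceC_Der_log_ideal[of "Suc d" f]]
  have M: "x \<in> Der_log f" if "x \<in> Der_log_ideal f d" for x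
    using that Der_log_ideal_subset by blast
  have mem: "vscale (a * b) x \<in> ?I" if "a \<in> max_ideal_power d" "b \<in> max_ideal_power d" "x \<in> Der_log f" for a b x
  proof -
    have "a \<in> max_ideal"
      using that(1) max_ideal_power_antimono[of "Suc 0" d] max_ideal_power_1_subset \<open>0 < d\<close> by auto
    then have "a * b \<in> ideal_prod (*) max_ideal (max_ideal_power d)"
      using that by (intro ideal_prod_mem module_cps)
    then have "a * b \<in> max_ideal_power (Suc d)"
      by simp
    then show ?thesis
      using that(3) by (rule ideal_prod_mem[OF vfield.module_axioms])
  qed
  have pure: "vbracket (vscale a x) (vscale b y) \<in> ?I"
    if ab: "a \<in> max_ideal_power d" "b \<in> max_ideal_power d" and xy: "x \<in> Der_log f" "y \<in> Der_log f" for a b x y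
  proof -
    have "vbracket (vscale a x) (vscale b y)
        = vscale (a * x b) y - vscale (b * y a) x + vscale (a * b) (vbracket x y)"
      by (simp add: vbracket_def vscale_def fun_eq_iff Der_mult[OF Der_log_Der[OF xy(1)]]
          Der_mult[OF Der_log_Der[OF xy(2)]] algebra_simps)
    then show ?thesis
      using ab xy Der_log_max_ideal_power[OF f] vbracket_Der_log by (simp only:) (intro add diff mem; blast)
  qed
  have half: "vbracket (vscale a x) \<epsilon> \<in> ?I" if ax: "a \<in> max_ideal_power d" "x \<in> Der_log f" for a x
  proof -
    have axM: "vscale a x \<in> Der_log f"
      using subspace_Der_log ax(2) by (rule vfield.subspace_scale)
    have "\<epsilon> \<in> Der_log f \<and> vbracket (vscale a x) \<epsilon> \<in> ?I"
      using vfield.module_axioms assms(4)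
    proof (rule ideal_prod_induct)
      show "0 \<in> Der_log f \<and> vbracket (vscale a x) 0 \<in> ?I"
        unfolding L.br_zero(2)[OF axM]
        by (intro conjI vfieldC.subspace_0 subspaceC_Der_log subspaceC_Der_log_ideal)
      show "y + z \<in> Der_log f \<and> vbracket (vscale a x) (y + z) \<in> ?I"
        if "y \<in> Der_log f \<and> vbracket (vscale a x) y \<in> ?I" "z \<in> Der_log f \<and> vbracket (vscale a x) z \<in> ?I" for y z
        using that axM by (auto simp only: L.br_add_right intro: add vfieldC.subspace_add[OF subspaceC_Der_log])
      show "vscale b y \<in> Der_log f \<and> vbracket (vscale a x) (vscale b y) \<in> ?I"
        if "b \<in> max_ideal_power d" "y \<in> Der_log f" for b y
        using that pure[OF ax(1) that(1) ax(2) that(2)] vfield.subspace_scale[OF subspace_Der_log] by blast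
    qed (use max_ideal_power_closed[of d] in auto)
    then show ?thesis by blast
  qed
  have "\<delta> \<in> Der_log f \<and> vbracket \<delta> \<epsilon> \<in> ?I"
    using vfield.module_axioms assms(3)
  proof (rule ideal_prod_induct)
    show "0 \<in> Der_log f \<and> vbracket 0 \<epsilon> \<in> ?I"
      unfolding L.br_zero(1)[OF M[OF assms(4)]]
      by (intro conjI vfieldC.subspace_0 subspaceC_Der_log subspaceC_Der_log_ideal)
    show "y + z \<in> Der_log f \<and> vbracket (y + z) \<epsilon> \<in> ?I"
      if "y \<in> Der_log f \<and> vbracket y \<epsilon> \<in> ?I" "z \<in> Der_log f \<and> vbracket z \<epsilon> \<in> ?I" for y z
      using that M[OF assms(4)]
      by (auto simp only: L.br_add_left intro: add vfieldC.subspace_add[OF subspaceC_Der_log])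
    show "vscale b y \<in> Der_log f \<and> vbracket (vscale b y) \<epsilon> \<in> ?I"
      if "b \<in> max_ideal_power d" "y \<in> Der_log f" for b y
      using that half vfield.subspace_scale[OF subspace_Der_log] by blast
  qed (use max_ideal_power_closed[of d] in auto)
  then show ?thesis by blast
qed

text \<open>
  From \<open>m \<cdot> Der_log f\<close> on, each step of the derived series gains a power of \<open>m\<close>, so that it reaches every
  \<open>m\<^sup>d \<cdot> Der_log f\<close>; the derived series of the quotient consists of the cosets.
\<close>

theorem solvable_quotient_if_derived_subset:
  assumes f: "\<not> is_product f" and "d \<ge> 1"
    and k: "lie_algebra_mod.derived vscaleC vbracket (Der_log f) k \<subseteq> Der_log_ideal f 1"
  shows "solvable_lie (Der_log_quotient f d)"
proof -
  interpret L: lie_algebra_mod vscaleC vbracket "Der_log f" "Der_log_ideal f d"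
    using f by (rule lie_algebra_mod_Der_log)
  have deep: "L.derived (k + j) \<subseteq> Der_log_ideal f (Suc j)" for j
  proof (induction j)
    case 0
    then show ?case using k by simp
  next
    case (Suc j)
    have "L.derived (Suc (k + j)) \<subseteq> Der_log_ideal f (Suc (Suc j))"
      using Suc subspaceC_Der_log_ideal vbracket_Der_log_ideal_Suc[OF f]
      by (rule L.derived_Suc_subset) auto
    then show ?case by simp
  qed
  define I where "I = Der_log_ideal f d"
  define Q where "Q = Der_log_quotient f d"
  define co where "co = lcoset (Der_log_lie f) I"
  note sub = subspaceC_Der_log_ideal[of d f, folded I_def]
  have co_mem: "y \<in> co x \<longleftrightarrow> y - x \<in> I" for x y
    unfolding co_def lcoset_def Der_log_lie_def by (auto intro!: image_eqI[of y _ "y - x"])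
  have co_eqI: "co x = co y" if "x - y \<in> I" for x y
  proof -
    have "z - x \<in> I \<longleftrightarrow> z - y \<in> I" for z
      using vfieldC.subspace_add[OF sub _ that, of "z - x"] vfieldC.subspace_diff[OF sub _ that, of "z - y"]
      by (auto simp: algebra_simps)
    then show ?thesis by (auto simp: co_mem)
  qed
  have co_self: "x \<in> co x" for x
    using vfieldC.subspace_0[OF sub] by (simp add: co_mem)
  have UN: "(\<Union>a\<in>co x. co (F a)) = co (F x)" if "\<And>a. a \<in> co x \<Longrightarrow> F a - F x \<in> I" for F x
    using co_eqI[OF that] co_self by blast
  have UN2: "(\<Union>a\<in>co x. \<Union>b\<in>co y. co (F a b)) = co (F x y)"
    if "\<And>a b. a \<in> co x \<Longrightarrow> b \<in> co y \<Longrightarrow> F a b - F x y \<in> I" for F x y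
    using co_eqI[OF that] co_self by blast
  note Q_simps = Q_def Der_log_quotient_def lie_quotient_def co_def I_def Der_log_lie_def
  have carrier: "lcarrier Q = co ` Der_log f"
    by (simp add: Q_simps)
  have zero: "lzero Q = co 0"
    by (simp add: Q_simps lcoset_def)
  have add: "ladd Q (co x) (co y) = co (x + y)" for x y
  proof -
    have "ladd Q (co x) (co y) = (\<Union>a\<in>co x. \<Union>b\<in>co y. co (a + b))"
      by (simp add: Q_simps)
    also have "\<dots> = co (x + y)"
    proof (rule UN2)
      fix a b assume "a \<in> co x" "b \<in> co y"
      then have "(a - x) + (b - y) \<in> I"
        by (intro vfieldC.subspace_add[OF sub]) (simp_all add: co_mem)
      then show "a + b - (x + y) \<in> I"
        by (simp add: algebra_simps)
    qed
    finally show ?thesis .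
  qed
  have scale: "lscale Q c (co x) = co (vscaleC c x)" for c x
  proof -
    have "lscale Q c (co x) = (\<Union>a\<in>co x. co (vscaleC c a))"
      by (simp add: Q_simps)
    also have "\<dots> = co (vscaleC c x)"
      by (rule UN) (use vfieldC.subspace_scale[OF sub] in
          \<open>simp add: co_mem flip: vfieldC.scale_right_diff_distrib\<close>)
    finally show ?thesis .
  qed
  have bracket: "lbracket Q (co x) (co y) = co (vbracket x y)"
    if xy: "x \<in> Der_log f" "y \<in> Der_log f" for x y
  proof -
    have "lbracket Q (co x) (co y) = (\<Union>a\<in>co x. \<Union>b\<in>co y. co (vbracket a b))"
      by (simp add: Q_simps)
    also have "\<dots> = co (vbracket x y)"
    proof (rule UN2)
      fix a b assume "a \<in> co x" "b \<in> co y"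
      then have ab: "a - x \<in> I" "b - y \<in> I"
        by (simp_all add: co_mem)
      then have M: "a - x \<in> Der_log f" "b - y \<in> Der_log f"
        using L.I_subset by (auto simp: I_def)
      then have b: "b \<in> Der_log f"
        using vfieldC.subspace_add[OF subspaceC_Der_log M(2) xy(2)] by simp
      have "vbracket (a - x) b + vbracket x (b - y) \<in> I"
        using L.br_ideal_left[OF ab(1)[unfolded I_def] b] L.br_ideal[OF xy(1) ab(2)[unfolded I_def]]
        unfolding I_def by (rule vfieldC.subspace_add[OF subspaceC_Der_log_ideal])
      also have "vbracket (a - x) b + vbracket x (b - y) = vbracket a b - vbracket x y"
        using L.br_add_left[OF M(1) xy(1) b] L.br_add_right[OF M(2) xy(2) xy(1)] by simp
      finally show "vbracket a b - vbracket x y \<in> I" .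
    qed
    finally show ?thesis .
  qed
  have derived_M: "L.derived i \<subseteq> Der_log f \<and> vfieldC.subspace (L.derived i)" for i
  proof (induction i)
    case (Suc i)
    then have "L.derived (Suc i) \<subseteq> Der_log f"
      by (intro L.derived_Suc_subset[where N = "Der_log f"] subspaceC_Der_log vbracket_Der_log) auto
    then show ?case
      by simp
  qed (simp add: subspaceC_Der_log)
  have subset: "derived_series Q i \<subseteq> co ` L.derived i" for i
  proof (induction i)
    case (Suc i)
    let ?D = "L.derived (Suc i)"
    have D: "vfieldC.subspace ?D" "?D \<subseteq> Der_log f"
      using derived_M[of "Suc i"] by blast+
    have "lsubspace Q (co ` ?D)"
      unfolding lsubspace_def carrier zero
      using D vfieldC.subspace_0[OF D(1)] vfieldC.subspace_add[OF D(1)] vfieldC.subspace_scale[OF D(1)]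
      by (auto simp only: add scale image_iff intro!: image_mono imageI)
    moreover have "{lbracket Q x y | x y. x \<in> derived_series Q i \<and> y \<in> derived_series Q i} \<subseteq> co ` ?D"
    proof safe
      fix X Y assume "X \<in> derived_series Q i" "Y \<in> derived_series Q i"
      then obtain x y where xy: "x \<in> L.derived i" "y \<in> L.derived i" "X = co x" "Y = co y"
        using Suc by blast
      then have "vbracket x y \<in> ?D"
        by (auto intro: vfieldC.span_base)
      moreover have "lbracket Q X Y = co (vbracket x y)"
        unfolding xy(3,4) using xy(1,2) derived_M[of i] by (intro bracket) auto
      ultimately show "lbracket Q X Y \<in> co ` ?D"
        by blast
    qed
    ultimately show ?case
      by (auto simp: lspan_def)
  qed (simp add: carrier)
  have zero_mem: "lzero Q \<in> derived_series Q i" for i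
  proof (cases i)
    case 0
    then show ?thesis
      using vfieldC.subspace_0[OF subspaceC_Der_log, of f] by (auto simp: carrier zero)
  next
    case (Suc j)
    then show ?thesis
      by (auto simp: lspan_def lsubspace_def)
  qed
  have "derived_series Q i = {lzero Q}" if i: "k + d \<le> i" for i
  proof -
    have "L.derived i \<subseteq> Der_log_ideal f (Suc (i - k))"
      using deep[of "i - k"] i by simp
    also have "\<dots> \<subseteq> I"
      unfolding I_def using i by (intro Der_log_ideal_antimono) simp
    finally have "co ` L.derived i \<subseteq> {lzero Q}"
      unfolding zero using co_eqI[of _ 0] by auto
    then show ?thesis
      using subset[of i] zero_mem[of i] by blast
  qed
  then show ?thesis
    unfolding solvable_lie_def Q_def by blast
qed

section \<open>Commuting logarithmic fields and the conclusion\<close>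

text \<open>
  Take a member \<open>u \<cdot> \<phi> f\<close> of the contact class whose diagonal symmetries have the maximal dimension \<open>s\<close>, and
  the fields \<open>\<phi>\<^sup>-\<^sup>1 \<sigma> \<phi>\<close> for \<open>\<sigma>\<close> in a basis of these symmetries. They are independent even modulo \<open>m \<cdot> Der_log f\<close>, since they are determined by their linear parts and a field in
  \<open>m \<cdot> Der_log f\<close> has linear part zero.
\<close>

lemma commuting_fields_exist:
  fixes f :: "'n::finite cps"
  assumes f: "\<not> is_product f"
  shows "\<exists>B. finite B \<and> card B = s_invariant f \<and> B \<subseteq> Der_log f \<and>
    (\<forall>x\<in>B. \<forall>y\<in>B. vbracket x y = 0) \<and>
    (\<forall>b\<in>B. b \<notin> vfieldC.span (B - {b} \<union> Der_log_ideal f 1))"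
proof -
  obtain g where g: "g \<in> contact_class f" "s_invariant f = vfieldC.dim (diagonal_symmetries g)"
    using s_invariant_maximum(1) by blast
  obtain u \<phi> where u: "u dvd 1" "cps_automorphism \<phi>" "g = u * \<phi> f"
    using g(1) by (auto simp: contact_class_def)
  define \<psi> where "\<psi> = inv \<phi>"
  interpret \<phi>: cps_hom \<phi>
    using u(2) by (simp add: cps_automorphism_iff)
  interpret \<psi>: cps_hom \<psi>
    using cps_automorphism_inv[OF u(2)] by (simp add: cps_automorphism_iff \<psi>_def)
  have "bij \<phi>"
    using u(2) by (simp add: cps_automorphism_iff)
  then have \<phi>\<psi>: "\<phi> (\<psi> x) = x" "\<psi> (\<phi> x) = x" for x
    by (simp_all add: \<psi>_def bij_is_surj surj_f_inv_f bij_is_inj)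
  define pullback where "pullback \<sigma> = (\<lambda>x. \<psi> (\<sigma> (\<phi> x)))" for \<sigma> :: "'n vfield"
  have pullback_linear: "Vector_Spaces.linear vscaleC vscaleC pullback"
    by unfold_locales (simp_all add: pullback_def fun_eq_iff \<psi>.hom_add vscaleC_apply \<psi>.hom_cscale)
  interpret pullback: Vector_Spaces.linear vscaleC vscaleC pullback
    by (rule pullback_linear)
  have pullback_eq_0: "\<sigma> = 0" if "pullback \<sigma> = 0" for \<sigma>
  proof -
    have "\<psi> (\<sigma> x) = 0" for x
      using fun_cong[OF that, of "\<psi> x"] by (simp add: pullback_def \<phi>\<psi>)
    then show ?thesis
      using \<phi>\<psi>(1) \<phi>.hom_zero by (metis ext zero_fun_apply)
  qed
  then have pullback_inj: "inj pullback"
    by (auto simp: inj_on_def) (metis pullback.diff eq_iff_diff_eq_0)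
  have pullback_Der_log: "pullback \<sigma> \<in> Der_log f" if \<sigma>_g: "\<sigma> \<in> Der_log g" for \<sigma>
  proof -
    have \<sigma>: "\<sigma> \<in> Der"
      using \<sigma>_g by (rule Der_log_Der)
    have "pullback \<sigma> (x + y) = pullback \<sigma> x + pullback \<sigma> y" "pullback \<sigma> (cps_const c * x) = cps_const c * pullback \<sigma> x"
      "pullback \<sigma> (x * y) = pullback \<sigma> x * y + x * pullback \<sigma> y" for x y c
      by (simp_all add: pullback_def \<phi>.hom_add \<psi>.hom_add \<phi>.hom_mult \<psi>.hom_mult \<phi>.hom_const \<psi>.hom_const
          Der_add[OF \<sigma>] Der_mult[OF \<sigma>] Der_const_eq_0[OF \<sigma>] \<psi>.hom_zero \<phi>\<psi>)
    then have "pullback \<sigma> \<in> Der"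
      by (simp add: Der_def)
    moreover have "f dvd pullback \<sigma> f"
    proof -
      obtain b where "\<sigma> (u * \<phi> f) = u * \<phi> f * b"
        using \<sigma>_g unfolding Der_log_def u(3) by (auto elim: dvdE)
      then have "u * \<sigma> (\<phi> f) = \<phi> f * (u * b - \<sigma> u)"
        by (simp add: Der_mult[OF \<sigma>] algebra_simps)
      moreover obtain v where "1 = u * v"
        using u(1) by (auto simp: dvd_def)
      ultimately have "\<sigma> (\<phi> f) = \<phi> f * ((u * b - \<sigma> u) * v)"
        by (metis mult.assoc mult.commute mult_1)
      then have "pullback \<sigma> f = f * \<psi> ((u * b - \<sigma> u) * v)"
        by (simp add: pullback_def \<psi>.hom_mult \<phi>\<psi>)
      then show ?thesis ..
    qed
    ultimately show ?thesis
      by (simp add: Der_log_def)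
  qed
  obtain B where B: "B \<subseteq> diagonal_symmetries g" "finite B" "vfieldC.independent B"
    "card B = vfieldC.dim (diagonal_symmetries g)"
    by (rule diagonal_symmetries_basis)
  have diag_B: "\<exists>w. \<sigma> = diagonal_field w" if "\<sigma> \<in> B" for \<sigma>
    using that B(1) by (auto simp: diagonal_symmetries_def diagonal_iff)
  have diag_span: "\<exists>w. \<sigma> = diagonal_field w" if "\<sigma> \<in> vfieldC.span B" for \<sigma>
    using that
  proof (induction rule: vfieldC.span_induct_alt)
    case base
    then show ?case
      by (intro exI[of _ "\<lambda>_. 0"] sym[OF iffD2[OF diagonal_field_eq_0_iff]] refl)
  next
    case (step c x y)
    obtain w w' where w: "x = diagonal_field w" "y = diagonal_field w'"
      using step diag_B by blast
    have "vscaleC c x + y = diagonal_field (\<lambda>i. c * w i + w' i)"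
      unfolding w by (intro ext cps_eqI)
        (simp add: coeff_simps vscaleC_apply coeff_cscale coeff_diagonal_field weight_def sum_distrib_left
          sum_distrib_right sum.distrib algebra_simps)
    then show ?case by blast
  qed
  have commute: "vbracket (pullback x) (pullback y) = 0" if xy: "x \<in> B" "y \<in> B" for x y
  proof -
    obtain w w' where w: "x = diagonal_field w" "y = diagonal_field w'"
      using xy diag_B by blast
    have "x (y z) = y (x z)" for z
      unfolding w by (rule cps_eqI) (simp add: coeff_diagonal_field)
    then show ?thesis
      by (simp add: vbracket_def pullback_def \<phi>\<psi> fun_eq_iff)
  qed
  have linear_part_0: "\<eta> x \<in> order_ge (Suc (Suc 0))"
    if "\<eta> \<in> Der_log_ideal f 1" "x \<in> order_ge (Suc 0)" for \<eta> x
    using vfield.module_axioms that(1)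
  proof (rule ideal_prod_induct)
    show "vscale a \<theta> x \<in> order_ge (Suc (Suc 0))" if "a \<in> max_ideal_power 1" "\<theta> \<in> Der_log f" for a \<theta>
      using that \<open>x \<in> order_ge (Suc 0)\<close> max_ideal_power_1_subset Der_log_max_ideal[OF f that(2), of x]
      by (auto simp: vscale_def order_ge_1 intro!: order_ge_Suc_mult)
  qed (use max_ideal_power_closed[of 1] in \<open>auto intro: order_ge_add\<close>)
  have pullback_diag: "diagonal_field w = 0" if "pullback (diagonal_field w) \<in> Der_log_ideal f 1" for w
  proof -
    have "w i = 0" for i
    proof -
      have "pullback (diagonal_field w) (\<psi> (cps_X i)) \<in> order_ge (Suc (Suc 0))"
        using that \<psi>.hom_order_ge[OF X_order_ge] by (rule linear_part_0)
      then have "\<phi> (pullback (diagonal_field w) (\<psi> (cps_X i))) \<in> order_ge (Suc (Suc 0))"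
        by (rule \<phi>.hom_order_ge)
      then have "cscale (w i) (cps_X i) \<in> order_ge (Suc (Suc 0))"
        by (simp add: pullback_def \<phi>\<psi> diagonal_field_X)
      moreover have "total_degree (0(i := 1)) = 1"
        using total_degree_upd[of 0 i 1] by (simp add: total_degree_def)
      ultimately have "coeff (cscale (w i) (cps_X i)) (0(i := 1)) = 0"
        unfolding order_ge_def by fastforce
      then show ?thesis
        by (simp add: coeff_cscale cps_X.rep_eq)
    qed
    then show ?thesis
      by (simp only: diagonal_field_eq_0_iff) blast
  qed
  have indep: "pullback b \<notin> vfieldC.span (pullback ` B - {pullback b} \<union> Der_log_ideal f 1)" if b: "b \<in> B" for b
  proof
    assume "pullback b \<in> vfieldC.span (pullback ` B - {pullback b} \<union> Der_log_ideal f 1)"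
    moreover have "pullback ` B - {pullback b} = pullback ` (B - {b})"
      using pullback_inj by (auto simp: inj_def)
    ultimately obtain x i where xi: "x \<in> vfieldC.span (pullback ` (B - {b}))"
        "i \<in> vfieldC.span (Der_log_ideal f 1)" "pullback b = x + i"
      by (auto simp: vfieldC.span_Un)
    have i: "i \<in> Der_log_ideal f 1"
      using xi(2) unfolding vfieldC.span_eq_iff[THEN iffD2, OF subspaceC_Der_log_ideal] .
    obtain \<sigma> where \<sigma>: "\<sigma> \<in> vfieldC.span (B - {b})" "x = pullback \<sigma>"
      using xi(1) pullback.span_image[of "B - {b}"] by auto
    have "b - \<sigma> \<in> vfieldC.span B"
      using b \<sigma>(1) vfieldC.span_mono[of "B - {b}" B] by (intro vfieldC.span_diff) (auto intro: vfieldC.span_base)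
    then obtain w where w: "b - \<sigma> = diagonal_field w"
      using diag_span by blast
    have "pullback (b - \<sigma>) = i"
      using xi(3) \<sigma>(2) by (simp add: pullback.diff)
    then have "b - \<sigma> = 0"
      using i pullback_diag by (simp add: w)
    then show False
      using \<sigma>(1) B(3) b by (auto simp: vfieldC.dependent_def)
  qed
  show ?thesis
  proof (intro exI[of _ "pullback ` B"] conjI ballI)
    show "card (pullback ` B) = s_invariant f"
      using card_image[OF inj_on_subset[OF pullback_inj], of B] B(4) g(2) by simp
    show "pullback ` B \<subseteq> Der_log f"
      using B(1) pullback_Der_log by (auto simp: diagonal_symmetries_def)
  qed (use B(2) commute indep in auto)
qed

theorem proposition6p1:
  fixes f :: "'n::finite cps"
  assumes "f \<noteq> 0" and "\<not> is_product f"
  shows "(\<forall>r. is_min_number_of_generators (Der_log f) (s_invariant f + r) \<and>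
              (r \<le> 1 \<or> s_invariant f = 0) \<longrightarrow>
              (\<forall>d\<ge>1. solvable_lie (Der_log_quotient f d))) \<and>
         (free_of_rank (Der_log f) 2 \<longrightarrow>
              (\<forall>d\<ge>1. solvable_lie (Der_log_quotient f d)))"
proof (intro conjI allI impI; (elim conjE)?)
  interpret L: lie_algebra_mod vscaleC vbracket "Der_log f" "Der_log_ideal f 1"
    using assms(2) by (rule lie_algebra_mod_Der_log)
  fix r d :: nat
  assume d: "1 \<le> d" and "is_min_number_of_generators (Der_log f) (s_invariant f + r)"
    and r: "r \<le> 1 \<or> s_invariant f = 0"
  then obtain G where G: "finite G" "card G = s_invariant f + r" "vfield.span G = Der_log f"
    by (auto simp: is_min_number_of_generators_def)
  note span_G = Der_log_subset_span_generators[OF G(1,3)]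
  have "\<exists>k. L.derived k \<subseteq> Der_log_ideal f 1"
    using r
  proof
    assume s: "s_invariant f = 0"
    show ?thesis
    proof (rule L.solvable_if_ad_nilpotent[OF _ G(1) span_G])
      fix x y assume xy: "x \<in> Der_log f" "y \<in> Der_log f"
      show "\<exists>n. (vbracket x ^^ n) y \<in> Der_log_ideal f 1"
        by (rule ad_nilpotent[OF assms(2) G(1,3) xy(1) Der_log_nilpotent[OF assms(2) s xy(1)] xy(2)])
    qed
  next
    assume "r \<le> 1"
    obtain B where B: "finite B" "card B = s_invariant f" "B \<subseteq> Der_log f"
        "\<And>x y. x \<in> B \<Longrightarrow> y \<in> B \<Longrightarrow> vbracket x y = 0"
        "\<And>b. b \<in> B \<Longrightarrow> b \<notin> vfieldC.span (B - {b} \<union> Der_log_ideal f 1)"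
      using commuting_fields_exist[OF assms(2)] by blast
    obtain G' where G': "G' \<subseteq> G" "card G' + card B \<le> card G"
        "G \<subseteq> vfieldC.span (G' \<union> (B \<union> Der_log_ideal f 1))"
      using vfieldC.exchange_mod[OF G(1) B(1) _ B(5)] B(3) span_G by blast
    \<comment> \<open>Exchanging \<open>s\<close> of the \<open>s + r\<close> generators against \<open>B\<close> leaves at most one.\<close>
    have "finite G'" "card G' \<le> 1"
      using G'(1,2) G(1,2) B(2) \<open>r \<le> 1\<close> finite_subset by auto
    then obtain \<nu> where \<nu>: "G' \<subseteq> {\<nu>}" "\<nu> \<in> Der_log f"
      using G'(1) G(3) vfield.span_superset[of G] vfield.subspace_0[OF subspace_Der_log, of f]
      by (cases "card G'") (auto simp: card_Suc_eq)
    have "G' \<union> (B \<union> Der_log_ideal f 1) \<subseteq> insert \<nu> (B \<union> Der_log_ideal f 1)"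
      using \<nu>(1) by blast
    from vfieldC.span_mono[OF this] G'(3)
    have "vfieldC.span (G \<union> Der_log_ideal f 1) \<subseteq> vfieldC.span (insert \<nu> (B \<union> Der_log_ideal f 1))"
      by (intro vfieldC.span_minimal) (auto intro: vfieldC.span_base)
    with span_G have "Der_log f \<subseteq> vfieldC.span (insert \<nu> (B \<union> Der_log_ideal f 1))"
      by (rule order_trans)
    with B(3) _ \<nu>(2) have "L.derived 2 \<subseteq> Der_log_ideal f 1"
      by (rule L.derived_subset_I_if_commuting_and_one)
         (simp only: B(4) vfieldC.subspace_0[OF subspaceC_Der_log_ideal])
    then show ?thesis ..
  qed
  then show "solvable_lie (Der_log_quotient f d)"
    using solvable_quotient_if_derived_subset[OF assms(2) d] by blast
next
  interpret L: lie_algebra_mod vscaleC vbracket "Der_log f" "Der_log_ideal f 1"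
    using assms(2) by (rule lie_algebra_mod_Der_log)
  fix d :: nat
  assume d: "1 \<le> d" and "free_of_rank (Der_log f) 2"
  then obtain G where G: "finite G" "card G = 2" "vfield.span G = Der_log f"
    by (auto simp: free_of_rank_def)
  then obtain x y where xy: "G = {x, y}"
    by (auto simp: card_2_iff)
  have "x \<in> Der_log f" "y \<in> Der_log f"
    using G(3) vfield.span_superset[of G] by (auto simp: xy)
  moreover have "Der_log f \<subseteq> vfieldC.span (insert y ({x} \<union> Der_log_ideal f 1))"
    using Der_log_subset_span_generators[OF G(1,3)] by (simp add: xy insert_commute)
  ultimately have "L.derived 2 \<subseteq> Der_log_ideal f 1"
    by (intro L.derived_subset_I_if_commuting_and_one[where B = "{x}" and \<nu> = y])
       (auto simp only: L.br_self vfieldC.subspace_0[OF subspaceC_Der_log_ideal] singleton_iff)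
  then show "solvable_lie (Der_log_quotient f d)"
    by (rule solvable_quotient_if_derived_subset[OF assms(2) d])
qed

end
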